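(* Let $\Gamma$ be a group which is hyperbolic relative to a family $\mathcal G$ of amenable subgroups. Then the left and right translation action of $\Gamma\times\Gamma$ on the Stone–Čech remainder $\partial^\beta\Gamma=\beta\Gamma\setminus\Gamma$ is amenable.
   Context: The action of $\Gamma\times\Gamma$ on $\partial^\beta\Gamma$ is the restriction of the continuous extension to $\beta\Gamma$ (the Stone–Čech compactification of the discrete group $\Gamma$) of the action $(s,t)\cdot x=sxt^{-1}$ on $\Gamma$. Relative hyperbolicity (in the sense of Bowditch): $\Gamma$ is hyperbolic relative to $\mathcal G$ if $\Gamma$ admits an action by graph automorphisms on a connected fine hyperbolic graph $K$ with finite quotient (finitely many orbits of vertices and of edges) such that all edge stabilizers are finite, the set of infinite vertex stabilizers is precisely $\mathcal G$, and each element of $\mathcal G$ is finitely generated. Graphs: graphs have no loops or multiple edges; $d$ is the path metric on the vertex set $V(K)$. A finite path of length $n$ is a sequence $x_0x_1\cdots x_n$ of vertices with each $x_i$ equal or adjacent to $x_{i+1}$. A circuit is a closed path ($x_0=x_n$) with $x_0,\dots,x_{n-1}$ distinct. A path $\alpha$ is geodesic if $d(\alpha(m),\alpha(n))=|m-n|$ for all $m,n$. The Gromov product is $\langle x,y\rangle_z=\frac12(d(x,z)+d(y,z)-d(x,y))$. $K$ is hyperbolic if there is $\delta>0$ such that for any finite geodesic paths $\alpha$ and $\beta$ starting at a common vertex $z$ and ending at $\alpha_+$ and $\beta_+$, and any $k\le\langle\alpha_+,\beta_+\rangle_z$, one has $d(\alpha(k),\beta(k))<\delta$. $K$ is fine if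 for every $n$ and every edge $e$, the set of circuits of length at most $n$ containing $e$ is finite. Amenable action: for a discrete group $G$, $\mathrm{Prob}(G)=\{\mu\in\ell_1(G):\mu\ge0,\ \sum_{s}\mu(s)=1\}$ with the pointwise convergence topology (which coincides with the $\ell_1$-norm topology), and $(s\cdot\mu)(t)=\mu(s^{-1}t)$. An action of $G$ by homeomorphisms on a compact Hausdorff space $\Omega$ is amenable if for every finite $E\subset G$ and $\varepsilon>0$ there is a continuous map $\mu\colon\Omega\to\mathrm{Prob}(G)$, $\omega\mapsto\mu_\omega$, with $\max_{s\in E}\sup_{\omega\in\Omega}\|s\cdot\mu_\omega-\mu_{s\omega}\|_1\le\varepsilon$. A group is amenable iff its action on a one-point space is amenable. *)

theory Defs
  imports "HOL-Analysis.Analysis" "HOL-Algebra.Group_Action" "HOL-Algebra.Generated_Groups"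
begin

section \<open>Graphs\<close>

text \<open>
  A graph is a vertex set \<open>V\<close> with a set \<open>E\<close> of two-element subsets of \<open>V\<close>. A path of length \<open>n\<close>
  is a list of \<open>n + 1\<close> vertices; as consecutive vertices may coincide, a path may pause.
\<close>

definition graph :: "'v set \<Rightarrow> 'v set set \<Rightarrow> bool" where
  "graph V E \<longleftrightarrow> (\<forall>e\<in>E. e \<subseteq> V \<and> card e = 2)"

definition graph_path :: "'v set \<Rightarrow> 'v set set \<Rightarrow> 'v list \<Rightarrow> bool" where
  "graph_path V E p \<longleftrightarrow> p \<noteq> [] \<and> set p \<subseteq> V \<and>
     (\<forall>i. Suc i < length p \<longrightarrow> p ! i = p ! Suc i \<or> {p ! i, p ! Suc i} \<in> E)"

definition path_length :: "'v list \<Rightarrow> nat" where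
  "path_length p = length p - 1"

definition connected_graph :: "'v set \<Rightarrow> 'v set set \<Rightarrow> bool" where
  "connected_graph V E \<longleftrightarrow> V \<noteq> {} \<and>
     (\<forall>x\<in>V. \<forall>y\<in>V. \<exists>p. graph_path V E p \<and> hd p = x \<and> last p = y)"

text \<open>Only meaningful if \<open>x\<close> and \<open>y\<close> are joined by a path.\<close>

definition graph_dist :: "'v set \<Rightarrow> 'v set set \<Rightarrow> 'v \<Rightarrow> 'v \<Rightarrow> nat" where
  "graph_dist V E x y =
     (LEAST n. \<exists>p. graph_path V E p \<and> hd p = x \<and> last p = y \<and> path_length p = n)"

definition geodesic_path :: "'v set \<Rightarrow> 'v set set \<Rightarrow> 'v list \<Rightarrow> bool" where
  "geodesic_path V E p \<longleftrightarrow> graph_path V E p \<and>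
     (\<forall>m < length p. \<forall>n < length p. int (graph_dist V E (p ! m) (p ! n)) = \<bar>int m - int n\<bar>)"

definition gromov_product :: "'v set \<Rightarrow> 'v set set \<Rightarrow> 'v \<Rightarrow> 'v \<Rightarrow> 'v \<Rightarrow> real" where
  "gromov_product V E x y z =
     (real (graph_dist V E x z) + real (graph_dist V E y z) - real (graph_dist V E x y)) / 2"

text \<open>
  The Gromov product of the end points is at most the length of either path, so the indices \<open>k\<close>
  below are valid.
\<close>

definition hyperbolic_graph :: "'v set \<Rightarrow> 'v set set \<Rightarrow> bool" where
  "hyperbolic_graph V E \<longleftrightarrow> (\<exists>\<delta>::real. \<delta> > 0 \<and>
     (\<forall>\<alpha> \<beta>. geodesic_path V E \<alpha> \<longrightarrow> geodesic_path V E \<beta> \<longrightarrow> hd \<alpha> = hd \<beta> \<longrightarrow>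
       (\<forall>k::nat. real k \<le> gromov_product V E (last \<alpha>) (last \<beta>) (hd \<alpha>) \<longrightarrow>
          real (graph_dist V E (\<alpha> ! k) (\<beta> ! k)) < \<delta>)))"

definition circuit :: "'v set \<Rightarrow> 'v set set \<Rightarrow> 'v list \<Rightarrow> bool" where
  "circuit V E p \<longleftrightarrow> graph_path V E p \<and> hd p = last p \<and> distinct (butlast p)"

definition path_contains_edge :: "'v list \<Rightarrow> 'v set \<Rightarrow> bool" where
  "path_contains_edge p e \<longleftrightarrow> (\<exists>i. Suc i < length p \<and> e = {p ! i, p ! Suc i})"

definition fine_graph :: "'v set \<Rightarrow> 'v set set \<Rightarrow> bool" where
  "fine_graph V E \<longleftrightarrow>
     (\<forall>n. \<forall>e\<in>E. finite {p. circuit V E p \<and> path_length p \<le> n \<and> path_contains_edge p e})"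

section \<open>Relative hyperbolicity\<close>

text \<open>Stabilizers of edges are setwise.\<close>

definition edge_action :: "('a \<Rightarrow> 'v \<Rightarrow> 'v) \<Rightarrow> 'a \<Rightarrow> 'v set \<Rightarrow> 'v set" where
  "edge_action \<phi> g e = \<phi> g ` e"

definition graph_action ::
    "('a, 'b) monoid_scheme \<Rightarrow> 'v set \<Rightarrow> 'v set set \<Rightarrow> ('a \<Rightarrow> 'v \<Rightarrow> 'v) \<Rightarrow> bool" where
  "graph_action G V E \<phi> \<longleftrightarrow> group_action G V \<phi> \<and>
     (\<forall>g\<in>carrier G. \<forall>x\<in>V. \<forall>y\<in>V. {\<phi> g x, \<phi> g y} \<in> E \<longleftrightarrow> {x, y} \<in> E)"

definition finitely_generated_subgroup :: "('a, 'b) monoid_scheme \<Rightarrow> 'a set \<Rightarrow> bool" where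
  "finitely_generated_subgroup G H \<longleftrightarrow> (\<exists>S. finite S \<and> S \<subseteq> carrier G \<and> generate G S = H)"

text \<open>
  HOL has no existential quantification over types, so the type of the vertices of the graph is a
  parameter. A theorem assuming \<open>relatively_hyperbolic TYPE('v) G \<G>\<close> with a type variable \<open>'v\<close>
  covers graphs on any type.
\<close>

definition relatively_hyperbolic ::
    "'v itself \<Rightarrow> ('a, 'b) monoid_scheme \<Rightarrow> 'a set set \<Rightarrow> bool" where
  "relatively_hyperbolic _ G \<G> \<longleftrightarrow> (\<exists>(V :: 'v set) E \<phi>.
     graph V E \<and> connected_graph V E \<and> fine_graph V E \<and> hyperbolic_graph V E \<and>
     graph_action G V E \<phi> \<and>
     finite (orbits G V \<phi>) \<and> finite (orbits G E (edge_action \<phi>)) \<and>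
     (\<forall>e\<in>E. finite (stabilizer G (edge_action \<phi>) e)) \<and>
     {stabilizer G \<phi> v | v. v \<in> V \<and> infinite (stabilizer G \<phi> v)} = \<G> \<and>
     (\<forall>H\<in>\<G>. finitely_generated_subgroup G H))"

section \<open>Amenable actions\<close>

text \<open>Functions on \<open>G\<close> are extensional, i.e. \<open>undefined\<close> outside \<open>carrier G\<close>.\<close>

definition Prob :: "('a, 'b) monoid_scheme \<Rightarrow> ('a \<Rightarrow> real) set" where
  "Prob G = {\<mu> \<in> carrier G \<rightarrow>\<^sub>E {0..}. (\<mu> has_sum 1) (carrier G)}"

definition Prob_topology :: "('a, 'b) monoid_scheme \<Rightarrow> ('a \<Rightarrow> real) topology" where
  "Prob_topology G = subtopology (product_topology (\<lambda>_. euclideanreal) (carrier G)) (Prob G)"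

definition left_translate ::
    "('a, 'b) monoid_scheme \<Rightarrow> 'a \<Rightarrow> ('a \<Rightarrow> real) \<Rightarrow> 'a \<Rightarrow> real" where
  "left_translate G s \<mu> = (\<lambda>t\<in>carrier G. \<mu> (inv\<^bsub>G\<^esub> s \<otimes>\<^bsub>G\<^esub> t))"

definition l1_norm :: "('a, 'b) monoid_scheme \<Rightarrow> ('a \<Rightarrow> real) \<Rightarrow> real" where
  "l1_norm G f = (\<Sum>\<^sub>\<infinity>t\<in>carrier G. \<bar>f t\<bar>)"

definition action_by_homeomorphisms ::
    "('a, 'b) monoid_scheme \<Rightarrow> 'c topology \<Rightarrow> ('a \<Rightarrow> 'c \<Rightarrow> 'c) \<Rightarrow> bool" where
  "action_by_homeomorphisms G X \<phi> \<longleftrightarrow>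
     group_action G (topspace X) \<phi> \<and> (\<forall>g\<in>carrier G. homeomorphic_map X X (\<phi> g))"

definition amenable_action ::
    "('a, 'b) monoid_scheme \<Rightarrow> 'c topology \<Rightarrow> ('a \<Rightarrow> 'c \<Rightarrow> 'c) \<Rightarrow> bool" where
  "amenable_action G X \<phi> \<longleftrightarrow>
     compact_space X \<and> Hausdorff_space X \<and> action_by_homeomorphisms G X \<phi> \<and>
     (\<forall>E (\<epsilon>::real). finite E \<longrightarrow> E \<subseteq> carrier G \<longrightarrow> \<epsilon> > 0 \<longrightarrow>
        (\<exists>\<mu>. continuous_map X (Prob_topology G) \<mu> \<and>
          (\<forall>s\<in>E. \<forall>\<omega>\<in>topspace X.
             l1_norm G (\<lambda>t. left_translate G s (\<mu> \<omega>) t - \<mu> (\<phi> s \<omega>) t) \<le> \<epsilon>)))"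

definition amenable_group :: "('a, 'b) monoid_scheme \<Rightarrow> bool" where
  "amenable_group G \<longleftrightarrow> amenable_action G (discrete_topology {()}) (\<lambda>_. \<lambda>x\<in>{()}. x)"

section \<open>The Stone--Cech compactification of a discrete space\<close>

text \<open>
  The Stone--Cech compactification of the discrete space \<open>X\<close> is the space of ultrafilters on \<open>X\<close>,
  with the Stone topology; the points of \<open>X\<close> are identified with the principal ultrafilters. The
  lemmas \<open>compact_space_beta\<close>, \<open>Hausdorff_space_beta\<close>, \<open>beta_points_dense\<close> and \<open>beta_universal\<close> below
  are the defining properties; by the last one the description in \<open>beta_extension\<close> is proper.
\<close>

definition ultrafilters_on :: "'a set \<Rightarrow> 'a filter set" where
  "ultrafilters_on X = {F. F \<noteq> bot \<and> F \<le> principal X \<and>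
     (\<forall>A. eventually (\<lambda>x. x \<in> A) F \<or> eventually (\<lambda>x. x \<notin> A) F)}"

definition beta :: "'a set \<Rightarrow> 'a filter topology" where
  "beta X = topology_generated_by
     {{F \<in> ultrafilters_on X. eventually (\<lambda>x. x \<in> A) F} | A. A \<subseteq> X}"

definition beta_point :: "'a \<Rightarrow> 'a filter" where
  "beta_point x = principal {x}"

definition beta_remainder :: "'a set \<Rightarrow> 'a filter topology" where
  "beta_remainder X = subtopology (beta X) (topspace (beta X) - beta_point ` X)"

definition beta_extension :: "'a set \<Rightarrow> ('a \<Rightarrow> 'a) \<Rightarrow> 'a filter \<Rightarrow> 'a filter" where
  "beta_extension X f = (THE g. g \<in> extensional (topspace (beta X)) \<and>
     continuous_map (beta X) (beta X) g \<and> (\<forall>x\<in>X. g (beta_point x) = beta_point (f x)))"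

lemma topspace_beta: "topspace (beta X) = ultrafilters_on X"
proof -
  have "eventually (\<lambda>x. x \<in> X) F" if "F \<in> ultrafilters_on X" for F
    using that by (simp add: ultrafilters_on_def le_principal)
  then show ?thesis
    unfolding beta_def by auto
qed

lemma ultrafilters_on_not:
  assumes "F \<in> ultrafilters_on X"
  shows "eventually (\<lambda>x. \<not> P x) F \<longleftrightarrow> \<not> eventually P F"
proof -
  have "F \<noteq> bot" and "eventually (\<lambda>x. x \<in> {x. P x}) F \<or> eventually (\<lambda>x. x \<notin> {x. P x}) F"
    using assms unfolding ultrafilters_on_def by blast+
  then show ?thesis
    by (metis (mono_tags, lifting) eventually_const eventually_elim2 mem_Collect_eq)
qed

lemma openin_beta_basic: "openin (beta X) {F \<in> ultrafilters_on X. eventually P F}"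
proof -
  have "{F \<in> ultrafilters_on X. eventually P F} =
      {F \<in> ultrafilters_on X. eventually (\<lambda>x. x \<in> {x \<in> X. P x}) F}"
    by (auto simp: ultrafilters_on_def le_principal eventually_conj_iff)
  also have "openin (beta X) \<dots>"
    unfolding beta_def by (intro topology_generated_by_Basis) blast
  finally show ?thesis .
qed

lemma openin_beta_nbhd:
  assumes "openin (beta X) W" "F \<in> W"
  obtains A where "A \<subseteq> X" "eventually (\<lambda>x. x \<in> A) F"
    "{H \<in> ultrafilters_on X. eventually (\<lambda>x. x \<in> A) H} \<subseteq> W"
proof -
  have "generate_topology_on {{F \<in> ultrafilters_on X. eventually (\<lambda>x. x \<in> A) F} | A. A \<subseteq> X} W"
    using assms(1) unfolding beta_def by (rule openin_topology_generated_by)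
  then have "\<forall>F\<in>W. \<exists>A\<subseteq>X. eventually (\<lambda>x. x \<in> A) F \<and>
      {H \<in> ultrafilters_on X. eventually (\<lambda>x. x \<in> A) H} \<subseteq> W"
  proof induction
    case (Int a b)
    show ?case
    proof
      fix F assume "F \<in> a \<inter> b"
      with Int.IH obtain A B where A: "A \<subseteq> X" "eventually (\<lambda>x. x \<in> A) F"
          "{H \<in> ultrafilters_on X. eventually (\<lambda>x. x \<in> A) H} \<subseteq> a"
        and B: "eventually (\<lambda>x. x \<in> B) F"
          "{H \<in> ultrafilters_on X. eventually (\<lambda>x. x \<in> B) H} \<subseteq> b"
        by (meson IntD1 IntD2)
      then have "eventually (\<lambda>x. x \<in> A \<inter> B) F"
          "{H \<in> ultrafilters_on X. eventually (\<lambda>x. x \<in> A \<inter> B) H} \<subseteq> a \<inter> b"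
        by (auto simp: eventually_conj_iff)
      with A(1) show "\<exists>A\<subseteq>X. eventually (\<lambda>x. x \<in> A) F \<and>
          {H \<in> ultrafilters_on X. eventually (\<lambda>x. x \<in> A) H} \<subseteq> a \<inter> b"
        by (metis le_infI1)
    qed
  next
    case (UN K)
    show ?case
    proof
      fix F assume "F \<in> \<Union>K"
      then obtain k where k: "k \<in> K" "F \<in> k"
        by blast
      with UN.IH obtain A where "A \<subseteq> X" "eventually (\<lambda>x. x \<in> A) F"
          "{H \<in> ultrafilters_on X. eventually (\<lambda>x. x \<in> A) H} \<subseteq> k"
        by meson
      with k show "\<exists>A\<subseteq>X. eventually (\<lambda>x. x \<in> A) F \<and>
          {H \<in> ultrafilters_on X. eventually (\<lambda>x. x \<in> A) H} \<subseteq> \<Union>K"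
        by (meson Sup_upper subset_trans)
    qed
  qed blast+
  with assms(2) that show ?thesis
    by meson
qed

lemma beta_point_in: "x \<in> X \<Longrightarrow> beta_point x \<in> topspace (beta X)"
  by (auto simp: topspace_beta ultrafilters_on_def beta_point_def eventually_principal
      principal_eq_bot_iff)

lemma Hausdorff_space_beta: "Hausdorff_space (beta X)"
  unfolding Hausdorff_space_def
proof (intro allI impI, elim conjE)
  fix F H :: "'a filter"
  assume F: "F \<in> topspace (beta X)" and H: "H \<in> topspace (beta X)" and "F \<noteq> H"
  then obtain P where P: "eventually P F \<noteq> eventually P H"
    by (auto simp: filter_eq_iff)
  let ?U = "\<lambda>P. {F \<in> ultrafilters_on X. eventually P F}"
  have dis: "disjnt (?U P) (?U (\<lambda>x. \<not> P x))"
    by (auto simp: disjnt_def ultrafilters_on_not)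
  show "\<exists>U V. openin (beta X) U \<and> openin (beta X) V \<and> F \<in> U \<and> H \<in> V \<and> disjnt U V"
  proof (cases "eventually P F")
    case True
    with P F H have "F \<in> ?U P" "H \<in> ?U (\<lambda>x. \<not> P x)"
      by (auto simp: topspace_beta ultrafilters_on_not)
    with dis show ?thesis
      using openin_beta_basic by blast
  next
    case False
    with P F H have "H \<in> ?U P" "F \<in> ?U (\<lambda>x. \<not> P x)"
      by (auto simp: topspace_beta ultrafilters_on_not)
    with dis show ?thesis
      by (intro exI[of _ "?U (\<lambda>x. \<not> P x)"] exI[of _ "?U P"])
        (simp add: openin_beta_basic disjnt_sym)
  qed
qed

lemma beta_points_dense: "(beta X) closure_of (beta_point ` X) = topspace (beta X)"
proof -
  have "F \<in> (beta X) closure_of (beta_point ` X)" if F: "F \<in> topspace (beta X)" for F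
    unfolding in_closure_of
  proof (intro conjI F allI impI, elim conjE)
    fix W assume "F \<in> W" "openin (beta X) W"
    then obtain A where A: "A \<subseteq> X" "eventually (\<lambda>x. x \<in> A) F"
      "{H \<in> ultrafilters_on X. eventually (\<lambda>x. x \<in> A) H} \<subseteq> W"
      by (metis openin_beta_nbhd)
    moreover have "F \<noteq> bot"
      using F by (simp add: topspace_beta ultrafilters_on_def)
    ultimately obtain a where a: "a \<in> A"
      by (metis (no_types, lifting) eventually_happens')
    then have "beta_point a \<in> {H \<in> ultrafilters_on X. eventually (\<lambda>x. x \<in> A) H}"
      using A(1) beta_point_in[of a X]
      by (auto simp: topspace_beta beta_point_def eventually_principal)
    with A a show "\<exists>y. y \<in> beta_point ` X \<and> y \<in> W"
      by blast
  qed
  then show ?thesis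
    using closure_of_subset_topspace[of "beta X" "beta_point ` X"] by (intro equalityI subsetI) auto
qed

lemma ex_ultrafilter_le:
  fixes F :: "'a filter"
  assumes F: "F \<noteq> bot" "F \<le> principal X"
  obtains U where "U \<in> ultrafilters_on X" "U \<le> F"
proof -
  let ?R = "{(b, a). a \<noteq> bot \<and> a \<le> b \<and> b \<le> F}"
  have Fld: "Field ?R = {G. G \<noteq> bot \<and> G \<le> F}"
    by (auto simp: Field_def bot_unique)
  have "\<exists>m\<in>Field ?R. \<forall>a\<in>Field ?R. (m, a) \<in> ?R \<longrightarrow> a = m"
  proof (rule Zorns_po_lemma)
    show "Partial_order ?R"
      by (auto simp: partial_order_on_def preorder_on_def
          antisym_def refl_on_def trans_def Field_def bot_unique)
    fix C assume C: "C \<in> Chains ?R"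
    show "\<exists>u\<in>Field ?R. \<forall>a\<in>C. (a, u) \<in> ?R"
    proof (cases "C = {}")
      case True
      with F(1) Fld show ?thesis
        by blast
    next
      case False
      have C_le: "c \<noteq> bot \<and> c \<le> F" if "c \<in> C" for c
        using C that by (auto simp: Chains_def)
      have "Inf C = bot \<longleftrightarrow> (\<exists>x\<in>C. x = bot)"
        using C False unfolding trivial_limit_def
        by (intro eventually_Inf_base) (auto simp: Chains_def)
      then have "Inf C \<noteq> bot"
        using C_le by blast
      moreover have "Inf C \<le> F"
        using False C_le by (meson Inf_lower2 ex_in_conv)
      ultimately show ?thesis
        using C_le unfolding Fld by (intro bexI[of _ "Inf C"]) (auto intro: Inf_lower)
    qed
  qed
  then obtain U where U: "U \<noteq> bot" "U \<le> F"
    and max: "\<And>G. G \<noteq> bot \<Longrightarrow> G \<le> U \<Longrightarrow> G = U"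
    unfolding Fld by (auto intro: order_trans)
  have "eventually (\<lambda>x. x \<in> A) U \<or> eventually (\<lambda>x. x \<notin> A) U" for A
  proof (rule disjCI)
    assume "\<not> eventually (\<lambda>x. x \<notin> A) U"
    then have "inf U (principal A) \<noteq> bot"
      by (simp add: trivial_limit_def eventually_inf_principal)
    from max[OF this] have "U \<le> principal A"
      by (metis inf_le1 inf_le2)
    then show "eventually (\<lambda>x. x \<in> A) U"
      by (simp add: le_principal)
  qed
  with U F(2) have "U \<in> ultrafilters_on X"
    by (auto simp: ultrafilters_on_def)
  with U(2) that show thesis
    by blast
qed

lemma compact_space_beta: "compact_space (beta X)"
  unfolding compact_space_alt
proof (intro allI impI, elim conjE)
  fix \<U> assume op: "\<forall>U\<in>\<U>. openin (beta X) U" and cov: "topspace (beta X) \<subseteq> \<Union>\<U>"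
  define hat where "hat A = {F \<in> ultrafilters_on X. eventually (\<lambda>x. x \<in> A) F}" for A
  define \<A> where "\<A> = {A. A \<subseteq> X \<and> (\<exists>U\<in>\<U>. hat A \<subseteq> U)}"
  have cov': "\<exists>A\<in>\<A>. eventually (\<lambda>x. x \<in> A) F" if "F \<in> ultrafilters_on X" for F
  proof -
    from that cov obtain U where "U \<in> \<U>" "F \<in> U"
      by (auto simp: topspace_beta)
    with op obtain A where "A \<subseteq> X" "eventually (\<lambda>x. x \<in> A) F" "hat A \<subseteq> U"
      unfolding hat_def by (metis openin_beta_nbhd)
    with \<open>U \<in> \<U>\<close> show ?thesis
      unfolding \<A>_def by blast
  qed
  have "\<exists>\<B>. finite \<B> \<and> \<B> \<subseteq> \<A> \<and> X \<subseteq> \<Union>\<B>"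
  proof (rule ccontr)
    assume no: "\<not> ?thesis"
    define F where "F = (INF \<B>\<in>{\<B>. finite \<B> \<and> \<B> \<subseteq> \<A>}. principal (X - \<Union>\<B>))"
    have ev: "eventually P F \<longleftrightarrow> (\<exists>\<B>. finite \<B> \<and> \<B> \<subseteq> \<A> \<and> (\<forall>x\<in>X - \<Union>\<B>. P x))" for P
      unfolding F_def
    proof (subst eventually_INF_base)
      fix a b assume "a \<in> {\<B>. finite \<B> \<and> \<B> \<subseteq> \<A>}" "b \<in> {\<B>. finite \<B> \<and> \<B> \<subseteq> \<A>}"
      then show "\<exists>x\<in>{\<B>. finite \<B> \<and> \<B> \<subseteq> \<A>}.
          principal (X - \<Union>x) \<le> inf (principal (X - \<Union>a)) (principal (X - \<Union>b))"
        by (intro bexI[of _ "a \<union> b"]) auto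
    qed (auto simp: eventually_principal)
    have "F \<noteq> bot"
      using no unfolding trivial_limit_def ev by blast
    moreover have "F \<le> principal X"
      unfolding le_principal ev by (metis DiffD1 empty_subsetI finite.emptyI)
    ultimately obtain U where U: "U \<in> ultrafilters_on X" "U \<le> F"
      by (rule ex_ultrafilter_le)
    then obtain A where A: "A \<in> \<A>" "eventually (\<lambda>x. x \<in> A) U"
      using cov' by blast
    then have "eventually (\<lambda>x. x \<notin> A) F"
      unfolding ev by (intro exI[of _ "{A}"]) auto
    then have "eventually (\<lambda>x. x \<notin> A) U"
      using U(2) filter_leD by blast
    with A(2) U(1) show False
      by (simp add: ultrafilters_on_not)
  qed
  then obtain \<B> where \<B>: "finite \<B>" "\<B> \<subseteq> \<A>" "X \<subseteq> \<Union>\<B>"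
    by blast
  then have "\<forall>A\<in>\<B>. \<exists>U. U \<in> \<U> \<and> hat A \<subseteq> U"
    by (auto simp: \<A>_def)
  then obtain u where u: "\<forall>A\<in>\<B>. u A \<in> \<U> \<and> hat A \<subseteq> u A"
    using bchoice[of \<B> "\<lambda>A U. U \<in> \<U> \<and> hat A \<subseteq> U"] by blast
  have "\<exists>A\<in>\<B>. F \<in> hat A" if F: "F \<in> ultrafilters_on X" for F
  proof (rule ccontr)
    assume "\<not> ?thesis"
    then have "\<forall>A\<in>\<B>. eventually (\<lambda>x. x \<notin> A) F"
      using F by (auto simp: hat_def ultrafilters_on_not)
    then have "eventually (\<lambda>x. \<forall>A\<in>\<B>. x \<notin> A) F"
      using \<B>(1) by (simp add: eventually_ball_finite)
    moreover have "eventually (\<lambda>x. x \<in> X) F"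
      using F by (simp add: ultrafilters_on_def le_principal)
    ultimately have "eventually (\<lambda>x. False) F"
      by (rule eventually_elim2) (use \<B>(3) in blast)
    with F show False
      by (simp add: ultrafilters_on_def)
  qed
  then have "topspace (beta X) \<subseteq> \<Union>(u ` \<B>)"
    using u by (fastforce simp: topspace_beta)
  then show "\<exists>\<F>. finite \<F> \<and> \<F> \<subseteq> \<U> \<and> topspace (beta X) \<subseteq> \<Union>\<F>"
    using \<B>(1) u by (intro exI[of _ "u ` \<B>"]) auto
qed

lemma beta_universal:
  assumes K: "compact_space K" "Hausdorff_space K" and f: "f \<in> X \<rightarrow> topspace K"
  shows "\<exists>!g. g \<in> extensional (topspace (beta X)) \<and> continuous_map (beta X) K g \<and>
    (\<forall>x\<in>X. g (beta_point x) = f x)"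
proof -
  have ex: "\<exists>l. limitin K f l F" if F: "F \<in> ultrafilters_on X" for F
  proof (rule ccontr)
    assume no: "\<not> ?thesis"
    define \<U> where "\<U> = {U. openin K U \<and> eventually (\<lambda>x. f x \<notin> U) F}"
    have "topspace K \<subseteq> \<Union>\<U>"
    proof
      fix l assume "l \<in> topspace K"
      with no obtain U where "openin K U" "l \<in> U" "\<not> eventually (\<lambda>x. f x \<in> U) F"
        unfolding limitin_def by blast
      with F show "l \<in> \<Union>\<U>"
        unfolding \<U>_def by (auto simp: ultrafilters_on_not)
    qed
    moreover have "\<forall>U\<in>\<U>. openin K U"
      by (simp add: \<U>_def)
    ultimately obtain \<F> where \<F>: "finite \<F>" "\<F> \<subseteq> \<U>" "topspace K \<subseteq> \<Union>\<F>"
      using K(1) unfolding compact_space_alt by meson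
    then have "eventually (\<lambda>x. \<forall>U\<in>\<F>. f x \<notin> U) F"
      by (intro eventually_ball_finite) (auto simp: \<U>_def)
    moreover have "eventually (\<lambda>x. x \<in> X) F"
      using F by (simp add: ultrafilters_on_def le_principal)
    ultimately have "eventually (\<lambda>x. False) F"
      by (rule eventually_elim2) (use \<F>(3) f in blast)
    with F show False
      by (simp add: ultrafilters_on_def)
  qed
  define g where "g = (\<lambda>F\<in>topspace (beta X). SOME l. limitin K f l F)"
  have lim: "limitin K f (g F) F" if "F \<in> ultrafilters_on X" for F
    using someI_ex[OF ex[OF that]] that by (simp add: g_def topspace_beta)
  have "continuous_map (beta X) K g"
    unfolding continuous_map_atin
  proof
    fix F assume "F \<in> topspace (beta X)"
    then have F: "F \<in> ultrafilters_on X"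
      by (simp add: topspace_beta)
    show "limitin K g (g F) (atin (beta X) F)"
      unfolding limitin_def
    proof (intro conjI allI impI, goal_cases)
      case 1
      show ?case
        using lim[OF F] by (rule limitin_topspace)
    next
      case (2 W)
      have "neighbourhood_base_of (closedin K) K"
        using K compact_Hausdorff_imp_regular_space neighbourhood_base_of_closedin by blast
      with 2 obtain U C where UC: "openin K U" "closedin K C" "g F \<in> U" "U \<subseteq> C" "C \<subseteq> W"
        unfolding neighbourhood_base_of by meson
      let ?V = "{H \<in> ultrafilters_on X. eventually (\<lambda>x. f x \<in> U) H}"
      have "g H \<in> W" if H: "H \<in> ?V" for H
      proof (rule ccontr)
        assume "g H \<notin> W"
        with UC lim[of H] H have "g H \<in> topspace K - C"
          by (auto simp: limitin_def)
        with UC(2) lim[of H] H have "eventually (\<lambda>x. f x \<in> topspace K - C) H"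
          by (intro limitinD[where l = "g H" and F = H]) (auto intro: openin_diff)
        moreover have "eventually (\<lambda>x. f x \<in> U) H"
          using H by simp
        ultimately have "eventually (\<lambda>x. False) H"
          by (rule eventually_elim2) (use UC(4) in blast)
        with H show False
          by (simp add: ultrafilters_on_def)
      qed
      moreover have "openin (beta X) ?V"
        by (rule openin_beta_basic)
      moreover have "F \<in> ?V"
        using F limitinD[OF lim[OF F] UC(1,3)] by simp
      ultimately show ?case
        unfolding eventually_atin by (intro disjI2 exI[of _ ?V]) auto
    qed
  qed
  moreover have "g (beta_point x) = f x" if x: "x \<in> X" for x
  proof -
    have "limitin K f (f x) (beta_point x)"
      using f x by (auto simp: limitin_def beta_point_def eventually_principal)
    moreover have "beta_point x \<in> ultrafilters_on X"
      using beta_point_in[OF x] by (simp add: topspace_beta)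
    moreover have "beta_point x \<noteq> bot"
      by (simp add: beta_point_def principal_eq_bot_iff)
    ultimately show ?thesis
      using limitin_Hausdorff_unique[OF lim _ _ K(2)] by metis
  qed
  moreover have "g \<in> extensional (topspace (beta X))"
    by (simp add: g_def)
  moreover have "h = h'"
    if "h \<in> extensional (topspace (beta X))" "continuous_map (beta X) K h"
      "\<forall>x\<in>X. h (beta_point x) = f x"
      "h' \<in> extensional (topspace (beta X))" "continuous_map (beta X) K h'"
      "\<forall>x\<in>X. h' (beta_point x) = f x" for h h'
  proof (rule extensionalityI[OF that(1,4)])
    fix F assume "F \<in> topspace (beta X)"
    then have F: "F \<in> (beta X) closure_of (beta_point ` X)"
      by (simp add: beta_points_dense)
    show "h F = h' F"
      by (rule forall_in_closure_of_eq[OF F K(2) that(2,5)]) (use that in auto)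
  qed
  ultimately show ?thesis
    by (intro ex1I[of _ g]) blast+
qed

lemma beta_extension:
  assumes "f \<in> X \<rightarrow> X"
  shows "continuous_map (beta X) (beta X) (beta_extension X f)"
    and "x \<in> X \<Longrightarrow> beta_extension X f (beta_point x) = beta_point (f x)"
proof -
  have "\<exists>!g. g \<in> extensional (topspace (beta X)) \<and> continuous_map (beta X) (beta X) g \<and>
      (\<forall>x\<in>X. g (beta_point x) = beta_point (f x))"
    using assms by (intro beta_universal compact_space_beta Hausdorff_space_beta)
      (auto intro: beta_point_in)
  from theI'[OF this]
  show "continuous_map (beta X) (beta X) (beta_extension X f)"
    and "x \<in> X \<Longrightarrow> beta_extension X f (beta_point x) = beta_point (f x)"
    unfolding beta_extension_def by blast+
qed

definition bitranslation ::
    "('a, 'b) monoid_scheme \<Rightarrow> 'a \<times> 'a \<Rightarrow> 'a filter \<Rightarrow> 'a filter" where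
  "bitranslation G = (\<lambda>(s, t). \<lambda>\<omega>\<in>topspace (beta_remainder (carrier G)).
     beta_extension (carrier G) (\<lambda>x. s \<otimes>\<^bsub>G\<^esub> x \<otimes>\<^bsub>G\<^esub> inv\<^bsub>G\<^esub> t) \<omega>)"

end

theory Submission
  imports Defs
begin

text \<open>
  A bounded function on \<open>\<Gamma>\<close> extends to \<open>\<beta>\<Gamma>\<close>, so it suffices to find approximately equivariant means
  at all but finitely many points \<open>x\<close> of \<open>\<Gamma>\<close> that are combinations of finitely many fixed ones.
  Vertex stabilizers are amenable, so means on \<open>\<Gamma>\<close> may be replaced by measures on a finite set of
  vertices of the fine hyperbolic graph, and by taking products it suffices that the measure of
  \<open>s x t\<close> is close to the \<open>s\<close>-translate of that of \<open>x\<close>.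

  Let \<open>g\<close> be a geodesic from a base vertex \<open>z\<close> to \<open>x z\<close>. The size of the turn that \<open>g\<close> makes at a vertex
  depends only on \<open>z\<close> and \<open>x z\<close>, up to a constant, and hardly changes when these are moved a bounded
  distance. The measure of \<open>x\<close> sits at the first vertex where \<open>g\<close> makes a turn of size at least \<open>\<theta>\<close>,
  if there is one near \<open>z\<close>; otherwise \<open>g\<close> starts with small turns, hence in a finite part of the
  graph, and the measure is spread over the vertices at distance between \<open>n\<close> and \<open>2 n\<close> from \<open>z\<close> on
  geodesics between points near \<open>z\<close> and points near \<open>x z\<close>. Averaging over \<open>\<theta>\<close>, and over the meaning
  of ``near'', makes the measures approximately equivariant.
\<close>

section \<open>Geodesics and walks avoiding a vertex\<close>

text \<open>Vertices of infinite valence are the obstacle: the means must be combinations of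
  finitely many fixed ones, so one finite set of vertices has to support the measures of all
  \<open>x\<close>, yet neither balls nor unions of geodesics are finite. Fineness only bounds the
  directions at a vertex that are joined by short walks missing this vertex. Hence a geodesic with
  bounded turns has finitely many possible beginnings, while a vertex with a large turn lies on
  every geodesic with nearby ends and can carry the mass itself.

  Turns are counted in steps of a relation \<open>P\<close> that is chosen after the finite set of
  group elements. It absorbs all constants depending on that set, including the turns along fixed
  geodesics from \<open>z\<close> to \<open>s z\<close>, so the turns of two nearby paths differ by
  at most 4, and the number \<open>L\<close> of thresholds may be chosen last. Short paths without a
  large turn come from finitely many \<open>x\<close>: paths are prolonged by an edge at both ends,
  and edge stabilizers are finite.

  The product that reduces the problem is that of the measures of \<open>x\<close> and of its
  inverse: the inverse of \<open>s x t^-1\<close> is \<open>t x^-1 s^-1\<close>, which begins with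
  \<open>t\<close>.\<close>

locale vertex_metric =
  fixes V :: "'v set" and d :: "'v \<Rightarrow> 'v \<Rightarrow> nat"
  assumes d_eq_0: "x \<in> V \<Longrightarrow> y \<in> V \<Longrightarrow> d x y = 0 \<longleftrightarrow> x = y"
    and d_sym: "x \<in> V \<Longrightarrow> y \<in> V \<Longrightarrow> d x y = d y x"
    and d_tri: "x \<in> V \<Longrightarrow> y \<in> V \<Longrightarrow> z \<in> V \<Longrightarrow> d x z \<le> d x y + d y z"
begin

definition geod :: "(nat \<Rightarrow> 'v) \<Rightarrow> 'v \<Rightarrow> 'v \<Rightarrow> bool" where
  "geod g x y \<longleftrightarrow> g 0 = x \<and> g (d x y) = y \<and> (\<forall>i\<le>d x y. g i \<in> V) \<and>
    (\<forall>i j. i \<le> j \<longrightarrow> j \<le> d x y \<longrightarrow> d (g i) (g j) = j - i)"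

text \<open>Distance at most \<open>l\<close> in the graph with \<open>z\<close> deleted. Steps may
  pause, so \<open>l\<close> is an upper bound and lengths can be estimated generously.\<close>

primrec conn :: "'v \<Rightarrow> nat \<Rightarrow> 'v \<Rightarrow> 'v \<Rightarrow> bool" where
  "conn z 0 x y \<longleftrightarrow> x = y \<and> x \<in> V \<and> x \<noteq> z"
| "conn z (Suc l) x y \<longleftrightarrow> (\<exists>w. conn z l x w \<and> d w y \<le> 1 \<and> y \<in> V \<and> y \<noteq> z)"

declare conn.simps(2) [simp del]

lemma d_self: "x \<in> V \<Longrightarrow> d x x = 0"
  using d_eq_0 by blast

lemma geodD:
  assumes "geod g x y"
  shows "g 0 = x" "g (d x y) = y" "\<And>i. i \<le> d x y \<Longrightarrow> g i \<in> V"
    "\<And>i j. i \<le> j \<Longrightarrow> j \<le> d x y \<Longrightarrow> d (g i) (g j) = j - i"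
    "x \<in> V" "y \<in> V" "\<And>i. i \<le> d x y \<Longrightarrow> d x (g i) = i" "\<And>i. i \<le> d x y \<Longrightarrow> d (g i) y = d x y - i"
proof -
  have *: "g 0 = x" "g (d x y) = y" "\<And>i. i \<le> d x y \<Longrightarrow> g i \<in> V"
    "\<And>i j. i \<le> j \<Longrightarrow> j \<le> d x y \<Longrightarrow> d (g i) (g j) = j - i"
    using assms unfolding geod_def by blast+
  show "g 0 = x" "g (d x y) = y" "\<And>i. i \<le> d x y \<Longrightarrow> g i \<in> V"
    "\<And>i j. i \<le> j \<Longrightarrow> j \<le> d x y \<Longrightarrow> d (g i) (g j) = j - i"
    by (fact *)+
  show "x \<in> V" "y \<in> V" using *(3)[of 0] *(3)[of "d x y"] *(1,2) by auto
  show "d x (g i) = i" if "i \<le> d x y" for i using *(4)[of 0 i] *(1) that by simp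
  show "d (g i) y = d x y - i" if "i \<le> d x y" for i using *(4)[of i "d x y"] *(2) that by simp
qed

lemma geod_rev:
  assumes "geod g x y" shows "geod (\<lambda>i. g (d x y - i)) y x"
proof -
  note G = geodD[OF assms]
  have e: "d y x = d x y" using d_sym[OF G(5,6)] by simp
  have "d (g (d x y - i)) (g (d x y - j)) = j - i" if "i \<le> j" "j \<le> d x y" for i j
    using G(4)[of "d x y - j" "d x y - i"] G(3)[of "d x y - j"] G(3)[of "d x y - i"] that
    by (subst d_sym) auto
  then show ?thesis unfolding geod_def e using G by simp
qed

lemma geod_suffix:
  assumes "geod g x y" "i \<le> d x y" shows "geod (\<lambda>k. g (i + k)) (g i) y"
proof -
  note G = geodD[OF assms(1)]
  show ?thesis unfolding geod_def using G assms(2) by simp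
qed

lemma geod_prefix_rev:
  assumes "geod g x y" "i \<le> d x y" shows "geod (\<lambda>k. g (i - k)) (g i) x"
proof -
  note G = geodD[OF assms(1)]
  have e: "d (g i) x = i" using G(7)[of i] d_sym[OF G(5) G(3)[of i]] assms(2) by simp
  have "d (g (i - k)) (g (i - j)) = j - k" if "k \<le> j" "j \<le> i" for k j
    using G(4)[of "i - j" "i - k"] G(3)[of "i - j"] G(3)[of "i - k"] that assms(2)
    by (subst d_sym) auto
  then show ?thesis unfolding geod_def e using G assms(2) by simp
qed

lemma geod_inj:
  assumes "geod g x y" "i \<le> d x y" "j \<le> d x y" shows "g i = g j \<longleftrightarrow> i = j"
  by (metis geodD(7)[OF assms(1,2)] geodD(7)[OF assms(1,3)])

lemma geod_dist:
  assumes "geod g x y" "i \<le> d x y" "j \<le> d x y"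
  shows "d (g i) (g j) = (if i \<le> j then j - i else i - j)"
  using geodD(4)[OF assms(1), of i j] geodD(4)[OF assms(1), of j i]
    geodD(3)[OF assms(1), of i] geodD(3)[OF assms(1), of j] assms d_sym[of "g i" "g j"] by (auto simp: not_le)

lemma conn_in: "conn z l x y \<Longrightarrow> x \<in> V \<and> y \<in> V \<and> x \<noteq> z \<and> y \<noteq> z"
proof (induction l arbitrary: y)
  case 0
  then show ?case by auto
next
  case (Suc l)
  then show ?case by (fastforce simp: conn.simps(2))
qed

lemma conn_dist: "conn z l x y \<Longrightarrow> d x y \<le> l"
proof (induction l arbitrary: y)
  case 0 then show ?case using d_self by auto
next
  case (Suc l)
  then obtain w where w: "conn z l x w" "d w y \<le> 1" "y \<in> V" by (auto simp: conn.simps(2))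
  with Suc.IH[OF w(1)] d_tri[of x w y] conn_in[OF w(1)] show ?case by auto
qed

lemma conn_refl: "x \<in> V \<Longrightarrow> x \<noteq> z \<Longrightarrow> conn z l x x"
proof (induction l)
  case (Suc l)
  then show ?case using d_self[of x] by (simp only: conn.simps) (rule exI[of _ x], simp)
qed simp

lemma conn_Suc: "conn z l x y \<Longrightarrow> conn z (Suc l) x y"
  using conn_in[of z l x y] d_self[of y] by (simp only: conn.simps) (rule exI[of _ y], simp)

lemma conn_mono:
  assumes "conn z l x y" "l \<le> l'" shows "conn z l' x y"
  using assms(2)
proof (induction rule: dec_induct)
  case (step n)
  from conn_Suc[OF step.IH] show ?case .
qed (rule assms(1))

lemma conn_trans: "conn z l x y \<Longrightarrow> conn z l' y w \<Longrightarrow> conn z (l + l') x w"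
proof (induction l' arbitrary: w)
  case 0 then show ?case by simp
next
  case (Suc l')
  then show ?case by (metis add_Suc_right conn.simps(2))
qed

lemma conn_step: "x \<in> V \<Longrightarrow> x \<noteq> z \<Longrightarrow> y \<in> V \<Longrightarrow> y \<noteq> z \<Longrightarrow> d x y \<le> 1 \<Longrightarrow> conn z 1 x y"
  by (simp only: One_nat_def conn.simps) blast

lemma conn_sym: "conn z l x y \<Longrightarrow> conn z l y x"
proof (induction l arbitrary: y)
  case 0 then show ?case by auto
next
  case (Suc l)
  then obtain w where w: "conn z l x w" "d w y \<le> 1" "y \<in> V" "y \<noteq> z" by (auto simp: conn.simps(2))
  have "conn z 1 y w" using conn_in[OF w(1)] w d_sym[of w y] by (intro conn_step) auto
  from conn_trans[OF this Suc.IH[OF w(1)]] show ?case by (simp only: plus_1_eq_Suc)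
qed

lemma conn_walk:
  assumes "\<And>k. i \<le> k \<Longrightarrow> k \<le> j \<Longrightarrow> g k \<in> V \<and> g k \<noteq> z"
    and "\<And>k. i \<le> k \<Longrightarrow> k < j \<Longrightarrow> d (g k) (g (Suc k)) \<le> 1" and "i \<le> j"
  shows "conn z (j - i) (g i) (g j)"
  using assms(3,1,2)
proof (induction j rule: dec_induct)
  case base
  then show ?case by auto
next
  case (step k)
  then have "conn z (k - i) (g i) (g k)" by simp
  moreover have "conn z 1 (g k) (g (Suc k))" using step by (intro conn_step) auto
  ultimately show ?case using conn_trans step(1) by (metis Suc_diff_le Suc_eq_plus1)
qed

lemma conn_geod:
  assumes g: "geod g x y" and "i \<le> d x y" "j \<le> d x y"
    and z: "\<And>k. min i j \<le> k \<Longrightarrow> k \<le> max i j \<Longrightarrow> g k \<noteq> z"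
  shows "conn z (d (g i) (g j)) (g i) (g j)"
proof -
  have *: "conn z (j - i) (g i) (g j)" if "i \<le> j" "j \<le> d x y" "\<And>k. i \<le> k \<Longrightarrow> k \<le> j \<Longrightarrow> g k \<noteq> z" for i j
    by (rule conn_walk) (use geodD(3,4)[OF g] that in \<open>auto\<close>)
  show ?thesis
  proof (cases "i \<le> j")
    case True then show ?thesis using * assms geod_dist[OF g assms(2,3)] by auto
  next
    case False then show ?thesis using *[of j i] assms geod_dist[OF g assms(2,3)] conn_sym by auto
  qed
qed

end

text \<open>\<open>hyp\<close> says that \<open>k\<close> is at most the Gromov product, doubled to
  stay within the natural numbers. \<open>fine\<close> speaks of circuits through the edge from
  \<open>v\<close> to \<open>u\<close>: such a circuit is a walk from \<open>u\<close> to a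
  neighbour \<open>w\<close> of \<open>v\<close> that misses \<open>v\<close>.\<close>

locale fine_hyperbolic = vertex_metric V d for V :: "'v set" and d +
  fixes \<delta> :: nat
  assumes geod_ex: "x \<in> V \<Longrightarrow> y \<in> V \<Longrightarrow> \<exists>g. geod g x y"
    and hyp: "geod g z x \<Longrightarrow> geod h z y \<Longrightarrow> 2 * k + d x y \<le> d z x + d z y \<Longrightarrow> d (g k) (h k) \<le> \<delta>"
    and fine: "u \<in> V \<Longrightarrow> v \<in> V \<Longrightarrow> d v u = 1 \<Longrightarrow> finite {w \<in> V. d v w = 1 \<and> conn v l u w}"
begin

text \<open>A geodesic from \<open>x\<close> to \<open>y\<close> stays within \<open>q\<close> of
  \<open>x\<close>, hence cannot reach \<open>z\<close>.\<close>

lemma conn_short: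
  assumes "x \<in> V" "y \<in> V" "z \<in> V" "d x y \<le> q" "q < d x z"
  shows "conn z q x y"
proof -
  obtain g where g: "geod g x y" using geod_ex assms by blast
  have "conn z (d (g 0) (g (d x y))) (g 0) (g (d x y))"
    using assms geodD(7)[OF g] by (intro conn_geod[OF g]) force+
  then show ?thesis using geodD[OF g] assms conn_mono by metis
qed

text \<open>Both geodesics are followed to distance \<delta> + 1 from \<open>v\<close>, where the
  crossing between them is too short to reach \<open>v\<close>, or to \<open>y\<close>, where they
  meet. Each of the three pieces has length at most \<delta>.\<close>

lemma bigon:
  assumes g: "geod g v y" and h: "geod h v y" and "v \<noteq> y"
  shows "conn v (3 * \<delta>) (g 1) (h 1)"
proof -
  note G = geodD[OF g] and H = geodD[OF h]
  have pos: "1 \<le> d v y" using d_eq_0[of v y] G(5,6) assms(3) by linarith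
  define k where "k = min (\<delta> + 1) (d v y)"
  have k: "1 \<le> k" "k \<le> d v y" using pos by (auto simp: k_def)
  have "g i \<noteq> v" if "1 \<le> i" "i \<le> d v y" for i using geod_inj[OF g, of i 0] that G(1) by auto
  then have 1: "conn v (k - 1) (g 1) (g k)"
    using conn_geod[OF g, of 1 k v] k G(4)[of 1 k] by auto
  have "h i \<noteq> v" if "1 \<le> i" "i \<le> d v y" for i using geod_inj[OF h, of i 0] that H(1) by auto
  then have 2: "conn v (k - 1) (h 1) (h k)"
    using conn_geod[OF h, of 1 k v] k H(4)[of 1 k] by auto
  have 3: "conn v \<delta> (g k) (h k)"
  proof (cases "\<delta> + 1 \<le> d v y")
    case True
    then have "k = \<delta> + 1" by (simp add: k_def)
    moreover have "d (g k) (h k) \<le> \<delta>" using hyp[OF g h, of k] k d_self[OF G(6)] by simp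
    ultimately show ?thesis using G(3,5,7) H(3) k d_sym[of "g k" v] by (intro conn_short) auto
  next
    case False
    then have "k = d v y" by (simp add: k_def)
    with G(2) H(2) G(6) assms(3) show ?thesis by (simp add: conn_refl)
  qed
  have "k - 1 \<le> \<delta>" by (auto simp: k_def)
  with conn_trans[OF conn_trans[OF 1 3] conn_sym[OF 2]] show ?thesis by (elim conn_mono) auto
qed

text \<open>Seen from \<open>y\<close>, the Gromov product of \<open>a\<close> and \<open>a'\<close>
  is at least \<open>d a y - D\<close>, so up to there the geodesics are close at equal distances
  from \<open>y\<close>.\<close>

lemma thin_common_end:
  assumes g: "geod g a y" and g': "geod g' a' y" and a: "d a a' \<le> D" and i: "i \<le> d a y" "D \<le> i"
  shows "d a y - i \<le> d a' y" "d (g i) (g' (d a' y - (d a y - i))) \<le> \<delta>"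
proof -
  note G = geodD[OF g] and G' = geodD[OF g']
  have t: "d a y \<le> d a a' + d a' y" using d_tri[OF G(5) G'(5) G'(6)] .
  then show 1: "d a y - i \<le> d a' y" using a i by linarith
  have s: "d y a = d a y" "d y a' = d a' y" using d_sym[OF G(5,6)] d_sym[OF G'(5,6)] by simp_all
  have "d (g (d a y - (d a y - i))) (g' (d a' y - (d a y - i))) \<le> \<delta>"
    by (rule hyp[OF geod_rev[OF g] geod_rev[OF g']]) (use t a i s in linarith)
  then show "d (g i) (g' (d a' y - (d a y - i))) \<le> \<delta>" using i by simp
qed

end

section \<open>Turns along geodesics\<close>

primrec near :: "('v \<Rightarrow> 'v \<Rightarrow> 'v \<Rightarrow> bool) \<Rightarrow> 'v \<Rightarrow> nat \<Rightarrow> 'v \<Rightarrow> 'v \<Rightarrow> bool" where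
  "near P v 0 u w \<longleftrightarrow> u = w"
| "near P v (Suc k) u w \<longleftrightarrow> near P v k u w \<or> (\<exists>x. near P v k u x \<and> P v x w)"

lemma near_mono: "near P v k u w \<Longrightarrow> k \<le> k' \<Longrightarrow> near P v k' u w"
proof (induction k' rule: nat_induct)
  case (Suc n)
  then show ?case by (cases "k = Suc n") auto
qed simp

lemma near_trans: "near P v k u x \<Longrightarrow> near P v l x w \<Longrightarrow> near P v (k + l) u w"
proof (induction l arbitrary: w)
  case (Suc l)
  then show ?case by (metis add_Suc_right near.simps(2))
qed simp

lemma near_1: "P v u w \<Longrightarrow> near P v 1 u w"
  by auto

lemma near_sym:
  assumes "\<And>u w. P v u w \<Longrightarrow> P v w u"
  shows "near P v k u w \<Longrightarrow> near P v k w u"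
proof (induction k arbitrary: w)
  case (Suc k)
  from Suc.prems consider "near P v k u w" | x where "near P v k u x" "P v x w" by auto
  then show ?case
  proof cases
    case 1
    then show ?thesis using Suc.IH by simp
  next
    case 2
    have "near P v (1 + k) w u"
      by (rule near_trans[OF near_1[of P, OF assms[OF 2(2)]] Suc.IH[OF 2(1)]])
    then show ?thesis by (simp only: plus_1_eq_Suc)
  qed
qed simp

text \<open>An angle measured in \<open>P\<close>-steps. Truncation at \<open>L\<close> gives a
  value also to directions that no chain of \<open>P\<close>-steps joins, and a value below
  \<open>L\<close> always comes from a chain.\<close>

definition turn_size :: "('v \<Rightarrow> 'v \<Rightarrow> 'v \<Rightarrow> bool) \<Rightarrow> nat \<Rightarrow> 'v \<Rightarrow> 'v \<Rightarrow> 'v \<Rightarrow> nat" where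
  "turn_size P L v u w = (LEAST k. k = L \<or> near P v k u w)"

lemma turn_size_le: "turn_size P L v u w \<le> L"
  unfolding turn_size_def by (rule Least_le) simp

lemma turn_size_le_near: "near P v k u w \<Longrightarrow> turn_size P L v u w \<le> k"
  unfolding turn_size_def by (intro Least_le disjI2)

lemma near_turn_size:
  assumes "turn_size P L v u w < L" shows "near P v (turn_size P L v u w) u w"
proof -
  have "turn_size P L v u w = L \<or> near P v (turn_size P L v u w) u w"
    unfolding turn_size_def by (rule LeastI[of _ L]) simp
  with assms show ?thesis by simp
qed

lemma turn_size_sym:
  assumes "\<And>u w. P v u w \<Longrightarrow> P v w u"
  shows "turn_size P L v u w = turn_size P L v w u"
proof -
  have "near P v k u w \<longleftrightarrow> near P v k w u" for k using near_sym[of P v, OF assms] by blast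
  then show ?thesis unfolding turn_size_def by simp
qed

text \<open>A chain between \<open>u'\<close> and \<open>w'\<close> is prolonged at both ends; if
  none is shorter than \<open>L\<close>, truncation gives the bound.\<close>

lemma turn_size_lipschitz:
  assumes "near P v i u u'" "near P v j w' w"
  shows "turn_size P L v u w \<le> turn_size P L v u' w' + (i + j)"
proof (cases "turn_size P L v u' w' < L")
  case True
  from near_trans[OF near_trans[OF assms(1) near_turn_size[OF True]] assms(2)]
  have "near P v (turn_size P L v u' w' + (i + j)) u w" by (simp add: ac_simps)
  then show ?thesis by (rule turn_size_le_near)
next
  case False
  then show ?thesis using turn_size_le[of P L v u w] by linarith
qed

definition prev_vertex :: "'v \<Rightarrow> (nat \<Rightarrow> 'v) \<Rightarrow> nat \<Rightarrow> 'v" where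
  "prev_vertex b g i = (if i = 0 then b else g (i - 1))"

definition next_vertex :: "(nat \<Rightarrow> 'v) \<Rightarrow> nat \<Rightarrow> 'v \<Rightarrow> nat \<Rightarrow> 'v" where
  "next_vertex g m w i = (if i = m then w else g (Suc i))"

context vertex_metric
begin

text \<open>A geodesic \<open>g\<close> from \<open>a\<close> to \<open>y\<close> is prolonged by a vertex \<open>b\<close> before \<open>a\<close> and a vertex \<open>w\<close>
  after \<open>y\<close>, so that it makes a turn at each of its vertices.\<close>

definition path_turn ::
    "('v \<Rightarrow> 'v \<Rightarrow> 'v \<Rightarrow> bool) \<Rightarrow> nat \<Rightarrow> 'v \<Rightarrow> (nat \<Rightarrow> 'v) \<Rightarrow> nat \<Rightarrow> 'v \<Rightarrow> 'v \<Rightarrow> nat" where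
  "path_turn P L b g m w v = (if v \<in> g ` {..m}
     then turn_size P L v (prev_vertex b g (d (g 0) v)) (next_vertex g m w (d (g 0) v)) else 0)"

lemma path_turn_geod:
  assumes "geod g a y" "i \<le> d a y"
  shows "path_turn P L b g (d a y) w (g i) =
    turn_size P L (g i) (prev_vertex b g i) (next_vertex g (d a y) w i)"
  using assms geodD(1,7)[OF assms(1)] by (simp add: path_turn_def)

text \<open>The comparison of turns below is proved for paths with a common end; reversal makes it
  available for a common start.\<close>

lemma path_turn_rev:
  assumes g: "geod g a y" and sym: "\<And>v u w. P v u w \<Longrightarrow> P v w u"
  shows "path_turn P L w (\<lambda>i. g (d a y - i)) (d y a) b v = path_turn P L b g (d a y) w v"
proof -
  note G = geodD[OF g]
  define m where "m = d a y"
  have e: "d y a = m" using d_sym[OF G(5,6)] m_def by simp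
  show ?thesis
  proof (cases "v \<in> g ` {..m}")
    case True
    then obtain i where i: "i \<le> m" "v = g i" by auto
    have "path_turn P L w (\<lambda>i. g (m - i)) (d y a) b (g (m - (m - i))) =
      turn_size P L (g (m - (m - i))) (prev_vertex w (\<lambda>i. g (m - i)) (m - i)) (next_vertex (\<lambda>i. g (m - i)) (d y a) b (m - i))"
      using path_turn_geod[OF geod_rev[OF g], of "m - i"] unfolding m_def[symmetric] e by simp
    moreover have "prev_vertex w (\<lambda>i. g (m - i)) (m - i) = next_vertex g m w i"
      using i by (auto simp: prev_vertex_def next_vertex_def)
    moreover have "next_vertex (\<lambda>i. g (m - i)) (d y a) b (m - i) = prev_vertex b g i"
      using i e by (auto simp: prev_vertex_def next_vertex_def)
    ultimately show ?thesis using path_turn_geod[OF g, of i P L b w] i turn_size_sym[of P v, OF sym] 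
      unfolding m_def[symmetric] by simp
  next
    case False
    have "v \<notin> (\<lambda>i. g (m - i)) ` {..m}" using False by auto
    with False show ?thesis unfolding path_turn_def m_def[symmetric] e by simp
  qed
qed

lemma prev_vertex_adj:
  assumes g: "geod g a y" and b: "b \<in> V" "d a b = 1" and i: "i \<le> d a y"
  shows "prev_vertex b g i \<in> V" "d (g i) (prev_vertex b g i) = 1"
proof -
  have "prev_vertex b g i \<in> V \<and> d (g i) (prev_vertex b g i) = 1"
  proof (cases "i = 0")
    case True
    then show ?thesis using geodD(1)[OF g] b by (simp add: prev_vertex_def)
  next
    case False
    then show ?thesis using geodD(3)[OF g, of "i - 1"] geod_dist[OF g i, of "i - 1"] i
      by (simp add: prev_vertex_def)
  qed
  then show "prev_vertex b g i \<in> V" "d (g i) (prev_vertex b g i) = 1" by blast+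
qed

lemma next_vertex_adj:
  assumes g: "geod g a y" and w: "w \<in> V" "d y w = 1" and i: "i \<le> d a y"
  shows "next_vertex g (d a y) w i \<in> V" "d (g i) (next_vertex g (d a y) w i) = 1"
proof -
  have "next_vertex g (d a y) w i \<in> V \<and> d (g i) (next_vertex g (d a y) w i) = 1"
  proof (cases "i = d a y")
    case True
    then show ?thesis using geodD(2)[OF g] w by (simp add: next_vertex_def)
  next
    case False
    then show ?thesis using geodD(3)[OF g, of "Suc i"] geod_dist[OF g i, of "Suc i"] i
      by (simp add: next_vertex_def)
  qed
  then show "next_vertex g (d a y) w i \<in> V" "d (g i) (next_vertex g (d a y) w i) = 1" by blast+
qed

end

context fine_hyperbolic
begin

text \<open>Following \<open>g\<close> for \<open>D + \<delta> + 1\<close> steps beyond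
  \<open>g i\<close> achieves two things: the point reached is at least \<open>D\<close> from
  \<open>a\<close>, where \<open>g'\<close> is within \<delta>, and it is farther than \<delta> from
  \<open>g i\<close>, so that the crossing misses \<open>g i\<close>. If \<open>g\<close> is over
  before, it has reached \<open>y\<close>, which lies on \<open>g'\<close>.\<close>

lemma forward_connection:
  assumes g: "geod g a y" and g': "geod g' a' y" and D: "d a a' \<le> D"
    and i: "i < d a y" and v: "g i \<notin> g' ` {..d a' y}"
  shows "\<exists>r\<le>d a' y. conn (g i) (D + 2 * \<delta> + 1) (g (Suc i)) (g' r)"
proof -
  note G = geodD[OF g] and G' = geodD[OF g']
  define f where "f = min (D + \<delta> + 1) (d a y - i)"
  have f: "1 \<le> f" "i + f \<le> d a y" "f \<le> D + \<delta> + 1" using i by (auto simp: f_def)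
  have "g k \<noteq> g i" if "Suc i \<le> k" "k \<le> i + f" for k
    using geod_inj[OF g, of k i] that f by auto
  then have "conn (g i) (d (g (Suc i)) (g (i + f))) (g (Suc i)) (g (i + f))"
    by (intro conn_geod[OF g]) (use f in auto)
  then have 1: "conn (g i) (D + \<delta> + 1) (g (Suc i)) (g (i + f))"
    using G(4)[of "Suc i" "i + f"] f by (elim conn_mono) auto
  show ?thesis
  proof (cases "i + f = d a y")
    case True
    then have "g (i + f) = g' (d a' y)" using G(2) G'(2) by simp
    with 1 show ?thesis by (intro exI[of _ "d a' y"]) (auto elim: conn_mono)
  next
    case False
    then have f2: "f = D + \<delta> + 1" using i by (simp add: f_def min_def split: if_splits)
    define r where "r = d a' y - (d a y - (i + f))"
    have r: "r \<le> d a' y" "d (g (i + f)) (g' r) \<le> \<delta>"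
      using thin_common_end(2)[OF g g' D, of "i + f"] f f2 by (auto simp: r_def)
    have "conn (g i) \<delta> (g (i + f)) (g' r)"
      using r f f2 G(3) G'(3) geod_dist[OF g, of "i + f" i] by (intro conn_short) auto
    from conn_trans[OF 1 this] r(1) show ?thesis by (intro exI[of _ r]) (auto elim: conn_mono)
  qed
qed

text \<open>Going back along \<open>g\<close>, either there is room for \<delta> + 1 steps that end
  at least \<open>D\<close> from \<open>a\<close>, where one can cross to \<open>g'\<close>, or
  \<open>a\<close> is near and the way leads through \<open>a\<close> and along \<open>s\<close>.
  Unless \<open>r = 0\<close>, the clause on \<open>r\<close> places \<open>g' r\<close> strictly
  before the point of \<open>g'\<close> that is as far from \<open>y\<close> as \<open>g i\<close>;
  if \<open>g i\<close> lies on \<open>g'\<close>, it is that point.\<close>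

lemma backward_connection:
  assumes g: "geod g a y" and g': "geod g' a' y" and s: "geod s a a'" and D: "d a a' \<le> D"
    and i: "i \<le> d a y" "0 < i" and v: "g i \<notin> s ` {..d a a'}"
  shows "\<exists>r\<le>d a' y. (r = 0 \<or> r + (d a y - i) < d a' y) \<and>
    conn (g i) (2 * D + 2 * \<delta> + 1) (g (i - 1)) (g' r)"
proof -
  note G = geodD[OF g] and G' = geodD[OF g'] and S = geodD[OF s]
  define f where "f = (if i \<ge> D + \<delta> + 1 then \<delta> + 1 else i)"
  have f: "1 \<le> f" "f \<le> i" "f \<le> D + \<delta> + 1" using i by (auto simp: f_def)
  have "g k \<noteq> g i" if "i - f \<le> k" "k \<le> i - 1" for k
  proof -
    have "k \<le> d a y" "k \<noteq> i" using that f i by linarith+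
    then show ?thesis using geod_inj[OF g, of k i] i by blast
  qed
  then have "conn (g i) (d (g (i - 1)) (g (i - f))) (g (i - 1)) (g (i - f))"
    by (intro conn_geod[OF g]) (use f i in auto)
  then have 1: "conn (g i) (f - 1) (g (i - 1)) (g (i - f))"
    using geod_dist[OF g, of "i - 1" "i - f"] f i by (elim conn_mono) auto
  show ?thesis
  proof (cases "i \<ge> D + \<delta> + 1")
    case False
    then have "g (i - f) = a" using G(1) by (simp add: f_def)
    moreover have "s k \<noteq> g i" if "k \<le> d a a'" for k
      using v that by (metis atMost_iff imageI)
    then have "conn (g i) (d (s 0) (s (d a a'))) (s 0) (s (d a a'))"
      by (intro conn_geod[OF s]) auto
    ultimately have "conn (g i) (f - 1 + d a a') (g (i - 1)) (g' 0)"
      using conn_trans[OF 1] S(1,2) G'(1) by metis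
    then show ?thesis using f D by (intro exI[of _ 0]) (auto elim: conn_mono)
  next
    case True
    then have f2: "f = \<delta> + 1" by (auto simp: f_def)
    define r where "r = d a' y - (d a y - (i - f))"
    have r: "r \<le> d a' y" "d (g (i - f)) (g' r) \<le> \<delta>" "d a y - (i - f) \<le> d a' y"
      using thin_common_end[OF g g' D, of "i - f"] f f2 i True by (auto simp: r_def)
    have "conn (g i) \<delta> (g (i - f)) (g' r)"
      using r f f2 i G(3) G'(3) geod_dist[OF g, of "i - f" i] by (intro conn_short) auto
    from conn_trans[OF 1 this] r f i f2 show ?thesis
      by (intro exI[of _ r]) (auto elim!: conn_mono simp: r_def)
  qed
qed

text \<open>The two walks and the distance of at most 2 between \<open>p\<close> and
  \<open>q\<close> bound the distance between \<open>g' r\<close> and \<open>g' t\<close>, hence the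
  length of the stretch of \<open>g'\<close> that joins the walks.\<close>

lemma conn_along:
  assumes g': "geod g' a' y" and 1: "conn v k p (g' r)" and 2: "conn v l q (g' t)"
    and r: "r \<le> d a' y" "t \<le> d a' y"
    and v: "\<And>j. min r t \<le> j \<Longrightarrow> j \<le> max r t \<Longrightarrow> g' j \<noteq> v" and pq: "d p q \<le> 2"
  shows "conn v (2 * k + 2 * l + 2) p q"
proof -
  note G' = geodD[OF g']
  have "d (g' r) (g' t) \<le> k + (2 + l)"
    using d_tri[of "g' r" p "g' t"] d_tri[of p q "g' t"] conn_dist[OF conn_sym[OF 1]]
      conn_dist[OF 2] conn_in[OF 1] conn_in[OF 2] pq by force
  then have "conn v (k + (2 + l)) (g' r) (g' t)"
    by (intro conn_mono[OF conn_geod[OF g' r(1) r(2) v]]) auto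
  from conn_trans[OF conn_trans[OF 1 this] conn_sym[OF 2]] show ?thesis
    by (elim conn_mono) auto
qed

text \<open>At a vertex of both paths the outgoing directions differ by one step of
  \<open>P\<close>, because of \<open>bigon\<close>, and the incoming ones by at most three: if
  \<open>s\<close> passes there, its turn is one step and a bigon on either side gives the others;
  if not, the directions are joined along \<open>g'\<close>. At a vertex missed by \<open>g'\<close>
  the neighbours on \<open>g\<close> are joined along \<open>g'\<close>, possibly after a turn of
  \<open>s\<close>, so the turn is at most 3. All walks that occur are shorter than
  \<open>12 * (D + \<delta> + 1)\<close>, so 4 does not depend on \<open>D\<close>.\<close>

theorem path_turn_compare:
  assumes g: "geod g a y" and g': "geod g' a' y" and s: "geod s a a'" and D: "d a a' \<le> D"
    and b: "b \<in> V" "d a b = 1" and b': "b' \<in> V" "d a' b' = 1" and w: "w \<in> V" "d y w = 1"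
    and sym: "\<And>v u w. P v u w \<Longrightarrow> P v w u"
    and P: "\<And>v u w. v \<in> V \<Longrightarrow> u \<in> V \<Longrightarrow> w \<in> V \<Longrightarrow> d v u = 1 \<Longrightarrow> d v w = 1 \<Longrightarrow>
      conn v (12 * (D + \<delta> + 1)) u w \<Longrightarrow> P v u w"
    and turns: "\<And>j. j \<le> d a a' \<Longrightarrow> P (s j) (prev_vertex b s j) (next_vertex s (d a a') b' j)"
  shows "path_turn P L b g (d a y) w v \<le> path_turn P L b' g' (d a' y) w v + 4"
proof (cases "v \<in> g ` {..d a y}")
  case False
  then show ?thesis by (simp add: path_turn_def)
next
  case True
  note G = geodD[OF g] and G' = geodD[OF g'] and S = geodD[OF s]
  have sa: "d a' a = d a a'" using d_sym[OF S(5,6)] by simp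
  obtain i where i: "i \<le> d a y" and v: "v = g i" using True by auto
  have vV: "v \<in> V" using G(3) i v by simp
  define u where "u = prev_vertex b g i"
  define x where "x = next_vertex g (d a y) w i"
  have u: "u \<in> V" "d v u = 1" using prev_vertex_adj[OF g b i] by (auto simp: u_def v)
  have x: "x \<in> V" "d v x = 1" using next_vertex_adj[OF g w i] by (auto simp: x_def v)
  have ux: "d p q \<le> 2" if "p \<in> V" "q \<in> V" "d v p = 1" "d v q = 1" for p q
    using d_tri[of p v q] d_sym[of p v] vV that by simp
  have nearP: "near P v 1 p q" if "conn v (12 * (D + \<delta> + 1)) p q" "d v p = 1" "d v q = 1" for p q
    by (rule near_1, rule P) (use that conn_in[OF that(1)] vV in simp_all)
  have sj: "near P v 1 u (prev_vertex b s j)" if j: "j \<le> d a a'" "v = s j" for j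
  proof (cases "i = 0")
    case True
    then have "s j = s 0" using j(2) v G(1) S(1) by metis
    then have "j = 0" using geod_inj[OF s j(1), of 0] by blast
    with True show ?thesis by (simp add: u_def prev_vertex_def)
  next
    case False
    then have "v \<noteq> a" using geod_inj[OF g i, of 0] v G(1) by (metis le0)
    then have j0: "j \<noteq> 0" using j(2) S(1) by metis
    have "conn v (3 * \<delta>) (g (i - 1)) (s (j - 1))"
      by (rule bigon[OF geod_prefix_rev[OF g i, folded v] geod_prefix_rev[OF s j(1), folded j(2)] \<open>v \<noteq> a\<close>])
    moreover have "d v (s (j - 1)) = 1" using geod_dist[OF s j(1), of "j - 1"] j j0 by auto
    ultimately show ?thesis using u False j0
      by (intro nearP) (auto simp: u_def prev_vertex_def elim: conn_mono)
  qed
  show ?thesis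
  proof (cases "v \<in> g' ` {..d a' y}")
    case True
    then obtain i' where i': "i' \<le> d a' y" and v': "v = g' i'" by auto
    have mi: "d a y - i = d a' y - i'" using G(8)[OF i] G'(8)[OF i'] v v' by simp
    define u' where "u' = prev_vertex b' g' i'"
    define x' where "x' = next_vertex g' (d a' y) w i'"
    have u': "u' \<in> V" "d v u' = 1" using prev_vertex_adj[OF g' b' i'] by (auto simp: u'_def v')
    have x': "x' \<in> V" "d v x' = 1" using next_vertex_adj[OF g' w i'] by (auto simp: x'_def v')
    have nx: "near P v 1 x' x"
    proof (cases "i = d a y")
      case True
      then have "i' = d a' y" using mi i' by simp
      with True show ?thesis by (simp add: x_def x'_def next_vertex_def)
    next
      case False
      then have vy: "v \<noteq> y" using geod_inj[OF g i, of "d a y"] v G(2) by (metis order_refl)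
      have "i' \<noteq> d a' y" using False mi i i' by simp
      moreover have "conn v (3 * \<delta>) (g' (i' + 1)) (g (i + 1))"
        by (rule bigon[OF geod_suffix[OF g' i', folded v'] geod_suffix[OF g i, folded v] vy])
      ultimately show ?thesis using False x x'
        by (intro nearP) (auto simp: x_def x'_def next_vertex_def elim: conn_mono)
    qed
    have nu: "near P v 3 u u'"
    proof (cases "v \<in> s ` {..d a a'}")
      case True
      then obtain j where j: "j \<le> d a a'" "v = s j" by auto
      have "near P v 1 (next_vertex s (d a a') b' j) u'"
      proof (cases "j = d a a'")
        case True
        then have "g' i' = g' 0" using j(2) v' G'(1) S(2) by metis
        then have "i' = 0" using geod_inj[OF g' i', of 0] by blast
        with True show ?thesis by (simp add: u'_def prev_vertex_def next_vertex_def)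
      next
        case False
        then have va: "v \<noteq> a'" using geod_inj[OF s j(1), of "d a a'"] j(2) S(2) by (metis order_refl)
        then have i0: "i' \<noteq> 0" using v' G'(1) by metis
        have "conn v (3 * \<delta>) (s (j + 1)) (g' (i' - 1))"
          by (rule bigon[OF geod_suffix[OF s j(1), folded j(2)] geod_prefix_rev[OF g' i', folded v'] va])
        moreover have "d v (s (Suc j)) = 1" using geod_dist[OF s j(1), of "Suc j"] j False by auto
        ultimately show ?thesis using u' False i0
          by (intro nearP) (auto simp: u'_def prev_vertex_def next_vertex_def elim: conn_mono)
      qed
      from near_trans[OF near_trans[OF sj[OF j] near_1[of P, OF turns[OF j(1), folded j(2)]]] this]
      show ?thesis by (simp add: numeral_3_eq_3)
    next
      case False
      have i0: "i \<noteq> 0" using False v G(1) S(1) by (metis atMost_iff imageI le0)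
      have i'0: "i' \<noteq> 0" using False v' G'(1) S(2) by (metis atMost_iff imageI order_refl)
      obtain r where r: "r \<le> d a' y" "r = 0 \<or> r + (d a y - i) < d a' y"
        and c: "conn v (2 * D + 2 * \<delta> + 1) (g (i - 1)) (g' r)"
        using backward_connection[OF g g' s D i] i0 False v by auto
      have ri: "r \<le> i' - 1" using r(2) mi i' i'0 by auto
      have e: "u = g (i - 1)" "u' = g' (i' - 1)" using i0 i'0 by (auto simp: u_def u'_def prev_vertex_def)
      have ne: "g' j \<noteq> v" if "j \<le> i' - 1" for j
      proof -
        have "j \<noteq> i'" "j \<le> d a' y" using that i' i'0 by linarith+
        then show ?thesis using geod_inj[OF g' _ i', of j] v' by blast
      qed
      have "conn v (2 * (2 * D + 2 * \<delta> + 1) + 2 * 0 + 2) (g (i - 1)) (g' (i' - 1))"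
        by (rule conn_along[OF g' c, of 0 _ "i' - 1"])
          (use ri i' ne u' ux[of u u'] u e in \<open>auto simp: conn_refl\<close>)
      then have "near P v 1 u u'" using e u u' by (intro nearP) (auto elim: conn_mono)
      then show ?thesis by (rule near_mono) simp
    qed
    have "turn_size P L v u x \<le> turn_size P L v u' x' + (3 + 1)"
      by (rule turn_size_lipschitz[OF nu nx])
    then show ?thesis
      using path_turn_geod[OF g i] path_turn_geod[OF g' i'] by (simp add: u_def u'_def x_def x'_def v[symmetric] v'[symmetric])
  next
    case False
    have im: "i \<noteq> d a y" using False v G(2) G'(2) by (metis atMost_iff imageI order_refl)
    have "a' \<noteq> v" using False G'(1) by (metis atMost_iff imageI le0)
    have g'v: "g' k \<noteq> v" if "k \<le> d a' y" for k
      using False that by (metis atMost_iff imageI)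
    obtain r where r: "r \<le> d a' y" and c: "conn v (D + 2 * \<delta> + 1) x (g' r)"
      using forward_connection[OF g g' D, of i] im i False v by (auto simp: x_def next_vertex_def)
    have "near P v 3 u x"
    proof (cases "v \<in> s ` {..d a a'}")
      case True
      then obtain j where j: "j \<le> d a a'" "v = s j" by auto
      have jq: "j \<noteq> d a a'" using j S(2) \<open>a' \<noteq> v\<close> by metis
      have "s k \<noteq> v" if "Suc j \<le> k" "k \<le> d a a'" for k
        using geod_inj[OF s, of k j] that j by auto
      then have "conn v (d (s (Suc j)) (s (d a a'))) (s (Suc j)) (s (d a a'))"
        by (intro conn_geod[OF s]) (use j jq in auto)
      then have "conn v D (s (Suc j)) (g' 0)"
        using S(2,8) G'(1) j jq D by (auto elim: conn_mono)
      moreover have "d v (s (Suc j)) = 1" using geod_dist[OF s j(1), of "Suc j"] j jq by auto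
      ultimately have "conn v (2 * D + 2 * (D + 2 * \<delta> + 1) + 2) (s (Suc j)) x"
        by (intro conn_along[where r = 0 and k = D, OF g' _ c _ r]) (use r g'v S(3) j jq x ux in auto)
      then have "near P v 1 (s (Suc j)) x" using x \<open>d v (s (Suc j)) = 1\<close>
        by (intro nearP) (auto elim: conn_mono)
      moreover have "P v (prev_vertex b s j) (s (Suc j))"
        using turns[OF j(1)] jq j(2) by (simp add: next_vertex_def)
      ultimately have "near P v (1 + 1 + 1) u x" using sj[OF j] near_trans near_1 by metis
      then show ?thesis by (simp add: numeral_3_eq_3)
    next
      case not_s: False
      have i0: "i \<noteq> 0" using not_s v G(1) S(1) by (metis atMost_iff imageI le0)
      then have e: "u = g (i - 1)" by (simp add: u_def prev_vertex_def)
      obtain t where t: "t \<le> d a' y" and c': "conn v (2 * D + 2 * \<delta> + 1) u (g' t)"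
        using backward_connection[OF g g' s D i] i0 not_s v e by auto
      have "conn v (2 * (2 * D + 2 * \<delta> + 1) + 2 * (D + 2 * \<delta> + 1) + 2) u x"
        by (rule conn_along[OF g' c' c t r]) (use g'v r t ux u x in auto)
      then have "near P v 1 u x" using u x by (intro nearP) (auto elim: conn_mono)
      then show ?thesis by (rule near_mono) simp
    qed
    then have "turn_size P L v u x \<le> 3" by (rule turn_size_le_near)
    then show ?thesis using path_turn_geod[OF g i] by (simp add: u_def x_def v[symmetric])
  qed
qed

end

section \<open>Beams of geodesics\<close>

text \<open>The last oriented edge is remembered, not only the last vertex: fineness bounds the
  continuations of an edge, whereas a vertex may have infinitely many neighbours.\<close>

primrec turn_reach :: "('v \<Rightarrow> 'v \<Rightarrow> 'v \<Rightarrow> bool) \<Rightarrow> nat \<Rightarrow> 'v \<times> 'v \<Rightarrow> ('v \<times> 'v) set" where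
  "turn_reach Q 0 e = {e}"
| "turn_reach Q (Suc k) e =
    turn_reach Q k e \<union> {(v, w) | u v w. (u, v) \<in> turn_reach Q k e \<and> Q v u w}"

lemma turn_reach_mono: "k \<le> k' \<Longrightarrow> turn_reach Q k e \<subseteq> turn_reach Q k' e"
  by (induction k' rule: dec_induct) auto

lemma turn_reach_inv:
  assumes "\<And>u v w. I (u, v) \<Longrightarrow> Q v u w \<Longrightarrow> I (v, w)" "I e"
  shows "e' \<in> turn_reach Q k e \<Longrightarrow> I e'"
proof (induction k arbitrary: e')
  case (Suc k)
  from Suc.prems consider "e' \<in> turn_reach Q k e"
    | u v w where "(u, v) \<in> turn_reach Q k e" "Q v u w" "e' = (v, w)" by auto
  then show ?case using Suc.IH assms(1) by cases blast+
qed (use assms(2) in simp)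

lemma finite_turn_reach:
  assumes "\<And>u v w. I (u, v) \<Longrightarrow> Q v u w \<Longrightarrow> I (v, w)" "I e"
    and "\<And>u v. I (u, v) \<Longrightarrow> finite {w. Q v u w}"
  shows "finite (turn_reach Q k e)"
proof (induction k)
  case (Suc k)
  have "{(v, w) | u v w. (u, v) \<in> turn_reach Q k e \<and> Q v u w} =
      (\<Union>(u, v)\<in>turn_reach Q k e. Pair v ` {w. Q v u w})"
    by auto
  moreover have "finite \<dots>"
    using Suc turn_reach_inv[of I Q, OF assms(1,2)] assms(3) by (intro finite_UN_I) auto
  ultimately show ?case using Suc by simp
qed simp

lemma turn_reach_chain:
  assumes "\<And>i. i < k \<Longrightarrow> Q (f (Suc i)) (f i) (f (Suc (Suc i)))"
  shows "(f k, f (Suc k)) \<in> turn_reach Q k (f 0, f 1)"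
  using assms
proof (induction k)
  case (Suc k)
  then have "(f k, f (Suc k)) \<in> turn_reach Q k (f 0, f 1)" by simp
  then show ?case using Suc.prems[of k] by auto
qed simp

context fine_hyperbolic
begin

definition narrow :: "nat \<Rightarrow> 'v \<Rightarrow> 'v \<Rightarrow> 'v \<Rightarrow> bool" where
  "narrow l v u w \<longleftrightarrow> w \<in> V \<and> d v w = 1 \<and> conn v l u w"

text \<open>The constants are those produced by \<open>narrow_chain_one_side\<close>.\<close>

abbreviation narrow_reach :: "'v \<times> 'v \<Rightarrow> ('v \<times> 'v) set" where
  "narrow_reach \<equiv> turn_reach (narrow (30 * \<delta> + 10)) (6 * \<delta> + 1)"

text \<open>A path glued from two geodesics at \<open>v\<close> is never faster than unit speed, and
  the equality of distances leaves no room for a shortcut.\<close>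

lemma geod_through:
  assumes "x \<in> V" "y \<in> V" "v \<in> V" "d x v + d v y = d x y"
  shows "\<exists>g. geod g x y \<and> g (d x v) = v"
proof -
  obtain g where g: "geod g x v" using geod_ex assms by blast
  obtain h where h: "geod h v y" using geod_ex assms by blast
  note G = geodD[OF g] and H = geodD[OF h]
  define k where "k i = (if i \<le> d x v then g i else h (i - d x v))" for i
  have V: "k i \<in> V" if "i \<le> d x y" for i using that G(3) H(3) assms(4) by (auto simp: k_def)
  have kx: "d x (k i) \<le> i" and ky: "d (k i) y \<le> d x y - i" if "i \<le> d x y" for i
  proof -
    show "d x (k i) \<le> i"
    proof (cases "i \<le> d x v")
      case False
      then show ?thesis using d_tri[of x v "k i"] V[OF that] H(7)[of "i - d x v"] assms that by (simp add: k_def)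
    qed (simp add: k_def G(7))
    show "d (k i) y \<le> d x y - i"
    proof (cases "i \<le> d x v")
      case True
      then show ?thesis using d_tri[of "k i" v y] V[OF that] G(8)[of i] assms that by (simp add: k_def)
    next
      case False
      then show ?thesis using H(8)[of "i - d x v"] assms that by (simp add: k_def)
    qed
  qed
  have upper: "d (k i) (k j) \<le> j - i" if "i \<le> j" "j \<le> d x y" for i j
  proof (cases "j \<le> d x v \<or> \<not> i \<le> d x v")
    case True
    then show ?thesis using that G(4)[of i j] H(4)[of "i - d x v" "j - d x v"] assms(4) by (auto simp: k_def)
  next
    case False
    then show ?thesis using d_tri[of "k i" v "k j"] V[of i] V[of j] G(8)[of i] H(7)[of "j - d x v"] assms that
      by (simp add: k_def)
  qed
  have "d (k i) (k j) = j - i" if "i \<le> j" "j \<le> d x y" for i j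
    using d_tri[of x "k i" y] d_tri[of "k i" "k j" y] upper[OF that] kx[of i] ky[of j] V[of i] V[of j] assms that
    by simp
  moreover have "k 0 = x" using G(1) by (simp add: k_def)
  moreover have "k (d x y) = y"
  proof (cases "d x y \<le> d x v")
    case True
    then have "d v y = 0" using assms(4) by linarith
    then have "v = y" using d_eq_0[OF assms(3,2)] by blast
    then show ?thesis using G(2) by (simp add: k_def)
  next
    case False
    moreover have "d x y - d x v = d v y" using assms(4) by linarith
    ultimately show ?thesis using H(2) by (simp add: k_def)
  qed
  ultimately have "geod k x y" unfolding geod_def using V by blast
  moreover have "k (d x v) = v" using G(2) by (simp add: k_def)
  ultimately show ?thesis by blast
qed

text \<open>The diagonal from \<open>a1\<close> to \<open>y\<close> is within \<delta> of
  \<open>h\<close> at time \<open>s\<close>, and within \<delta> of \<open>g\<close> from time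
  \<open>r\<close> on.\<close>

lemma thin_quadrilateral:
  assumes g: "geod g a y" and h: "geod h a1 y1" and r: "d a1 a \<le> r" "d y1 y \<le> r"
    and s: "r \<le> s" "s + r \<le> d a1 y1"
  shows "\<exists>j\<le>d a y. d (g j) (h s) \<le> 2 * \<delta>"
proof -
  note G = geodD[OF g] and H = geodD[OF h]
  obtain k where k: "geod k a1 y" using geod_ex G(6) H(5) by blast
  note K = geodD[OF k]
  have "d a1 y1 \<le> d a1 y + d y y1" by (intro d_tri G H)
  then have *: "d a1 y1 \<le> d a1 y + r" using r d_sym[OF G(6) H(6)] by simp
  have sk: "s \<le> d a1 y" using * s by linarith
  have 1: "d (h s) (k s) \<le> \<delta>" by (rule hyp[OF h k]) (use * s r in linarith)
  define j where "j = d a y - (d a1 y - s)"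
  have j: "j \<le> d a y" "d (k s) (g j) \<le> \<delta>"
    using thin_common_end(2)[OF k g r(1) sk s(1)] by (auto simp: j_def)
  have V: "h s \<in> V" "k s \<in> V" "g j \<in> V" using H(3) K(3) G(3) sk s j(1) by auto
  have "d (g j) (h s) \<le> d (g j) (k s) + d (k s) (h s)" by (intro d_tri V)
  then show ?thesis using 1 j V d_sym by (intro exI[of _ j]) auto
qed

text \<open>A chain starts with the edge from \<open>g j'\<close> to \<open>g j\<close>, takes a
  shortest crossing to \<open>h i\<close> and follows \<open>h\<close> to \<open>h t\<close>. Its
  turn at a vertex \<open>z\<close> is narrow because the chain closes up to a loop that does not
  return to \<open>z\<close>: along \<open>g\<close> to \<open>g j2\<close>, across to
  \<open>h (t + m)\<close> and back along \<open>h\<close> to \<open>h t\<close>. Minimality keeps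
  the crossing off \<open>g\<close> and \<open>h\<close> except at its ends; for a crossing of
  length 0, \<open>closest\<close> keeps the stretch of \<open>h\<close> off
  \<open>g\<close>.\<close>

lemma narrow_chain_one_side:
  assumes g: "geod g a y" and h: "geod h a1 y1"
    and t: "t + (4 * \<delta> + 1) \<le> d a1 y1" "h t \<notin> g ` {..d a y}"
    and i: "i \<le> t" "t \<le> i + (4 * \<delta> + 1)" and j: "j \<le> d a y" and q: "d (g j) (h i) \<le> 2 * \<delta>"
    and min: "\<And>i' j'. t \<le> i' + (4 * \<delta> + 1) \<Longrightarrow> i' \<le> t + (4 * \<delta> + 1) \<Longrightarrow> j' \<le> d a y \<Longrightarrow>
      d (g j) (h i) \<le> d (g j') (h i')"
    and closest: "\<And>s. d (g j) (h i) = 0 \<Longrightarrow> i < s \<Longrightarrow> s \<le> t \<Longrightarrow> h s \<notin> g ` {..d a y}"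
    and j2: "j2 \<le> d a y" "d (g j2) (h (t + (4 * \<delta> + 1))) \<le> 2 * \<delta>"
  shows "\<exists>j'\<le>d a y. (j' = Suc j \<or> j = Suc j') \<and> d (g j) (h t) \<le> 6 * \<delta> + 1 \<and>
    h t \<in> snd ` narrow_reach (g j', g j)"
proof -
  note G = geodD[OF g] and H = geodD[OF h]
  define m where "m = 4 * \<delta> + 1"
  define q where "q = d (g j) (h i)"
  have hV: "h s \<in> V" if "s \<le> t + m" for s using H(3) t(1) that by (simp add: m_def)
  have gV: "g s \<in> V" if "s \<le> d a y" for s using G(3) that .
  have hd: "d (h s) (h s') = (if s \<le> s' then s' - s else s - s')" if "s \<le> t + m" "s' \<le> t + m" for s s'
    using geod_dist[OF h] t(1) that by (simp add: m_def)
  have hinj: "h s = h s' \<longleftrightarrow> s = s'" if "s \<le> t + m" "s' \<le> t + m" for s s'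
    using geod_inj[OF h] t(1) that by (simp add: m_def)
  obtain c where c: "geod c (g j) (h i)" using geod_ex gV[OF j] hV[of i] i by auto
  note C = geodD[OF c, folded q_def]
  have K1: "c k \<noteq> h s" if "k < q" "t \<le> s + m" "s \<le> t + m" for k s
    using min[of s j] that C(7)[of k] j by (auto simp: q_def m_def)
  have K2: "c k \<noteq> g s" if "0 < k" "k \<le> q" "s \<le> d a y" for k s
    using min[of i s] that C(8)[of k] i by (auto simp: q_def m_def)
  have K3: "h s \<noteq> g s'" if "i < s" "s \<le> t" "s' \<le> d a y" for s s'
  proof (cases "q = 0")
    case True
    then show ?thesis using closest[of s] that by (auto simp: q_def)
  next
    case False
    then show ?thesis using min[of s s'] that i d_self[OF gV[of s']] by (auto simp: q_def m_def)
  qed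
  \<comment> \<open>The number of turns of the chain: at most \<open>2 * \<delta>\<close> for the
    crossing and \<open>4 * \<delta> + 1\<close> along \<open>h\<close>, as in
    \<open>narrow_reach\<close>.\<close>
  define N where "N = q + (t - i)"
  have N: "N \<le> 6 * \<delta> + 1" using i assms(8) by (simp add: N_def q_def)
  have N0: "0 < N"
  proof (rule ccontr)
    assume "\<not> 0 < N"
    then have "q = 0" "i = t" using i by (auto simp: N_def)
    then have "g j = h t" using d_eq_0[OF gV[OF j] hV[of t]] by (auto simp: q_def)
    then show False using t(2) j by (metis atMost_iff imageI)
  qed
  \<comment> \<open>This is why \<open>m\<close> is \<open>4 * \<delta> + 1\<close>:
    \<open>h (t + m)\<close> is at least \<open>m\<close> away from \<open>h i\<close>, and the two
    crossings, of length at most \<open>2 * \<delta>\<close> each, cannot meet.\<close>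
  have far: "2 * \<delta> < d (c k) (h (t + m))" if "k \<le> q" for k
  proof -
    have "d (h i) (h (t + m)) \<le> d (h i) (c k) + d (c k) (h (t + m))"
      by (intro d_tri C hV that) (use i in auto)
    then show ?thesis using C(8)[OF that] d_sym[OF C(3)[OF that] C(6)] hd[of i "t + m"] i assms(8)
      by (simp add: q_def m_def)
  qed
  have jj2: "j \<noteq> j2" using far[of 0] C(1) j2 by (auto simp: m_def)
  \<comment> \<open>The neighbour of \<open>g j\<close> on the side of \<open>g j2\<close>, so that
    the part of the loop on \<open>g\<close> avoids \<open>g j\<close>.\<close>
  define j' where "j' = (if j < j2 then Suc j else j - 1)"
  have j': "j' \<le> d a y" "j' = Suc j \<or> j = Suc j'" using j j2 jj2 by (auto simp: j'_def)
  \<comment> \<open>The crossing occupies the indices 1 to \<open>Suc q\<close>, with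
    \<open>f 1 = g j\<close>; the last vertex is \<open>f (Suc N) = h t\<close>.\<close>
  define f where "f k = (if k = 0 then g j' else if k \<le> Suc q then c (k - 1) else h (i + (k - Suc q)))" for k
  have fV: "f k \<in> V" if "k \<le> Suc N" for k
    using that gV[OF j'(1)] C(3)[of "k - 1"] hV[of "i + (k - Suc q)"] i by (auto simp: f_def N_def)
  have fstep: "d (f k) (f (Suc k)) = 1" if "k \<le> N" for k
  proof -
    consider "k = 0" | "0 < k" "k \<le> q" | "0 < k" "k = Suc q" | "0 < k" "Suc q < k" by linarith
    then show ?thesis
    proof cases
      case 1
      then show ?thesis using C(1) geod_dist[OF g j'(1) j] j' by (auto simp: f_def)
    next
      case 2
      then show ?thesis using C(4)[of "k - 1" k] by (simp add: f_def)
    next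
      case 3
      then show ?thesis using C(2) hd[of i "Suc i"] that i by (simp add: f_def N_def)
    next
      case 4
      then show ?thesis using hd[of "i + (k - Suc q)" "i + (Suc k - Suc q)"] that i by (simp add: f_def N_def)
    qed
  qed
  have f0: "f p \<noteq> f 0" if p: "0 < p" "p \<le> Suc N" for p
  proof -
    consider "p = 1" | "1 < p" "p \<le> Suc q" | "Suc q < p" using p by linarith
    then show ?thesis
    proof cases
      case 1
      then show ?thesis using C(1) geod_inj[OF g j j'(1)] j' by (auto simp: f_def)
    next
      case 2
      then show ?thesis using K2[of "p - 1" j'] j'(1) by (simp add: f_def)
    next
      case 3
      then show ?thesis using K3[of "i + (p - Suc q)" j'] that i j'(1) by (simp add: f_def N_def)
    qed
  qed
  have finj: "f p \<noteq> f p'" if p: "p < p'" "p' \<le> Suc N" for p p'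
  proof -
    consider "p = 0" | "0 < p" "p' \<le> Suc q" | "0 < p" "p \<le> q" "Suc q < p'" | "p = Suc q" "Suc q < p'" | "Suc q < p"
      using p by linarith
    then show ?thesis
    proof cases
      case 1
      then show ?thesis using f0[of p'] that by auto
    next
      case 2
      have "p - 1 \<noteq> p' - 1" "p - 1 \<le> q" "p' - 1 \<le> q" using 2 that by linarith+
      then have "c (p - 1) \<noteq> c (p' - 1)" using geod_inj[OF c] unfolding q_def by blast
      then show ?thesis using 2 that by (simp add: f_def)
    next
      case 3
      then show ?thesis using K1[of "p - 1" "i + (p' - Suc q)"] that i by (simp add: f_def N_def m_def)
    next
      case 4
      then show ?thesis using C(2) hinj[of i "i + (p' - Suc q)"] that i by (simp add: f_def N_def)
    next
      case 5
      then show ?thesis using hinj[of "i + (p - Suc q)" "i + (p' - Suc q)"] that i by (simp add: f_def N_def)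
    qed
  qed
  have fend: "f (Suc N) = h t" using i C(2) by (cases "i = t") (auto simp: f_def N_def)
  have turn: "narrow (30 * \<delta> + 10) (f (Suc k)) (f k) (f (Suc (Suc k)))" if k: "k < N" for k
  proof -
    define z where "z = f (Suc k)"
    have zc: "z = c k \<and> k \<le> q \<or> (\<exists>s. z = h s \<and> i < s \<and> s < t)"
    proof (cases "k \<le> q")
      case True
      then show ?thesis by (simp add: z_def f_def)
    next
      case False
      then show ?thesis using k i
        by (intro disjI2 exI[of _ "i + (Suc k - Suc q)"]) (auto simp: z_def f_def N_def)
    qed
    have zV: "z \<in> V" using fV k by (simp add: z_def)
    have z1: "2 * \<delta> < d z (h (t + m))"
      using zc far hd[of _ "t + m"] by (auto simp: m_def)
    have z2: "h s \<noteq> z" if "t \<le> s" "s \<le> t + m" for s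
    proof (cases "s = t")
      case True
      then show ?thesis using finj[of "Suc k" "Suc N"] fend k by (auto simp: z_def)
    next
      case False
      show ?thesis using zc
      proof (elim disjE conjE exE)
        assume "z = c k" "k \<le> q"
        then show ?thesis using K1[of k s] C(2) hinj[of i s] i that False by (cases "k = q") auto
      next
        fix s' assume "z = h s'" "i < s'" "s' < t"
        then show ?thesis using hinj[of s s'] that by auto
      qed
    qed
    have z3: "g s \<noteq> z" if "min j' j2 \<le> s" "s \<le> max j' j2" for s
    proof -
      have s: "s \<le> d a y" using that j' j2 by auto
      have sj: "s \<noteq> j" using that jj2 by (auto simp: j'_def split: if_splits)
      show ?thesis using zc
      proof (elim disjE conjE exE)
        assume *: "z = c k" "k \<le> q"
        show ?thesis
        proof (cases "k = 0")
          case True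
          then show ?thesis using * C(1) geod_inj[OF g s j] sj by auto
        next
          case False
          then show ?thesis using * K2[of k s] s by auto
        qed
      next
        fix s' assume "z = h s'" "i < s'" "s' < t"
        then show ?thesis using K3[of s' s] s by auto
      qed
    qed
    have fst0: "f 0 = g j'" by (simp add: f_def)
    have 1: "conn z k (f 0) (f k)"
      using conn_walk[of 0 k f z] fV fstep finj[of _ "Suc k"] k by (simp add: z_def less_imp_le)
    have 2: "conn z (d (g j') (g j2)) (g j') (g j2)"
      by (rule conn_geod[OF g j'(1) j2(1) z3])
    have 3: "conn z (2 * \<delta>) (h (t + m)) (g j2)"
      using z1 zV hV[of "t + m"] gV[OF j2(1)] j2(2) d_sym[of "h (t + m)" z] d_sym[of "h (t + m)" "g j2"]
      by (intro conn_short) (auto simp: m_def)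
    have 4: "conn z (d (h t) (h (t + m))) (h t) (h (t + m))"
      by (rule conn_geod[OF h]) (use t(1) z2 in \<open>auto simp: m_def\<close>)
    have "f p \<in> V \<and> f p \<noteq> z" if "Suc (Suc k) \<le> p" "p \<le> Suc N" for p
      using finj[of "Suc k" p] fV[of p] that by (simp add: z_def eq_commute)
    moreover have "d (f p) (f (Suc p)) \<le> 1" if "p < Suc N" for p
      using fstep[of p] that by simp
    ultimately have "conn z (Suc N - Suc (Suc k)) (f (Suc (Suc k))) (f (Suc N))"
      by (intro conn_walk) (use k in auto)
    then have 5: "conn z (N - Suc k) (f (Suc (Suc k))) (h t)" by (simp add: fend)
    have tot: "conn z (k + (d (g j') (g j2) + (2 * \<delta> + (d (h t) (h (t + m)) + (N - Suc k))))) (f k) (f (Suc (Suc k)))"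
      by (rule conn_trans[OF conn_sym[OF 1[unfolded fst0]] conn_trans[OF 2
          conn_trans[OF conn_sym[OF 3] conn_trans[OF conn_sym[OF 4] conn_sym[OF 5]]]]])
    have "d (g j) (g j2) \<le> d (g j) (h i) + d (h i) (g j2)" "d (h i) (g j2) \<le> d (h i) (h (t + m)) + d (h (t + m)) (g j2)"
      by (intro d_tri gV hV j j2; use i in auto)+
    then have "d (g j) (g j2) \<le> 2 * \<delta> + (2 * m + 2 * \<delta>)"
      using assms(8) j2(2) hd[of i "t + m"] i d_sym[OF hV[of "t + m"] gV[OF j2(1)]] by (simp add: m_def)
    moreover have "d (g j') (g j2) \<le> d (g j) (g j2)"
      using geod_dist[OF g j j2(1)] geod_dist[OF g j'(1) j2(1)] jj2 by (auto simp: j'_def)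
    moreover have "d (h t) (h (t + m)) = m" using hd[of t "t + m"] by simp
    \<comment> \<open>The lengths are at most \<open>6 * \<delta>\<close> on the chain,
      \<open>12 * \<delta> + 2\<close> on \<open>g\<close>, \<open>2 * \<delta>\<close> for the
      second crossing and \<open>4 * \<delta> + 1\<close> on \<open>h\<close>.\<close>
    ultimately have "k + (d (g j') (g j2) + (2 * \<delta> + (d (h t) (h (t + m)) + (N - Suc k)))) \<le> 30 * \<delta> + 10"
      using N k by (simp add: m_def)
    with tot have "conn z (30 * \<delta> + 10) (f k) (f (Suc (Suc k)))" by (rule conn_mono)
    then show ?thesis using fV[of "Suc (Suc k)"] fstep[of "Suc k"] k by (simp add: narrow_def z_def)
  qed
  have "(f N, f (Suc N)) \<in> turn_reach (narrow (30 * \<delta> + 10)) N (f 0, f 1)"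
    by (rule turn_reach_chain) (rule turn)
  moreover have "f 0 = g j'" "f 1 = g j" using C(1) by (simp_all add: f_def)
  ultimately have "(f N, h t) \<in> narrow_reach (g j', g j)"
    using turn_reach_mono[OF N] fend by (metis subsetD)
  then have "h t \<in> snd ` narrow_reach (g j', g j)"
    by (rule image_eqI[rotated]) simp
  moreover have "d (g j) (h t) \<le> 6 * \<delta> + 1"
    using d_tri[OF gV[OF j] hV[of i] hV[of t]] hd[of i t] i N by (simp add: N_def q_def)
  ultimately show ?thesis using j' by blast
qed

text \<open>The chain is built from a closest pair of points of \<open>g\<close> and of the window
  of \<open>h\<close> around \<open>t\<close>; if the point on \<open>h\<close> comes after
  \<open>t\<close>, then \<open>h\<close> is reversed.\<close>

lemma narrow_chain:
  assumes g: "geod g a y" and h: "geod h a1 y1"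
    and t: "4 * \<delta> + 1 \<le> t" "t + (4 * \<delta> + 1) \<le> d a1 y1" "h t \<notin> g ` {..d a y}"
    and left: "\<exists>j\<le>d a y. d (g j) (h (t - (4 * \<delta> + 1))) \<le> 2 * \<delta>"
    and right: "\<exists>j\<le>d a y. d (g j) (h (t + (4 * \<delta> + 1))) \<le> 2 * \<delta>"
  shows "\<exists>j\<le>d a y. \<exists>j'\<le>d a y. (j' = Suc j \<or> j = Suc j') \<and> d (g j) (h t) \<le> 6 * \<delta> + 1 \<and>
    h t \<in> snd ` narrow_reach (g j', g j)"
proof -
  note G = geodD[OF g] and H = geodD[OF h]
  define m where "m = 4 * \<delta> + 1"
  define M where "M = d a1 y1"
  have tm: "m \<le> t" "t + m \<le> M" using t by (simp_all add: m_def M_def)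
  have M': "d y1 a1 = M" using d_sym[OF H(5,6)] by (simp add: M_def)
  \<comment> \<open>The tie-break is at most \<open>m\<close> inside the window, so the weight
    \<open>m + 1\<close> makes this a lexicographic minimum: first the distance, then the closeness
    to \<open>t\<close>.\<close>
  define cost where "cost p = d (g (snd p)) (h (fst p)) * (m + 1) + (if fst p \<le> t then t - fst p else fst p - t)" for p :: "nat \<times> nat"
  define A where "A = {t - m..t + m} \<times> {..d a y}"
  have "finite A" "A \<noteq> {}" by (auto simp: A_def)
  then obtain p where p: "p \<in> A" "\<And>p'. p' \<in> A \<Longrightarrow> cost p \<le> cost p'"
    using ex_min_if_finite[of "cost ` A"] by (metis (no_types, lifting) finite_imageI image_iff image_is_empty not_le)
  obtain i j where ij: "p = (i, j)" by force
  have i: "t - m \<le> i" "i \<le> t + m" and j: "j \<le> d a y" using p(1) by (auto simp: ij A_def)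
  have min: "d (g j) (h i) \<le> d (g j') (h i')" if "t - m \<le> i'" "i' \<le> t + m" "j' \<le> d a y" for i' j'
  proof (rule ccontr)
    assume "\<not> ?thesis"
    then have "(d (g j') (h i') + 1) * (m + 1) \<le> d (g j) (h i) * (m + 1)" by (intro mult_right_mono) auto
    moreover have "cost (i, j) \<le> cost (i', j')" using p that by (auto simp: ij A_def)
    ultimately show False using i that tm by (simp add: cost_def split: if_splits)
  qed
  have closest: "(if i \<le> t then t - i else i - t) \<le> (if s \<le> t then t - s else s - t)"
    if "d (g j) (h i) = 0" "t - m \<le> s" "s \<le> t + m" and hs: "h s \<in> g ` {..d a y}" for s
  proof -
    obtain j' where "j' \<le> d a y" "h s = g j'" using hs by auto
    then have "cost (i, j) \<le> cost (s, j')" "d (g j') (h s) = 0"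
      using p that d_self[OF G(3)] by (auto simp: ij A_def)
    then show ?thesis using that by (auto simp: cost_def split: if_splits)
  qed
  obtain j1 where j1: "j1 \<le> d a y" "d (g j1) (h (t - m)) \<le> 2 * \<delta>" using left by (auto simp: m_def)
  obtain j2 where j2: "j2 \<le> d a y" "d (g j2) (h (t + m)) \<le> 2 * \<delta>" using right by (auto simp: m_def)
  have q: "d (g j) (h i) \<le> 2 * \<delta>"
    by (rule order_trans[OF min j2(2)]) (use j2(1) in auto)
  show ?thesis
  proof (cases "i \<le> t")
    case True
    have "\<exists>j'\<le>d a y. (j' = Suc j \<or> j = Suc j') \<and> d (g j) (h t) \<le> 6 * \<delta> + 1 \<and>
      h t \<in> snd ` narrow_reach (g j', g j)"
    proof (rule narrow_chain_one_side[OF g h t(2,3) True _ j q])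
      show "t \<le> i + (4 * \<delta> + 1)" using i by (simp add: m_def)
      show "d (g j) (h i) \<le> d (g j') (h i')"
        if "t \<le> i' + (4 * \<delta> + 1)" "i' \<le> t + (4 * \<delta> + 1)" "j' \<le> d a y" for i' j'
        by (rule min) (use that in \<open>auto simp: m_def\<close>)
      show "h s \<notin> g ` {..d a y}" if "d (g j) (h i) = 0" "i < s" "s \<le> t" for s
        using closest[of s] that i by auto
    qed (use j2 in \<open>auto simp: m_def\<close>)
    with j show ?thesis by blast
  next
    case False
    define h' where "h' k = h (d a1 y1 - k)" for k
    have h': "geod h' y1 a1" using geod_rev[OF h] by (simp add: h'_def[abs_def])
    have e: "h' (M - s) = h s" if "s \<le> M" for s using that by (simp add: h'_def M_def)
    have ht: "h' (M - t) = h t" and hi: "h' (M - i) = h i" using e tm i by auto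
    have "\<exists>j'\<le>d a y. (j' = Suc j \<or> j = Suc j') \<and> d (g j) (h' (M - t)) \<le> 6 * \<delta> + 1 \<and>
      h' (M - t) \<in> snd ` narrow_reach (g j', g j)"
    proof (rule narrow_chain_one_side[OF g h', of _ "M - i"])
      show "M - t + (4 * \<delta> + 1) \<le> d y1 a1" using tm unfolding M' by (simp add: m_def)
      show "h' (M - t) \<notin> g ` {..d a y}" unfolding ht by (rule t)
      show "M - i \<le> M - t" "M - t \<le> M - i + (4 * \<delta> + 1)" using False i tm by (auto simp: m_def)
      show "d (g j) (h' (M - i)) \<le> 2 * \<delta>" unfolding hi by (rule q)
      show "d (g j) (h' (M - i)) \<le> d (g j') (h' i')"
        if "M - t \<le> i' + (4 * \<delta> + 1)" "i' \<le> M - t + (4 * \<delta> + 1)" "j' \<le> d a y" for i' j'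
        using min[of "M - i'" j'] that tm unfolding hi by (simp add: h'_def m_def flip: M_def)
      show "h' s \<notin> g ` {..d a y}" if *: "d (g j) (h' (M - i)) = 0" "M - i < s" "s \<le> M - t" for s
      proof -
        have "t \<le> M - s" "M - s < i" using * tm by linarith+
        moreover have "h' s = h (M - s)" by (simp add: h'_def M_def)
        ultimately have "t - m \<le> M - s" "M - s \<le> t + m"
          "\<not> (if i \<le> t then t - i else i - t) \<le> (if M - s \<le> t then t - (M - s) else M - s - t)" "h' s = h (M - s)"
          using i by (auto split: if_splits)
        then show ?thesis using closest[of "M - s"] *(1) unfolding hi by metis
      qed
      show "d (g j1) (h' (M - t + (4 * \<delta> + 1))) \<le> 2 * \<delta>"
      proof -
        have "M - t + (4 * \<delta> + 1) = M - (t - m)" "t - m \<le> M" using tm by (simp_all add: m_def)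
        then show ?thesis using j1(2) e[of "t - m"] by metis
      qed
    qed (use j j1 in auto)
    with j show ?thesis unfolding ht by blast
  qed
qed

text \<open>Lying on a geodesic is written as equality in the triangle inequality, which is visibly
  invariant under isometries; \<open>geod_through\<close> recovers the geodesic.\<close>

definition beam :: "'v \<Rightarrow> 'v \<Rightarrow> nat \<Rightarrow> nat \<Rightarrow> nat \<Rightarrow> 'v set" where
  "beam a y r p p' = {v \<in> V. p < d a v \<and> d a v \<le> p' \<and>
     (\<exists>a1\<in>V. \<exists>y1\<in>V. d a a1 \<le> r \<and> d y y1 \<le> r \<and> d a1 v + d v y1 = d a1 y1)}"

text \<open>The margins ensure that the points \<open>4 * \<delta> + 1\<close> steps before and
  after \<open>v\<close>, on a geodesic through \<open>v\<close>, are at least \<open>r\<close> from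
  its ends, where \<open>thin_quadrilateral\<close> ties them to \<open>g\<close>.\<close>

lemma beam_cover:
  assumes g: "geod g a y" and p: "2 * r + (4 * \<delta> + 1) \<le> p" "p' + 2 * r + (4 * \<delta> + 1) \<le> d a y"
    and v: "v \<in> beam a y r p p'"
  shows "v \<in> g ` {p<..p'} \<or> (\<exists>j j'. j \<le> d a y \<and> j' \<le> d a y \<and> (j' = Suc j \<or> j = Suc j') \<and>
    p \<le> j + (6 * \<delta> + 1) \<and> j \<le> p' + (6 * \<delta> + 1) \<and>
    v \<in> snd ` narrow_reach (g j', g j))"
proof (cases "v \<in> g ` {..d a y}")
  case True
  then obtain i where "i \<le> d a y" "v = g i" by auto
  then show ?thesis using geodD(7)[OF g, of i] v by (auto simp: beam_def)
next
  case False
  note G = geodD[OF g]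
  obtain a1 y1 where *: "v \<in> V" "p < d a v" "d a v \<le> p'" "a1 \<in> V" "y1 \<in> V" "d a a1 \<le> r" "d y y1 \<le> r"
    "d a1 v + d v y1 = d a1 y1" using v by (auto simp: beam_def)
  obtain h where h: "geod h a1 y1" "h (d a1 v) = v" using geod_through * by blast
  define t where "t = d a1 v"
  have 1: "d a v \<le> d a a1 + d a1 v" by (intro d_tri G *)
  have 2: "d a y \<le> d a v + d v y" "d v y \<le> d v y1 + d y1 y" by (intro d_tri G *)+
  have s: "d y1 y = d y y1" "d a1 a = d a a1" using d_sym G * by blast+
  have t1: "r + (4 * \<delta> + 1) \<le> t" using 1 * p by (simp add: t_def)
  have t2: "t + (r + (4 * \<delta> + 1)) \<le> d a1 y1" using 2 s * p by (simp add: t_def)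
  have "\<exists>j\<le>d a y. \<exists>j'\<le>d a y. (j' = Suc j \<or> j = Suc j') \<and> d (g j) (h t) \<le> 6 * \<delta> + 1 \<and>
    h t \<in> snd ` narrow_reach (g j', g j)"
    by (rule narrow_chain[OF g h(1)])
      (use t1 t2 False h(2) s * thin_quadrilateral[OF g h(1), of r] in \<open>auto simp: t_def\<close>)
  then obtain j j' where j: "j \<le> d a y" "j' \<le> d a y" "j' = Suc j \<or> j = Suc j'" "d (g j) v \<le> 6 * \<delta> + 1"
    "v \<in> snd ` narrow_reach (g j', g j)"
    unfolding t_def h(2) by blast
  have "d a v \<le> d a (g j) + d (g j) v" "d a (g j) \<le> d a v + d v (g j)"
    by (intro d_tri G j *)+
  then have "d a v \<le> j + (6 * \<delta> + 1)" "j \<le> d a v + (6 * \<delta> + 1)"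
    using G(7)[OF j(1)] j(4) d_sym[OF *(1) G(3)[OF j(1)]] by simp_all
  with * j show ?thesis by (intro disjI2 exI[of _ j] exI[of _ j']) auto
qed

lemma finite_narrow_reach:
  assumes "u \<in> V" "v \<in> V" "d u v = 1" shows "finite (turn_reach (narrow l) k (u, v))"
  by (rule finite_turn_reach[where I = "\<lambda>(u, v). u \<in> V \<and> v \<in> V \<and> d u v = 1"])
    (use assms fine d_sym in \<open>auto simp: narrow_def\<close>)

text \<open>Each position on \<open>g\<close> has at most two edges, and each of them reaches at
  most \<open>c0\<close> vertices. The bound is linear in the width of the window and the same for
  all admissible radii \<open>r\<close>, which makes averaging over radii effective.\<close>

lemma card_beam_le:
  assumes g: "geod g a y" and p: "2 * r + (4 * \<delta> + 1) \<le> p" "p' + 2 * r + (4 * \<delta> + 1) \<le> d a y" "p \<le> p'"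
    and c0: "\<And>u v. u \<in> V \<Longrightarrow> v \<in> V \<Longrightarrow> d u v = 1 \<Longrightarrow>
      card (narrow_reach (u, v)) \<le> c0"
  shows "finite (beam a y r p p')" "card (beam a y r p p') \<le> (p' - p + 1) * (1 + 2 * c0 * (12 * \<delta> + 3))"
proof -
  define H where "H = 6 * \<delta> + 1"
  define R where "R e = snd ` turn_reach (narrow (30 * \<delta> + 10)) H e" for e
  \<comment> \<open>The positions of \<open>beam_cover\<close>, with a flag for the neighbour
    \<open>Suc j\<close> or \<open>j - 1\<close>. At \<open>j = 0\<close> the latter is
    \<open>j\<close> itself, which \<open>W\<close> excludes.\<close>
  define J where "J = {p - H..p' + H} \<times> (UNIV :: bool set)"
  define W where "W x = (let j = fst x; j' = if snd x then Suc j else j - 1 in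
    if j \<le> d a y \<and> j' \<le> d a y \<and> j' \<noteq> j then R (g j', g j) else {})" for x :: "nat \<times> bool"
  have W: "finite (W x) \<and> card (W x) \<le> c0" for x
  proof -
    obtain j b where x: "x = (j, b)" by force
    define j' where "j' = (if b then Suc j else j - 1)"
    show ?thesis
    proof (cases "j \<le> d a y \<and> j' \<le> d a y \<and> j' \<noteq> j")
      case True
      then have e: "g j' \<in> V" "g j \<in> V" "d (g j') (g j) = 1"
        using geodD(3)[OF g] geod_dist[OF g, of j' j] by (auto simp: j'_def split: if_splits)
      have "card (R (g j', g j)) \<le> c0"
        using card_image_le[OF finite_narrow_reach[OF e]] c0[OF e] unfolding R_def H_def by (rule order_trans)
      moreover have "finite (R (g j', g j))" using finite_narrow_reach[OF e] by (simp add: R_def)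
      ultimately show ?thesis using True by (simp add: W_def x j'_def Let_def)
    next
      case False
      then show ?thesis by (auto simp: W_def x j'_def Let_def)
    qed
  qed
  have sub: "beam a y r p p' \<subseteq> g ` {p<..p'} \<union> (\<Union>x\<in>J. W x)"
  proof
    fix v assume "v \<in> beam a y r p p'"
    from beam_cover[OF g p(1,2) this] show "v \<in> g ` {p<..p'} \<union> (\<Union>x\<in>J. W x)"
    proof (elim disjE exE conjE)
      fix j j' assume *: "j \<le> d a y" "j' \<le> d a y" "p \<le> j + (6 * \<delta> + 1)" "j \<le> p' + (6 * \<delta> + 1)"
        "v \<in> snd ` narrow_reach (g j', g j)" "j' = Suc j"
      then have "v \<in> W (j, True)" "(j, True) \<in> J" by (auto simp: W_def J_def R_def H_def)
      then show ?thesis by blast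
    next
      fix j j' assume *: "j \<le> d a y" "j' \<le> d a y" "p \<le> j + (6 * \<delta> + 1)" "j \<le> p' + (6 * \<delta> + 1)"
        "v \<in> snd ` narrow_reach (g j', g j)" "j = Suc j'"
      then have "v \<in> W (j, False)" "(j, False) \<in> J" by (auto simp: W_def J_def R_def H_def)
      then show ?thesis by blast
    qed simp
  qed
  have fin: "finite J" by (simp add: J_def)
  then have fin2: "finite (g ` {p<..p'} \<union> (\<Union>x\<in>J. W x))" using W by auto
  then show "finite (beam a y r p p')" using sub finite_subset by blast
  have "card (beam a y r p p') \<le> card (g ` {p<..p'} \<union> (\<Union>x\<in>J. W x))"
    by (rule card_mono[OF fin2 sub])
  also have "\<dots> \<le> card (g ` {p<..p'}) + card (\<Union>x\<in>J. W x)" by (rule card_Un_le)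
  also have "card (g ` {p<..p'}) \<le> p' - p" using card_image_le[of "{p<..p'}" g] by simp
  also have "card (\<Union>x\<in>J. W x) \<le> (\<Sum>x\<in>J. card (W x))" by (rule card_UN_le[OF fin])
  also have "\<dots> \<le> card J * c0" using sum_bounded_above[of J "\<lambda>x. card (W x)" c0] W by simp
  also have "card J \<le> (p' - p + 1) * (2 * (12 * \<delta> + 3))"
  proof -
    have "card J = 2 * (Suc (p' + H) - (p - H))" by (simp add: J_def card_cartesian_product)
    also have "Suc (p' + H) - (p - H) \<le> (p' - p) + (12 * \<delta> + 3)" using p by (simp add: H_def)
    also have "\<dots> \<le> (p' - p) * (12 * \<delta> + 3) + (12 * \<delta> + 3)" by simp
    finally show ?thesis by (simp add: algebra_simps)
  qed
  finally have "card (beam a y r p p') \<le> (p' - p) + (p' - p + 1) * (2 * (12 * \<delta> + 3)) * c0" by simp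
  then show "card (beam a y r p p') \<le> (p' - p + 1) * (1 + 2 * c0 * (12 * \<delta> + 3))" by (simp add: algebra_simps)
qed

end

section \<open>Finite signed sums and stopped measures\<close>

text \<open>Bounding all finite partial sums spares any discussion of supports and summability.\<close>

definition l1_le :: "('x \<Rightarrow> real) \<Rightarrow> real \<Rightarrow> bool" where
  "l1_le f e \<longleftrightarrow> (\<forall>T. finite T \<longrightarrow> (\<Sum>x\<in>T. \<bar>f x\<bar>) \<le> e)"

lemma l1_leD: "l1_le f e \<Longrightarrow> finite T \<Longrightarrow> (\<Sum>x\<in>T. \<bar>f x\<bar>) \<le> e"
  by (simp add: l1_le_def)

lemma l1_le_mono: "l1_le f e \<Longrightarrow> e \<le> e' \<Longrightarrow> l1_le f e'"
  unfolding l1_le_def by (meson order_trans)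

lemma l1_le_dominated: "l1_le f e \<Longrightarrow> (\<And>x. \<bar>g x\<bar> \<le> \<bar>f x\<bar>) \<Longrightarrow> l1_le g e"
  unfolding l1_le_def by (meson order_trans sum_mono)

lemma l1_le_nonneg: "l1_le f e \<Longrightarrow> 0 \<le> e"
  unfolding l1_le_def by (metis finite.emptyI sum.empty)

lemma l1_le_add: "l1_le f a \<Longrightarrow> l1_le g b \<Longrightarrow> l1_le (\<lambda>x. f x + g x) (a + b)"
  unfolding l1_le_def
proof (intro allI impI)
  fix T :: "'a set" assume *: "\<forall>T. finite T \<longrightarrow> (\<Sum>x\<in>T. \<bar>f x\<bar>) \<le> a" "\<forall>T. finite T \<longrightarrow> (\<Sum>x\<in>T. \<bar>g x\<bar>) \<le> b" "finite T"
  have "(\<Sum>x\<in>T. \<bar>f x + g x\<bar>) \<le> (\<Sum>x\<in>T. \<bar>f x\<bar> + \<bar>g x\<bar>)" by (intro sum_mono abs_triangle_ineq)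
  also have "\<dots> \<le> a + b" using * by (simp add: sum.distrib add_mono)
  finally show "(\<Sum>x\<in>T. \<bar>f x + g x\<bar>) \<le> a + b" .
qed

lemma l1_le_minus: "l1_le f a \<Longrightarrow> l1_le (\<lambda>x. - f x) a"
  unfolding l1_le_def by simp

lemma l1_le_diff: "l1_le f a \<Longrightarrow> l1_le g b \<Longrightarrow> l1_le (\<lambda>x. f x - g x) (a + b)"
  using l1_le_add[of f a "\<lambda>x. - g x" b] l1_le_minus[of g b] by simp

lemma l1_le_swap: "l1_le (\<lambda>x. f x - g x) a \<Longrightarrow> l1_le (\<lambda>x. g x - f x) a"
  using l1_le_minus[of "\<lambda>x. f x - g x" a] by simp

lemma l1_le_triangle: "l1_le (\<lambda>x. f x - g x) a \<Longrightarrow> l1_le (\<lambda>x. g x - h x) b \<Longrightarrow> l1_le (\<lambda>x. f x - h x) (a + b)"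
  using l1_le_add[of "\<lambda>x. f x - g x" a "\<lambda>x. g x - h x" b] by simp

lemma l1_le_0: "0 \<le> e \<Longrightarrow> l1_le (\<lambda>x. 0) e"
  by (simp add: l1_le_def)

lemma l1_le_cmult: "l1_le f e \<Longrightarrow> l1_le (\<lambda>x. c * f x) (\<bar>c\<bar> * e)"
  unfolding l1_le_def by (auto simp: abs_mult mult_left_mono simp flip: sum_distrib_left)

lemma l1_le_sum: "(\<And>i. i \<in> I \<Longrightarrow> l1_le (f i) (e i)) \<Longrightarrow> l1_le (\<lambda>x. \<Sum>i\<in>I. f i x) (\<Sum>i\<in>I. e i)"
proof (induction I rule: infinite_finite_induct)
  case (insert i I)
  then have "l1_le (\<lambda>x. f i x + (\<Sum>i\<in>I. f i x)) (e i + (\<Sum>i\<in>I. e i))" by (intro l1_le_add) auto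
  with insert show ?case by simp
qed (simp_all add: l1_le_0)

lemma l1_le_support:
  assumes "finite A" "\<And>x. x \<notin> A \<Longrightarrow> f x = 0" "(\<Sum>x\<in>A. \<bar>f x\<bar>) \<le> e"
  shows "l1_le f e"
  unfolding l1_le_def
proof (intro allI impI)
  fix T :: "'a set" assume T: "finite T"
  have "(\<Sum>x\<in>T. \<bar>f x\<bar>) = (\<Sum>x\<in>T \<inter> A. \<bar>f x\<bar>)"
    using assms T by (intro sum.mono_neutral_right) auto
  also have "\<dots> \<le> (\<Sum>x\<in>A. \<bar>f x\<bar>)" using assms by (intro sum_mono2) auto
  finally show "(\<Sum>x\<in>T. \<bar>f x\<bar>) \<le> e" using assms(3) by simp
qed

definition unif :: "'x set \<Rightarrow> 'x \<Rightarrow> real" where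
  "unif A x = (if x \<in> A then 1 / real (card A) else 0)"

lemma unif_nonneg: "0 \<le> unif A x"
  by (simp add: unif_def)

lemma sum_unif:
  assumes "finite B" "A \<subseteq> B" "A \<noteq> {}" shows "(\<Sum>x\<in>B. unif A x) = 1"
proof -
  have "finite A" using assms finite_subset by blast
  have "(\<Sum>x\<in>B. unif A x) = (\<Sum>x\<in>A. 1 / real (card A))"
    using assms by (intro sum.mono_neutral_cong_right) (auto simp: unif_def)
  then show ?thesis using assms \<open>finite A\<close> by simp
qed

text \<open>For an empty or infinite set the cardinality is 0 and division by 0 yields the zero
  function.\<close>

lemma l1_le_unif: "l1_le (unif A) 1"
proof (cases "finite A \<and> A \<noteq> {}")
  case True
  then show ?thesis using sum_unif[of A A] by (intro l1_le_support[of A]) (auto simp: unif_def)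
next
  case False
  then have "card A = 0" by auto
  then have "unif A = (\<lambda>x. 0)" by (auto simp: unif_def)
  then show ?thesis by (simp add: l1_le_0)
qed

text \<open>The change is at most twice the size of the symmetric difference, relative to the size
  of \<open>A\<close>; so a lower bound for one of the two sets is enough.\<close>

lemma l1_le_unif_diff:
  assumes "finite A" "finite B" "B \<noteq> {}" "0 < n" "n \<le> card A" "card (A - B) + card (B - A) \<le> k"
  shows "l1_le (\<lambda>x. unif A x - unif B x) (2 * real k / real n)"
proof (rule l1_le_support[of "A \<union> B"])
  define a b where "a = real (card A)" and "b = real (card B)"
  have pos: "a > 0" "b > 0" using assms by (auto simp: a_def b_def card_gt_0_iff)
  have ab: "card (A \<inter> B) + card (A - B) = card A" "card (A \<inter> B) + card (B - A) = card B"
    using card_Int_Diff[OF assms(1), of B] card_Int_Diff[OF assms(2), of A] by (simp_all add: Int_commute)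
  have U: "A \<union> B = (A \<inter> B) \<union> ((A - B) \<union> (B - A))" by blast
  have "(\<Sum>x\<in>A \<union> B. \<bar>unif A x - unif B x\<bar>) =
      (\<Sum>x\<in>A \<inter> B. \<bar>unif A x - unif B x\<bar>) + ((\<Sum>x\<in>A - B. \<bar>unif A x - unif B x\<bar>) + (\<Sum>x\<in>B - A. \<bar>unif A x - unif B x\<bar>))"
    (is "?lhs = ?i + (?p + ?q)")
  proof -
    have "?lhs = ?i + (\<Sum>x\<in>(A - B) \<union> (B - A). \<bar>unif A x - unif B x\<bar>)"
      unfolding U by (rule sum.union_disjoint) (use assms(1,2) in auto)
    also have "(\<Sum>x\<in>(A - B) \<union> (B - A). \<bar>unif A x - unif B x\<bar>) = ?p + ?q"
      by (rule sum.union_disjoint) (use assms(1,2) in auto)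
    finally show ?thesis .
  qed
  also have "(\<Sum>x\<in>A \<inter> B. \<bar>unif A x - unif B x\<bar>) = real (card (A \<inter> B)) * \<bar>1 / a - 1 / b\<bar>"
    by (simp add: unif_def a_def b_def)
  also have "(\<Sum>x\<in>A - B. \<bar>unif A x - unif B x\<bar>) = real (card (A - B)) / a"
    by (simp add: unif_def a_def)
  also have "(\<Sum>x\<in>B - A. \<bar>unif A x - unif B x\<bar>) = real (card (B - A)) / b"
    by (simp add: unif_def b_def)
  also have "real (card (A \<inter> B)) * \<bar>1 / a - 1 / b\<bar> + (real (card (A - B)) / a + real (card (B - A)) / b)
      \<le> 2 * real k / a"
  proof -
    define i p q where "i = real (card (A \<inter> B))" and "p = real (card (A - B))" and "q = real (card (B - A))"
    have e: "a = i + p" "b = i + q" "0 \<le> i" "0 \<le> p" "0 \<le> q" "p + q \<le> real k"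
      using ab assms(6) by (simp_all add: a_def b_def i_def p_def q_def flip: of_nat_add)
    have "\<bar>1 / a - 1 / b\<bar> = \<bar>b - a\<bar> / (a * b)" using pos by (simp add: field_simps)
    then have "i * \<bar>1 / a - 1 / b\<bar> + q / b = (i * \<bar>b - a\<bar> + q * a) / (a * b)" using pos by (simp add: field_simps)
    also have "\<dots> \<le> ((p + 2 * q) * b) / (a * b)"
    proof (intro divide_right_mono)
      have "i * \<bar>b - a\<bar> + q * a \<le> i * (p + q) + q * (i + p)"
        using e by (intro add_mono mult_left_mono) auto
      also have "\<dots> \<le> (p + 2 * q) * b"
        using mult_nonneg_nonneg[OF e(4,5)] mult_nonneg_nonneg[OF e(5,5)] by (simp add: e(2) algebra_simps)
      finally show "i * \<bar>b - a\<bar> + q * a \<le> (p + 2 * q) * b" .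
    qed (use pos in auto)
    also have "\<dots> = (p + 2 * q) / a" using pos by simp
    finally have "i * \<bar>1 / a - 1 / b\<bar> + (p / a + q / b) \<le> (2 * (p + q)) / a"
      by (simp add: add_divide_distrib)
    also have "\<dots> \<le> 2 * real k / a" using e pos by (intro divide_right_mono) auto
    finally show ?thesis by (simp add: i_def p_def q_def)
  qed
  also have "\<dots> \<le> 2 * real k / real n" using assms pos by (intro divide_left_mono) (auto simp: a_def)
  finally show "(\<Sum>x\<in>A \<union> B. \<bar>unif A x - unif B x\<bar>) \<le> 2 * real k / real n" by simp
qed (use assms in \<open>auto simp: unif_def\<close>)

text \<open>A path \<open>g\<close> of length \<open>m\<close> with turns \<open>\<tau>\<close>: place the mass at the first vertex where the turn is
  at least \<open>\<theta>\<close>, if it occurs within the first \<open>k\<close> steps, and distribute it according to \<open>\<eta>\<close> otherwise;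
  then average over \<open>\<theta>\<close> and \<open>k\<close>.\<close>

definition hits :: "('v \<Rightarrow> nat) \<Rightarrow> (nat \<Rightarrow> 'v) \<Rightarrow> nat \<Rightarrow> nat \<Rightarrow> nat \<Rightarrow> bool" where
  "hits \<tau> g m \<theta> k \<longleftrightarrow> (\<exists>i\<le>m. i \<le> k \<and> \<theta> \<le> \<tau> (g i))"

definition first_hit :: "('v \<Rightarrow> nat) \<Rightarrow> (nat \<Rightarrow> 'v) \<Rightarrow> nat \<Rightarrow> nat \<Rightarrow> nat" where
  "first_hit \<tau> g m \<theta> = (LEAST i. i \<le> m \<and> \<theta> \<le> \<tau> (g i))"

definition stopped ::
    "('v \<Rightarrow> nat) \<Rightarrow> (nat \<Rightarrow> 'v) \<Rightarrow> nat \<Rightarrow> ('v \<Rightarrow> real) \<Rightarrow> nat \<Rightarrow> nat \<Rightarrow> 'v \<Rightarrow> real" where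
  "stopped \<tau> g m \<eta> \<theta> k v =
     (if hits \<tau> g m \<theta> k then (if v = g (first_hit \<tau> g m \<theta>) then 1 else 0) else \<eta> v)"

definition stopped_avg ::
    "nat \<Rightarrow> nat \<Rightarrow> nat \<Rightarrow> ('v \<Rightarrow> nat) \<Rightarrow> (nat \<Rightarrow> 'v) \<Rightarrow> nat \<Rightarrow> ('v \<Rightarrow> real) \<Rightarrow> 'v \<Rightarrow> real" where
  "stopped_avg L K n \<tau> g m \<eta> v =
     (\<Sum>(\<theta>, k)\<in>{1..L} \<times> {K<..K + n}. stopped \<tau> g m \<eta> \<theta> k v) / (real L * real n)"

lemma first_hit:
  assumes "hits \<tau> g m \<theta> k"
  shows "first_hit \<tau> g m \<theta> \<le> m" "first_hit \<tau> g m \<theta> \<le> k" "\<theta> \<le> \<tau> (g (first_hit \<tau> g m \<theta>))"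
    "\<And>i. i < first_hit \<tau> g m \<theta> \<Longrightarrow> \<tau> (g i) < \<theta>"
proof -
  obtain i where i: "i \<le> m" "i \<le> k" "\<theta> \<le> \<tau> (g i)" using assms by (auto simp: hits_def)
  have *: "first_hit \<tau> g m \<theta> \<le> m \<and> \<theta> \<le> \<tau> (g (first_hit \<tau> g m \<theta>))"
    unfolding first_hit_def by (rule LeastI[of _ i]) (use i in simp)
  then show "first_hit \<tau> g m \<theta> \<le> m" "\<theta> \<le> \<tau> (g (first_hit \<tau> g m \<theta>))" by blast+
  have "first_hit \<tau> g m \<theta> \<le> i" unfolding first_hit_def by (rule Least_le) (use i in simp)
  then show "first_hit \<tau> g m \<theta> \<le> k" using i by simp
  show "\<tau> (g i) < \<theta>" if "i < first_hit \<tau> g m \<theta>" for i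
    using not_less_Least[of i "\<lambda>i. i \<le> m \<and> \<theta> \<le> \<tau> (g i)"] that * by (auto simp: first_hit_def)
qed

text \<open>The position of the first hit is independent of the horizon, which only decides whether
  the hit counts.\<close>

lemma hits_iff_first_hit: "hits \<tau> g m \<theta> k \<Longrightarrow> hits \<tau> g m \<theta> l \<longleftrightarrow> first_hit \<tau> g m \<theta> \<le> l"
  by (metis (no_types) first_hit(1-3) hits_def)

lemma l1_le_stopped: "l1_le \<eta> 1 \<Longrightarrow> l1_le (stopped \<tau> g m \<eta> \<theta> k) 1"
proof (cases "hits \<tau> g m \<theta> k")
  case True
  then show ?thesis by (intro l1_le_support[of "{g (first_hit \<tau> g m \<theta>)}"]) (auto simp: stopped_def)
next
  case False
  then have "stopped \<tau> g m \<eta> \<theta> k = \<eta>" by (auto simp: stopped_def)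
  then show "l1_le \<eta> 1 \<Longrightarrow> ?thesis" by simp
qed

lemma sum_stopped_avg:
  assumes "0 < L" "0 < n"
    and "\<And>\<theta> k. 1 \<le> \<theta> \<Longrightarrow> \<theta> \<le> L \<Longrightarrow> K < k \<Longrightarrow> k \<le> K + n \<Longrightarrow> (\<Sum>v\<in>B. stopped \<tau> g m \<eta> \<theta> k v) = 1"
  shows "(\<Sum>v\<in>B. stopped_avg L K n \<tau> g m \<eta> v) = 1"
proof -
  have "(\<Sum>v\<in>B. stopped_avg L K n \<tau> g m \<eta> v) =
     (\<Sum>v\<in>B. \<Sum>(\<theta>, k)\<in>{1..L} \<times> {K<..K + n}. stopped \<tau> g m \<eta> \<theta> k v) / (real L * real n)"
    by (simp add: stopped_avg_def sum_divide_distrib)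
  also have "(\<Sum>v\<in>B. \<Sum>(\<theta>, k)\<in>{1..L} \<times> {K<..K + n}. stopped \<tau> g m \<eta> \<theta> k v) =
     (\<Sum>x\<in>{1..L} \<times> {K<..K + n}. \<Sum>v\<in>B. stopped \<tau> g m \<eta> (fst x) (snd x) v)"
    by (subst sum.swap) (simp add: case_prod_unfold)
  also have "\<dots> = (\<Sum>x\<in>{1..L} \<times> {K<..K + n}. 1)" using assms(3) by (intro sum.cong) auto
  also have "\<dots> = real L * real n" by (simp add: card_cartesian_product)
  finally show ?thesis using assms by simp
qed

text \<open>At a given vertex at most four thresholds lie between \<tau> and \<tau>', and only the
  first \<open>K + n + D + 1\<close> vertices of either path matter, so at most
  \<open>8 * (K + n + D + 1)\<close> of the \<open>L\<close> thresholds are bad. For any other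
  threshold both paths stop at the same vertex, at positions differing by at most \<open>D\<close>,
  and at most \<open>D\<close> of the \<open>n\<close> horizons separate these positions. A bad pair
  of threshold and horizon costs 2, any other at most \<open>e\<close>.\<close>

lemma stopped_avg_compare:
  assumes pos: "0 < L" "0 < n"
    and \<tau>: "\<And>v. \<tau> v \<le> \<tau>' v + 4" "\<And>v. \<tau>' v \<le> \<tau> v + 4"
    and off: "\<And>v. v \<notin> g ` {..m} \<Longrightarrow> \<tau> v = 0" "\<And>v. v \<notin> g' ` {..m'} \<Longrightarrow> \<tau>' v = 0"
    and ord: "\<And>i i' j j'. i \<le> m \<Longrightarrow> i' \<le> m' \<Longrightarrow> j \<le> m \<Longrightarrow> j' \<le> m' \<Longrightarrow> g i = g' i' \<Longrightarrow> g j = g' j' \<Longrightarrow> i \<le> j \<longleftrightarrow> i' \<le> j'"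
    and lev: "\<And>i i'. i \<le> m \<Longrightarrow> i' \<le> m' \<Longrightarrow> g i = g' i' \<Longrightarrow> i \<le> i' + D \<and> i' \<le> i + D"
    and \<eta>: "l1_le \<eta> 1" "l1_le \<eta>' 1"
    and e: "0 \<le> e" "\<And>\<theta> k. 1 \<le> \<theta> \<Longrightarrow> \<theta> \<le> L \<Longrightarrow> K < k \<Longrightarrow> k \<le> K + n \<Longrightarrow> \<not> hits \<tau> g m \<theta> k \<Longrightarrow>
      \<not> hits \<tau>' g' m' \<theta> k \<Longrightarrow> l1_le (\<lambda>v. \<eta> v - \<eta>' v) e"
  shows "l1_le (\<lambda>v. stopped_avg L K n \<tau> g m \<eta> v - stopped_avg L K n \<tau>' g' m' \<eta>' v)
    (e + 16 * (real (K + n + D) + 1) / real L + 2 * real D / real n)"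
proof -
  \<comment> \<open>A hit on one path by time \<open>K + n\<close> may occur on the other up to
    \<open>D\<close> later.\<close>
  define X where "X = K + n + D"
  define W where "W = g ` {..X} \<union> g' ` {..X}"
  define bad where "bad = {\<theta>. \<exists>v\<in>W. (\<theta> \<le> \<tau> v) \<noteq> (\<theta> \<le> \<tau>' v)}"
  have finW: "finite W" by (simp add: W_def)
  have bad: "finite bad \<and> card bad \<le> 8 * (X + 1)"
  proof -
    have sub: "bad \<subseteq> (\<Union>v\<in>W. {min (\<tau> v) (\<tau>' v)<..min (\<tau> v) (\<tau>' v) + 4})"
    proof
      fix \<theta> assume "\<theta> \<in> bad"
      then obtain v where v: "v \<in> W" "(\<theta> \<le> \<tau> v) \<noteq> (\<theta> \<le> \<tau>' v)" by (auto simp: bad_def)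
      then have "\<theta> \<in> {min (\<tau> v) (\<tau>' v)<..min (\<tau> v) (\<tau>' v) + 4}" using \<tau>[of v] by auto
      with v show "\<theta> \<in> (\<Union>v\<in>W. {min (\<tau> v) (\<tau>' v)<..min (\<tau> v) (\<tau>' v) + 4})" by blast
    qed
    have fin: "finite (\<Union>v\<in>W. {min (\<tau> v) (\<tau>' v)<..min (\<tau> v) (\<tau>' v) + 4})" using finW by simp
    have "card bad \<le> card (\<Union>v\<in>W. {min (\<tau> v) (\<tau>' v)<..min (\<tau> v) (\<tau>' v) + 4})"
      by (rule card_mono[OF fin sub])
    also have "\<dots> \<le> (\<Sum>v\<in>W. card {min (\<tau> v) (\<tau>' v)<..min (\<tau> v) (\<tau>' v) + 4})"
      by (rule card_UN_le[OF finW])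
    also have "\<dots> = 4 * card W" by simp
    also have "card W \<le> card (g ` {..X}) + card (g' ` {..X})" unfolding W_def by (rule card_Un_le)
    also have "\<dots> \<le> 2 * (X + 1)" using card_image_le[of "{..X}" g] card_image_le[of "{..X}" g'] by simp
    finally have "card bad \<le> 8 * (X + 1)" by simp
    then show ?thesis using finite_subset[OF sub fin] by blast
  qed
  \<comment> \<open>A first hit on one path is a vertex of the other, since turns vanish off a path
    and \<open>\<theta> \<ge> 1\<close>. It is the first hit there too, because common vertices come
    in the same order.\<close>
  have same: "hits \<tau>2 g2 m2 \<theta> X \<and> g2 (first_hit \<tau>2 g2 m2 \<theta>) = g1 (first_hit \<tau>1 g1 m1 \<theta>) \<and>
      first_hit \<tau>2 g2 m2 \<theta> \<le> first_hit \<tau>1 g1 m1 \<theta> + D"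
    if h: "hits \<tau>1 g1 m1 \<theta> k" "k \<le> K + n" and \<theta>: "1 \<le> \<theta>"
      and off1: "\<And>v. v \<notin> g1 ` {..m1} \<Longrightarrow> \<tau>1 v = 0" and off2: "\<And>v. v \<notin> g2 ` {..m2} \<Longrightarrow> \<tau>2 v = 0"
      and good1: "\<And>i. i \<le> X \<Longrightarrow> \<theta> \<le> \<tau>1 (g1 i) \<longleftrightarrow> \<theta> \<le> \<tau>2 (g1 i)"
      and good2: "\<And>i. i \<le> X \<Longrightarrow> \<theta> \<le> \<tau>1 (g2 i) \<longleftrightarrow> \<theta> \<le> \<tau>2 (g2 i)"
      and ord: "\<And>i i' j j'. i \<le> m1 \<Longrightarrow> i' \<le> m2 \<Longrightarrow> j \<le> m1 \<Longrightarrow> j' \<le> m2 \<Longrightarrow> g1 i = g2 i' \<Longrightarrow> g1 j = g2 j' \<Longrightarrow> i \<le> j \<longleftrightarrow> i' \<le> j'"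
      and lev: "\<And>i i'. i \<le> m1 \<Longrightarrow> i' \<le> m2 \<Longrightarrow> g1 i = g2 i' \<Longrightarrow> i' \<le> i + D"
    for \<tau>1 \<tau>2 :: "'a \<Rightarrow> nat" and g1 g2 :: "nat \<Rightarrow> 'a" and m1 m2 \<theta> k
  proof -
    define i where "i = first_hit \<tau>1 g1 m1 \<theta>"
    note i = first_hit[OF h(1), folded i_def]
    have iX: "i \<le> X" using i(2) h(2) by (simp add: X_def)
    then have "\<theta> \<le> \<tau>2 (g1 i)" using good1 i(3) by blast
    then have "g1 i \<in> g2 ` {..m2}" using off2[of "g1 i"] \<theta> by fastforce
    then obtain i' where i': "i' \<le> m2" "g1 i = g2 i'" by auto
    have i'D: "i' \<le> i + D" using lev[OF i(1) i'] .
    then have i'X: "i' \<le> X" using i(2) h(2) by (simp add: X_def)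
    have "first_hit \<tau>2 g2 m2 \<theta> = i'"
      unfolding first_hit_def
    proof (rule Least_equality)
      show "i' \<le> m2 \<and> \<theta> \<le> \<tau>2 (g2 i')" using i' \<open>\<theta> \<le> \<tau>2 (g1 i)\<close> by simp
      fix j' assume j': "j' \<le> m2 \<and> \<theta> \<le> \<tau>2 (g2 j')"
      show "i' \<le> j'"
      proof (rule ccontr)
        assume n: "\<not> i' \<le> j'"
        then have t: "\<theta> \<le> \<tau>1 (g2 j')" using good2[of j'] j' i'X by simp
        then have "g2 j' \<in> g1 ` {..m1}" using off1[of "g2 j'"] \<theta> by fastforce
        then obtain j where j: "j \<le> m1" "g1 j = g2 j'" by auto
        then have "\<not> i \<le> j" using ord[OF i(1) i'(1) j(1) _ i'(2) j(2)] j' n by blast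
        then show False using i(4)[of j] t j(2) by simp
      qed
    qed
    moreover have "hits \<tau>2 g2 m2 \<theta> X" unfolding hits_def using i' i'X \<open>\<theta> \<le> \<tau>2 (g1 i)\<close> by auto
    ultimately show ?thesis using i' i'D by (simp add: i_def)
  qed
  define kbad where "kbad \<theta> = {k\<in>{K<..K + n}. hits \<tau> g m \<theta> k \<noteq> hits \<tau>' g' m' \<theta> k}" for \<theta>
  have good: "card (kbad \<theta>) \<le> D \<and> (\<forall>k\<in>{K<..K + n} - kbad \<theta>.
      l1_le (\<lambda>v. stopped \<tau> g m \<eta> \<theta> k v - stopped \<tau>' g' m' \<eta>' \<theta> k v) e)"
    if \<theta>: "1 \<le> \<theta>" "\<theta> \<le> L" "\<theta> \<notin> bad" for \<theta>
  proof (cases "\<exists>k\<le>K + n. hits \<tau> g m \<theta> k \<or> hits \<tau>' g' m' \<theta> k")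
    case False
    then have "\<not> hits \<tau> g m \<theta> k \<and> \<not> hits \<tau>' g' m' \<theta> k" if "k \<le> K + n" for k using that by blast
    moreover from this have "kbad \<theta> = {}" by (auto simp: kbad_def)
    ultimately show ?thesis using e(2)[OF \<theta>(1,2)] by (auto simp: stopped_def)
  next
    case True
    have g1: "\<theta> \<le> \<tau> (g i) \<longleftrightarrow> \<theta> \<le> \<tau>' (g i)" "\<theta> \<le> \<tau> (g' i) \<longleftrightarrow> \<theta> \<le> \<tau>' (g' i)" if "i \<le> X" for i
      using \<theta>(3) that by (auto simp: bad_def W_def)
    define i i' where "i = first_hit \<tau> g m \<theta>" and "i' = first_hit \<tau>' g' m' \<theta>"
    from True obtain k where k: "k \<le> K + n" "hits \<tau> g m \<theta> k \<or> hits \<tau>' g' m' \<theta> k" by blast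
    then have *: "hits \<tau> g m \<theta> X \<and> hits \<tau>' g' m' \<theta> X \<and> g i = g' i'"
    proof (elim conjE disjE)
      assume h: "hits \<tau> g m \<theta> k"
      then have "hits \<tau> g m \<theta> X" using k(1) by (auto simp: hits_def X_def)
      moreover have "hits \<tau>' g' m' \<theta> X \<and> g' i' = g i \<and> i' \<le> i + D" unfolding i_def i'_def
        by (rule same[OF h k(1) \<theta>(1) off]) (use g1 ord lev in blast)+
      ultimately show ?thesis by simp
    next
      assume h: "hits \<tau>' g' m' \<theta> k"
      then have "hits \<tau>' g' m' \<theta> X" using k(1) by (auto simp: hits_def X_def)
      moreover have "hits \<tau> g m \<theta> X \<and> g i = g' i' \<and> i \<le> i' + D" unfolding i_def i'_def
      proof (rule same[OF h k(1) \<theta>(1) off(2,1)])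
        show "i \<le> j \<longleftrightarrow> i' \<le> j'" if "i \<le> m'" "i' \<le> m" "j \<le> m'" "j' \<le> m" "g' i = g i'" "g' j = g j'" for i i' j j'
          using ord[of i' i j' j] that by simp
        show "i' \<le> i + D" if "i \<le> m'" "i' \<le> m" "g' i = g i'" for i i'
          using lev[of i' i] that by simp
      qed (use g1 in blast)+
      ultimately show ?thesis by simp
    qed
    then have ii: "hits \<tau> g m \<theta> l \<longleftrightarrow> i \<le> l" "hits \<tau>' g' m' \<theta> l \<longleftrightarrow> i' \<le> l" for l
      using hits_iff_first_hit unfolding i_def i'_def by blast+
    have D: "i \<le> i' + D \<and> i' \<le> i + D"
      using lev[of i i'] first_hit(1)[of \<tau> g m \<theta> X] first_hit(1)[of \<tau>' g' m' \<theta> X] * unfolding i_def i'_def by blast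
    have "kbad \<theta> \<subseteq> {min i i'..<max i i'}" by (auto simp: kbad_def ii)
    then have "card (kbad \<theta>) \<le> card {min i i'..<max i i'}" by (intro card_mono) auto
    also have "\<dots> \<le> D" using D by auto
    finally have 1: "card (kbad \<theta>) \<le> D" .
    have "l1_le (\<lambda>v. stopped \<tau> g m \<eta> \<theta> k v - stopped \<tau>' g' m' \<eta>' \<theta> k v) e" if k: "k \<in> {K<..K + n} - kbad \<theta>" for k
    proof (cases "hits \<tau> g m \<theta> k")
      case True
      then have "hits \<tau>' g' m' \<theta> k" using k by (auto simp: kbad_def)
      then have "stopped \<tau> g m \<eta> \<theta> k v - stopped \<tau>' g' m' \<eta>' \<theta> k v = 0" for v
        using True * by (simp add: stopped_def i_def i'_def)
      then show ?thesis using e(1) by (simp add: l1_le_0)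
    next
      case False
      then have h': "\<not> hits \<tau>' g' m' \<theta> k" using k by (auto simp: kbad_def)
      then show ?thesis using e(2)[OF \<theta>(1,2) _ _ False h'] False k by (simp add: stopped_def)
    qed
    with 1 show ?thesis by blast
  qed
  define E where "E \<theta> k = e + (if \<theta> \<in> bad then 2 else 0) + (if \<theta> \<notin> bad \<and> k \<in> kbad \<theta> then 2 else 0)" for \<theta> k
  have pair: "l1_le (\<lambda>v. stopped \<tau> g m \<eta> \<theta> k v - stopped \<tau>' g' m' \<eta>' \<theta> k v) (E \<theta> k)"
    if "1 \<le> \<theta>" "\<theta> \<le> L" "k \<in> {K<..K + n}" for \<theta> k
  proof (cases "\<theta> \<in> bad \<or> k \<in> kbad \<theta>")
    case True
    have "l1_le (\<lambda>v. stopped \<tau> g m \<eta> \<theta> k v - stopped \<tau>' g' m' \<eta>' \<theta> k v) (1 + 1)"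
      by (intro l1_le_diff l1_le_stopped \<eta>)
    then show ?thesis by (rule l1_le_mono) (use True e in \<open>auto simp: E_def\<close>)
  next
    case False
    then show ?thesis using good[OF that(1,2)] that(3) by (simp add: E_def)
  qed
  have "l1_le (\<lambda>v. \<Sum>x\<in>{1..L} \<times> {K<..K + n}. stopped \<tau> g m \<eta> (fst x) (snd x) v - stopped \<tau>' g' m' \<eta>' (fst x) (snd x) v)
      (\<Sum>x\<in>{1..L} \<times> {K<..K + n}. E (fst x) (snd x))"
    by (rule l1_le_sum) (use pair in force)
  then have "l1_le (\<lambda>v. (1 / (real L * real n)) * (\<Sum>x\<in>{1..L} \<times> {K<..K + n}. stopped \<tau> g m \<eta> (fst x) (snd x) v - stopped \<tau>' g' m' \<eta>' (fst x) (snd x) v))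
      (\<bar>1 / (real L * real n)\<bar> * (\<Sum>x\<in>{1..L} \<times> {K<..K + n}. E (fst x) (snd x)))"
    by (rule l1_le_cmult)
  then have main: "l1_le (\<lambda>v. stopped_avg L K n \<tau> g m \<eta> v - stopped_avg L K n \<tau>' g' m' \<eta>' v)
      (1 / (real L * real n) * (\<Sum>x\<in>{1..L} \<times> {K<..K + n}. E (fst x) (snd x)))"
    by (simp add: stopped_avg_def case_prod_unfold sum_subtractf diff_divide_distrib)
  have "(\<Sum>x\<in>{1..L} \<times> {K<..K + n}. E (fst x) (snd x)) = (\<Sum>\<theta>=1..L. \<Sum>k\<in>{K<..K + n}. E \<theta> k)"
    by (simp add: sum.cartesian_product case_prod_unfold)
  also have "\<dots> \<le> (\<Sum>\<theta>=1..L. real n * e + (if \<theta> \<in> bad then 2 * real n else 0) + 2 * real D)"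
  proof (rule sum_mono)
    fix \<theta> assume \<theta>: "\<theta> \<in> {1..L}"
    have "(\<Sum>k\<in>{K<..K + n}. E \<theta> k) = real n * e + (if \<theta> \<in> bad then 2 * real n else 0)
        + (\<Sum>k\<in>{K<..K + n}. if \<theta> \<notin> bad \<and> k \<in> kbad \<theta> then 2 else 0)"
      by (simp add: E_def sum.distrib distrib_left)
    also have "(\<Sum>k\<in>{K<..K + n}. if \<theta> \<notin> bad \<and> k \<in> kbad \<theta> then 2 else 0) \<le> 2 * real D"
    proof (cases "\<theta> \<in> bad")
      case False
      have "(\<Sum>k\<in>{K<..K + n}. if \<theta> \<notin> bad \<and> k \<in> kbad \<theta> then 2 else 0) = (\<Sum>k\<in>kbad \<theta>. 2 :: real)"
        using False by (intro sum.mono_neutral_cong_right) (auto simp: kbad_def)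
      also have "\<dots> \<le> 2 * real D" using good[of \<theta>] \<theta> False by simp
      finally show ?thesis .
    qed simp
    finally show "(\<Sum>k\<in>{K<..K + n}. E \<theta> k) \<le> real n * e + (if \<theta> \<in> bad then 2 * real n else 0) + 2 * real D" by simp
  qed
  also have "\<dots> = real L * real n * e + (\<Sum>\<theta>=1..L. if \<theta> \<in> bad then 2 * real n else 0) + 2 * real L * real D"
    by (simp add: sum.distrib algebra_simps)
  also have "(\<Sum>\<theta>=1..L. if \<theta> \<in> bad then 2 * real n else 0) \<le> (\<Sum>\<theta>\<in>bad. 2 * real n)"
    using bad by (subst sum.inter_restrict[symmetric]) (auto intro!: mult_right_mono card_mono)
  also have "\<dots> = 2 * real n * real (card bad)" by simp
  also have "\<dots> \<le> 2 * real n * real (8 * (X + 1))"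
    using bad by (intro mult_left_mono of_nat_mono) auto
  finally have "1 / (real L * real n) * (\<Sum>x\<in>{1..L} \<times> {K<..K + n}. E (fst x) (snd x))
      \<le> 1 / (real L * real n) * (real L * real n * e + 2 * real n * real (8 * (X + 1)) + 2 * real L * real D)"
    using pos by (intro mult_left_mono) auto
  also have "\<dots> = e + 16 * (real X + 1) / real L + 2 * real D / real n"
    using pos by (simp add: field_simps)
  finally show ?thesis using main l1_le_mono by (simp add: X_def)
qed

section \<open>Averages over beams of growing radius\<close>

context fine_hyperbolic
begin

lemma geod_in_beam:
  assumes g: "geod g a y" and "p' \<le> d a y" "i \<in> {p<..p'}" shows "g i \<in> beam a y r p p'"
proof -
  note G = geodD[OF g]
  have "d a (g i) + d (g i) y = d a y" "d a (g i) = i" using assms(2,3) G(7,8)[of i] by auto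
  moreover have "g i \<in> V" using G(3)[of i] assms by auto
  ultimately show ?thesis using G(5,6) d_self assms(3) unfolding beam_def by force
qed

lemma card_beam_ge:
  assumes g: "geod g a y" and "p' \<le> d a y" and "finite (beam a y r p p')"
  shows "p' - p \<le> card (beam a y r p p')"
proof -
  have "inj_on g {p<..p'}"
  proof (rule inj_onI)
    fix i j assume "i \<in> {p<..p'}" "j \<in> {p<..p'}" "g i = g j"
    then show "i = j" using geod_inj[OF g, of i j] assms(2) by simp
  qed
  then have "card (g ` {p<..p'}) = p' - p" by (simp add: card_image)
  then show ?thesis using card_mono[OF assms(3), of "g ` {p<..p'}"] geod_in_beam[OF g assms(2)]
    by (metis image_subsetI)
qed

lemma beam_mono: "r \<le> r' \<Longrightarrow> beam a y r p p' \<subseteq> beam a y r' p p'"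
  unfolding beam_def by (blast intro: order_trans)

text \<open>The radius \<open>r + D\<close> makes up for the moved end points. Vertices are lost
  only because the window is measured from \<open>a'\<close> instead of \<open>a\<close>, and these
  are within \<open>D\<close> of its ends.\<close>

lemma beam_move:
  assumes V: "a \<in> V" "y \<in> V" "a' \<in> V" "y' \<in> V" and D: "d a a' \<le> D" "d y y' \<le> D"
  shows "beam a y r n (2 * n) - beam a' y' (r + D) n (2 * n) \<subseteq>
    beam a y r n (n + D) \<union> beam a y r (2 * n - D) (2 * n)"
proof
  fix v assume v: "v \<in> beam a y r n (2 * n) - beam a' y' (r + D) n (2 * n)"
  then obtain a1 y1 where *: "v \<in> V" "n < d a v" "d a v \<le> 2 * n" "a1 \<in> V" "y1 \<in> V" "d a a1 \<le> r" "d y y1 \<le> r"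
    "d a1 v + d v y1 = d a1 y1" by (auto simp: beam_def)
  have "d a' a1 \<le> d a' a + d a a1" "d y' y1 \<le> d y' y + d y y1" by (intro d_tri V *)+
  then have "d a' a1 \<le> r + D" "d y' y1 \<le> r + D"
    using D * d_sym[OF V(1,3)] d_sym[OF V(2,4)] by simp_all
  then have "\<not> (n < d a' v \<and> d a' v \<le> 2 * n)" using v * by (auto simp: beam_def)
  moreover have "d a' v \<le> d a' a + d a v" "d a v \<le> d a a' + d a' v" by (intro d_tri V *)+
  ultimately have "d a v \<le> n + D \<or> 2 * n - D < d a v" using D d_sym[OF V(1,3)] by linarith
  with * show "v \<in> beam a y r n (n + D) \<union> beam a y r (2 * n - D) (2 * n)"
    unfolding beam_def by blast
qed

definition beam_avg :: "nat \<Rightarrow> nat \<Rightarrow> nat \<Rightarrow> 'v \<Rightarrow> 'v \<Rightarrow> 'v \<Rightarrow> real" where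
  "beam_avg J D n a y v = (\<Sum>j<J. unif (beam a y (j * D) n (2 * n)) v) / real J"

lemma l1_le_beam_avg: "l1_le (beam_avg J D n a y) 1"
proof (cases "J = 0")
  case True
  then have "beam_avg J D n a y = (\<lambda>v. 0)" by (auto simp: beam_avg_def)
  then show ?thesis by (simp add: l1_le_0)
next
  case False
  have "l1_le (\<lambda>v. (1 / real J) * (\<Sum>j<J. unif (beam a y (j * D) n (2 * n)) v)) (\<bar>1 / real J\<bar> * (\<Sum>j<J. 1))"
    by (intro l1_le_cmult l1_le_sum l1_le_unif)
  then show ?thesis using False by (simp add: beam_avg_def[abs_def])
qed

lemma beam_avg_nonneg: "0 \<le> beam_avg J D n a y v"
  unfolding beam_avg_def by (intro divide_nonneg_nonneg sum_nonneg unif_nonneg) simp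

text \<open>Moving the end points by at most \<open>D\<close> moves the beam of radius \<open>j D\<close> into the one of radius
  \<open>(j + 1) D\<close>, up to the two ends of the window. As the beams increase with \<open>j\<close> and their sizes are
  at most \<open>2 c n\<close> for a constant \<open>c\<close> independent of \<open>j\<close>, most of them grow little in one step.\<close>

lemma beam_avg_compare:
  assumes pos: "0 < J" "0 < D"
    and g: "geod g a y" and g': "geod g' a' y'" and D: "d a a' \<le> D" "d y y' \<le> D"
    and n: "2 * ((J + 1) * D) + (4 * \<delta> + 1) + D \<le> n"
    and far: "2 * n + 2 * ((J + 1) * D) + (4 * \<delta> + 1) \<le> d a y" "2 * n + 2 * ((J + 1) * D) + (4 * \<delta> + 1) \<le> d a' y'"
    and c0: "\<And>u v. u \<in> V \<Longrightarrow> v \<in> V \<Longrightarrow> d u v = 1 \<Longrightarrow>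
      card (narrow_reach (u, v)) \<le> c0"
    and c: "c = 1 + 2 * c0 * (12 * \<delta> + 3)"
  shows "l1_le (\<lambda>v. beam_avg J D n a y v - beam_avg J D n a' y' v)
    (8 * (real D + 1) * real c / real n + 8 * real c / real J + 2 / real J)"
proof -
  note G = geodD[OF g] and G' = geodD[OF g']
  have V: "a \<in> V" "y \<in> V" "a' \<in> V" "y' \<in> V" using G G' by auto
  have D': "d a' a \<le> D" "d y' y \<le> D" using D d_sym[OF V(1,3)] d_sym[OF V(2,4)] by auto
  define S where "S j = beam a y (j * D) n (2 * n)" for j
  define S' where "S' j = beam a' y' (j * D) n (2 * n)" for j
  have npos: "0 < n" using n by simp
  \<comment> \<open>Radii up to \<open>(J + 1) * D\<close> occur, since \<open>S (j + 2)\<close> is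
    used for \<open>j < J\<close>.\<close>
  have r: "j * D \<le> (J + 1) * D" if "j \<le> J + 1" for j using that by (intro mult_right_mono) auto
  have cb: "finite (beam a y (j * D) p p') \<and> card (beam a y (j * D) p p') \<le> (p' - p + 1) * c"
    if "j \<le> J + 1" "n \<le> p" "p \<le> p'" "p' \<le> 2 * n" for j p p'
    unfolding c using card_beam_le[OF g _ _ that(3) c0, of "j * D"] r[OF that(1)] that n far by auto
  have cb': "finite (beam a' y' (j * D) p p') \<and> card (beam a' y' (j * D) p p') \<le> (p' - p + 1) * c"
    if "j \<le> J + 1" "n \<le> p" "p \<le> p'" "p' \<le> 2 * n" for j p p'
    unfolding c using card_beam_le[OF g' _ _ that(3) c0, of "j * D"] r[OF that(1)] that n far by auto
  have nD: "D \<le> n" using n by simp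
  have bd: "card (S j - S' (Suc j)) \<le> 2 * ((D + 1) * c)" if j: "j \<le> J" for j
  proof -
    have "S j - S' (Suc j) \<subseteq> beam a y (j * D) n (n + D) \<union> beam a y (j * D) (2 * n - D) (2 * n)"
      using beam_move[OF V D, of "j * D" n] by (simp add: S_def S'_def add.commute)
    then have "card (S j - S' (Suc j)) \<le> card (beam a y (j * D) n (n + D) \<union> beam a y (j * D) (2 * n - D) (2 * n))"
      using cb[of j n "n + D"] cb[of j "2 * n - D" "2 * n"] j nD by (intro card_mono) auto
    also have "\<dots> \<le> card (beam a y (j * D) n (n + D)) + card (beam a y (j * D) (2 * n - D) (2 * n))"
      by (rule card_Un_le)
    also have "\<dots> \<le> (D + 1) * c + (D + 1) * c"
      using cb[of j n "n + D"] cb[of j "2 * n - D" "2 * n"] j nD by (intro add_mono) auto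
    finally show ?thesis by simp
  qed
  have bd': "card (S' j - S (Suc j)) \<le> 2 * ((D + 1) * c)" if j: "j \<le> J" for j
  proof -
    have "S' j - S (Suc j) \<subseteq> beam a' y' (j * D) n (n + D) \<union> beam a' y' (j * D) (2 * n - D) (2 * n)"
      using beam_move[OF V(3,4,1,2) D', of "j * D" n] by (simp add: S_def S'_def add.commute)
    then have "card (S' j - S (Suc j)) \<le> card (beam a' y' (j * D) n (n + D) \<union> beam a' y' (j * D) (2 * n - D) (2 * n))"
      using cb'[of j n "n + D"] cb'[of j "2 * n - D" "2 * n"] j nD by (intro card_mono) auto
    also have "\<dots> \<le> card (beam a' y' (j * D) n (n + D)) + card (beam a' y' (j * D) (2 * n - D) (2 * n))"
      by (rule card_Un_le)
    also have "\<dots> \<le> (D + 1) * c + (D + 1) * c"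
      using cb'[of j n "n + D"] cb'[of j "2 * n - D" "2 * n"] j nD by (intro add_mono) auto
    finally show ?thesis by simp
  qed
  have fin: "finite (S j)" "finite (S' j)" "card (S j) \<le> (n + 1) * c" if "j \<le> J + 1" for j
    using cb[of j n "2 * n"] cb'[of j n "2 * n"] that by (simp_all add: S_def S'_def)
  have low: "n \<le> card (S j)" "n \<le> card (S' j)" if "j \<le> J + 1" for j
    using card_beam_ge[OF g, of "2 * n" "j * D" n] card_beam_ge[OF g', of "2 * n" "j * D" n] fin(1,2)[OF that] far
    by (simp_all add: S_def S'_def)
  have mono: "S j \<subseteq> S (j + 2)" for j unfolding S_def by (intro beam_mono mult_right_mono) auto
  \<comment> \<open>Up to the ends of the window, \<open>S' (Suc j)\<close> lies between
    \<open>S j\<close> and \<open>S (j + 2)\<close>. The growth over two steps thus bounds the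
    difference of \<open>S j\<close> and \<open>S' (Suc j)\<close>.\<close>
  define t where "t j = real (card (S (j + 2))) - real (card (S j))" for j
  have t: "real (card (S (j + 2) - S j)) = t j" if "j < J" for j
  proof -
    have "card (S (j + 2) - S j) = card (S (j + 2)) - card (S j)"
      using fin(1)[of j] that mono[of j] by (intro card_Diff_subset) auto
    moreover have "card (S j) \<le> card (S (j + 2))" using card_mono[OF _ mono, of j] fin(1)[of "j + 2"] that by simp
    ultimately show ?thesis by (simp add: t_def of_nat_diff)
  qed
  have step: "l1_le (\<lambda>v. unif (S j) v - unif (S' (Suc j)) v) (2 * (4 * ((real D + 1) * real c) + t j) / real n)"
    if j: "j < J" for j
  proof -
    have "S' (Suc j) - S j \<subseteq> (S' (Suc j) - S (j + 2)) \<union> (S (j + 2) - S j)" by blast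
    then have "card (S' (Suc j) - S j) \<le> card ((S' (Suc j) - S (j + 2)) \<union> (S (j + 2) - S j))"
      using fin(1)[of "j + 2"] fin(2)[of "Suc j"] j by (intro card_mono) auto
    also have "\<dots> \<le> card (S' (Suc j) - S (j + 2)) + card (S (j + 2) - S j)" by (rule card_Un_le)
    also have "card (S' (Suc j) - S (j + 2)) \<le> 2 * ((D + 1) * c)" using bd'[of "Suc j"] j by simp
    finally have le: "card (S j - S' (Suc j)) + card (S' (Suc j) - S j) \<le> 4 * ((D + 1) * c) + card (S (j + 2) - S j)"
      using bd[of j] j by simp
    have "S' (Suc j) \<noteq> {}" using low(2)[of "Suc j"] npos j by auto
    then have "l1_le (\<lambda>v. unif (S j) v - unif (S' (Suc j)) v)
        (2 * real (4 * ((D + 1) * c) + card (S (j + 2) - S j)) / real n)"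
      using fin[of j] fin[of "Suc j"] low[of j] npos le j by (intro l1_le_unif_diff) auto
    moreover have "real (4 * ((D + 1) * c) + card (S (j + 2) - S j)) = 4 * ((real D + 1) * real c) + t j"
      using t[OF j] by (simp add: algebra_simps)
    ultimately show ?thesis by (simp only:)
  qed
  \<comment> \<open>The sum of the growths collapses to the last two sizes minus the first two,
    which is linear in \<open>n\<close> whatever \<open>J\<close> is.\<close>
  have tele: "(\<Sum>j<J. t j) \<le> 4 * real c * real n"
  proof -
    have "(\<Sum>j<k. t j) = real (card (S (k + 1))) + real (card (S k)) - real (card (S 1)) - real (card (S 0))" for k
      by (induction k) (auto simp: t_def)
    then have "(\<Sum>j<J. t j) \<le> real (card (S (J + 1))) + real (card (S J))" by simp
    also have "\<dots> \<le> real ((n + 1) * c) + real ((n + 1) * c)"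
      by (intro add_mono of_nat_mono fin(3)) auto
    also have "\<dots> \<le> 4 * real c * real n"
    proof -
      have "(n + 1) * c \<le> (n + n) * c" using npos by (intro mult_right_mono) auto
      then have "real ((n + 1) * c) \<le> real ((n + n) * c)" by (simp only: of_nat_le_iff)
      then show ?thesis by (simp add: algebra_simps)
    qed
    finally show ?thesis .
  qed
  \<comment> \<open>Pairing \<open>S j\<close> with \<open>S' (Suc j)\<close> shifts the second
    average by one index. This costs its first and its last term, the source of
    \<open>2 / real J\<close>.\<close>
  have "l1_le (\<lambda>v. (\<Sum>j<J. unif (S j) v - unif (S' (Suc j)) v) + (unif (S' J) v - unif (S' 0) v))
      ((\<Sum>j<J. 2 * (4 * ((real D + 1) * real c) + t j) / real n) + (1 + 1))"
    by (intro l1_le_add l1_le_sum l1_le_diff l1_le_unif step) auto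
  moreover have "(\<Sum>j<J. unif (S j) v - unif (S' (Suc j)) v) + (unif (S' J) v - unif (S' 0) v)
      = (\<Sum>j<J. unif (S j) v) - (\<Sum>j<J. unif (S' j) v)" for v
  proof -
    have "(\<Sum>j<k. unif (S' (Suc j)) v) + unif (S' 0) v = (\<Sum>j<k. unif (S' j) v) + unif (S' k) v" for k
      by (induction k) auto
    from this[of J] show ?thesis by (simp add: sum_subtractf)
  qed
  ultimately have "l1_le (\<lambda>v. (1 / real J) * ((\<Sum>j<J. unif (S j) v) - (\<Sum>j<J. unif (S' j) v)))
      (\<bar>1 / real J\<bar> * ((\<Sum>j<J. 2 * (4 * ((real D + 1) * real c) + t j) / real n) + 2))"
    by (intro l1_le_cmult) simp
  moreover have "\<bar>1 / real J\<bar> * ((\<Sum>j<J. 2 * (4 * ((real D + 1) * real c) + t j) / real n) + 2)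
      \<le> 8 * (real D + 1) * real c / real n + 8 * real c / real J + 2 / real J"
  proof -
    have "(\<Sum>j<J. 2 * (4 * ((real D + 1) * real c) + t j) / real n)
        = (\<Sum>j<J. (2 / real n) * (4 * ((real D + 1) * real c) + t j))"
      by simp
    also have "\<dots> = (2 / real n) * (\<Sum>j<J. 4 * ((real D + 1) * real c) + t j)"
      by (rule sum_distrib_left[symmetric])
    also have "(\<Sum>j<J. 4 * ((real D + 1) * real c) + t j) = real J * (4 * ((real D + 1) * real c)) + (\<Sum>j<J. t j)"
      by (simp add: sum.distrib)
    also have "(2 / real n) * (real J * (4 * ((real D + 1) * real c)) + (\<Sum>j<J. t j))
        \<le> (2 / real n) * (real J * (4 * ((real D + 1) * real c)) + 4 * real c * real n)"
      using tele by (intro mult_left_mono) auto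
    finally have "\<bar>1 / real J\<bar> * ((\<Sum>j<J. 2 * (4 * ((real D + 1) * real c) + t j) / real n) + 2)
        \<le> \<bar>1 / real J\<bar> * ((2 / real n) * (real J * (4 * ((real D + 1) * real c)) + 4 * real c * real n) + 2)"
      by (intro mult_left_mono) auto
    also have "\<dots> = 8 * (real D + 1) * real c / real n + 8 * real c / real J + 2 / real J"
      using pos npos by (simp add: field_simps)
    finally show ?thesis .
  qed
  ultimately have "l1_le (\<lambda>v. (1 / real J) * ((\<Sum>j<J. unif (S j) v) - (\<Sum>j<J. unif (S' j) v)))
      (8 * (real D + 1) * real c / real n + 8 * real c / real J + 2 / real J)" by (rule l1_le_mono)
  then show ?thesis by (simp add: beam_avg_def S_def S'_def diff_divide_distrib)
qed

end

lemma l1_le_reindex: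
  fixes f :: "'x \<Rightarrow> 'y"
  assumes "l1_le h e" "inj_on f A" shows "l1_le (\<lambda>v. if v \<in> A then h (f v) else 0) e"
  unfolding l1_le_def
proof (intro allI impI)
  fix T :: "'x set" assume T: "finite T"
  have "(\<Sum>v\<in>T. \<bar>if v \<in> A then h (f v) else 0\<bar>) = (\<Sum>v\<in>T \<inter> A. \<bar>h (f v)\<bar>)"
    using T by (intro sum.mono_neutral_cong_right) auto
  also have "\<dots> = (\<Sum>w\<in>f ` (T \<inter> A). \<bar>h w\<bar>)"
    using assms(2) by (subst sum.reindex) (auto simp: inj_on_def)
  also have "\<dots> \<le> e" using T assms(1) by (intro l1_leD) auto
  finally show "(\<Sum>v\<in>T. \<bar>if v \<in> A then h (f v) else 0\<bar>) \<le> e" .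
qed

context fine_hyperbolic
begin

text \<open>Exchanging the two paths reverses the connecting geodesic, whose turns still belong to
  the symmetric relation \<open>P\<close>.\<close>

lemma path_turn_compare_both:
  assumes g: "geod g a y" and g': "geod g' a' y" and s: "geod s a a'" and D: "d a a' \<le> D"
    and b: "b \<in> V" "d a b = 1" and b': "b' \<in> V" "d a' b' = 1" and w: "w \<in> V" "d y w = 1"
    and sym: "\<And>v u w. P v u w \<Longrightarrow> P v w u"
    and P: "\<And>v u w. v \<in> V \<Longrightarrow> u \<in> V \<Longrightarrow> w \<in> V \<Longrightarrow> d v u = 1 \<Longrightarrow> d v w = 1 \<Longrightarrow>
      conn v (12 * (D + \<delta> + 1)) u w \<Longrightarrow> P v u w"
    and turns: "\<And>j. j \<le> d a a' \<Longrightarrow> P (s j) (prev_vertex b s j) (next_vertex s (d a a') b' j)"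
  shows "path_turn P L b g (d a y) w v \<le> path_turn P L b' g' (d a' y) w v + 4"
    "path_turn P L b' g' (d a' y) w v \<le> path_turn P L b g (d a y) w v + 4"
proof -
  note S = geodD[OF s]
  have e: "d a' a = d a a'" using d_sym[OF S(5,6)] by simp
  show "path_turn P L b g (d a y) w v \<le> path_turn P L b' g' (d a' y) w v + 4"
    by (rule path_turn_compare[where P = P, OF g g' s D b b' w sym P turns]) assumption+
  show "path_turn P L b' g' (d a' y) w v \<le> path_turn P L b g (d a y) w v + 4"
  proof (rule path_turn_compare[where P = P, OF g' g geod_rev[OF s] _ b' b w sym P])
    show "P (s (d a a' - j)) (prev_vertex b' (\<lambda>i. s (d a a' - i)) j) (next_vertex (\<lambda>i. s (d a a' - i)) (d a' a) b j)"
      if j: "j \<le> d a' a" for j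
    proof -
      have "prev_vertex b' (\<lambda>i. s (d a a' - i)) j = next_vertex s (d a a') b' (d a a' - j)"
        using j e by (auto simp: prev_vertex_def next_vertex_def Suc_diff_le)
      moreover have "next_vertex (\<lambda>i. s (d a a' - i)) (d a' a) b j = prev_vertex b s (d a a' - j)"
        using j e by (auto simp: prev_vertex_def next_vertex_def)
      ultimately show ?thesis using sym[OF turns[of "d a a' - j"]] by simp
    qed
  qed (use D e in auto)
qed

section \<open>Finite supports that do not depend on the far end of the path\<close>

definition wide :: "('v \<Rightarrow> 'v \<Rightarrow> 'v \<Rightarrow> bool) \<Rightarrow> nat \<Rightarrow> 'v \<Rightarrow> 'v \<Rightarrow> 'v \<Rightarrow> bool" where
  "wide P L v u w \<longleftrightarrow> w \<in> V \<and> d v w = 1 \<and> near P v L u w"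

lemma finite_near:
  assumes "\<And>u. finite {w. P v u w}" shows "finite {w. near P v k u w}"
proof (induction k)
  case (Suc k)
  have "{w. near P v (Suc k) u w} = {w. near P v k u w} \<union> (\<Union>x\<in>{x. near P v k u x}. {w. P v x w})" by auto
  then show ?case using Suc assms by simp
qed simp

text \<open>With \<open>P\<close> locally finite, every edge has finitely many wide continuations.
  This is the finite part of the graph in which geodesics with turns below \<open>L\<close>
  begin.\<close>

lemma finite_wide_reach:
  assumes P: "\<And>v u. finite {w. P v u w}" and e: "u \<in> V" "v \<in> V" "d u v = 1"
  shows "finite (turn_reach (wide P L) k (u, v))"
    "e' \<in> turn_reach (wide P L) k (u, v) \<Longrightarrow> fst e' \<in> V \<and> snd e' \<in> V \<and> d (fst e') (snd e') = 1"
proof -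
  have fw: "finite {w. wide P L v u w}" for v u
    using finite_subset[OF _ finite_near[of P v L u, OF P]] by (auto simp: wide_def)
  show "finite (turn_reach (wide P L) k (u, v))"
    by (rule finite_turn_reach[where I = "\<lambda>e. fst e \<in> V \<and> snd e \<in> V \<and> d (fst e) (snd e) = 1"])
      (use e fw in \<open>auto simp: wide_def\<close>)
  show "fst e' \<in> V \<and> snd e' \<in> V \<and> d (fst e') (snd e') = 1" if "e' \<in> turn_reach (wide P L) k (u, v)"
    by (rule turn_reach_inv[where I = "\<lambda>e. fst e \<in> V \<and> snd e \<in> V \<and> d (fst e) (snd e) = 1", OF _ _ that])
      (use e in \<open>auto simp: wide_def\<close>)
qed

text \<open>\<open>N\<close> may exceed the length of the path by one; the edge reached is then the
  prolongation from \<open>y\<close> to \<open>w\<close>. This case shows that short paths with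
  small turns are few.\<close>

lemma path_reach:
  assumes g: "geod g a y" and w: "w \<in> V" "d y w = 1" and N: "N \<le> Suc (d a y)"
    and small: "\<And>k. k < N \<Longrightarrow> path_turn P L b g (d a y) w (g k) < L"
  shows "(prev_vertex b g N, if N \<le> d a y then g N else w) \<in> turn_reach (wide P L) N (b, a)"
proof -
  define m where "m = d a y"
  define f where "f k = (if k = 0 then b else if k \<le> Suc m then g (k - 1) else w)" for k
  have "wide P L (f (Suc k)) (f k) (f (Suc (Suc k)))" if k: "k < N" for k
  proof -
    have km: "k \<le> d a y" using k N by simp
    have e: "f (Suc k) = g k" "f k = prev_vertex b g k" "f (Suc (Suc k)) = next_vertex g m w k"
      using km by (auto simp: f_def m_def prev_vertex_def next_vertex_def)
    have t: "turn_size P L (g k) (prev_vertex b g k) (next_vertex g m w k) < L"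
      using small[OF k] path_turn_geod[OF g km, of P L b w] by (simp add: m_def)
    have "near P (g k) L (prev_vertex b g k) (next_vertex g m w k)"
      by (rule near_mono[OF near_turn_size[OF t]]) (use t in simp)
    then show ?thesis unfolding e wide_def using next_vertex_adj[OF g w km] by (simp add: m_def)
  qed
  then have "(f N, f (Suc N)) \<in> turn_reach (wide P L) N (f 0, f 1)" by (rule turn_reach_chain)
  moreover have "f 0 = b" "f 1 = a" using geodD(1)[OF g] by (simp_all add: f_def)
  moreover have "f N = prev_vertex b g N" "f (Suc N) = (if N \<le> d a y then g N else w)"
    using N by (auto simp: f_def m_def prev_vertex_def)
  ultimately show ?thesis by simp
qed

text \<open>Both orientations of each edge are used, as the chains of \<open>beam_cover\<close> may
  start from an edge of the path in either direction.\<close>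

definition support_set :: "('v \<Rightarrow> 'v \<Rightarrow> 'v \<Rightarrow> bool) \<Rightarrow> nat \<Rightarrow> nat \<Rightarrow> 'v \<Rightarrow> 'v \<Rightarrow> 'v set" where
  "support_set P L k b a = (\<Union>e\<in>turn_reach (wide P L) k (b, a).
     {snd e} \<union> snd ` narrow_reach e \<union>
     snd ` narrow_reach (prod.swap e))"

lemma finite_support_set:
  assumes P: "\<And>v u. finite {w. P v u w}" and e: "b \<in> V" "a \<in> V" "d b a = 1"
  shows "finite (support_set P L k b a)" "support_set P L k b a \<subseteq> V"
proof -
  have *: "finite (turn_reach (narrow l) k' e') \<and> finite (turn_reach (narrow l) k' (prod.swap e'))"
    if "e' \<in> turn_reach (wide P L) k (b, a)" for e' l k'
    using finite_wide_reach(2)[where P = P, OF P e that] finite_narrow_reach d_sym by (cases e') auto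
  then show "finite (support_set P L k b a)"
    unfolding support_set_def
    by (intro finite_UN_I finite_wide_reach(1)[where P = P, OF P e])
      (use * in \<open>simp del: turn_reach.simps\<close>)
  have V: "x \<in> turn_reach (narrow l) k' e' \<Longrightarrow> snd x \<in> V" if "snd e' \<in> V" for x l k' e'
    by (rule turn_reach_inv[where I = "\<lambda>e. snd e \<in> V"]) (use that in \<open>auto simp: narrow_def\<close>)
  show "support_set P L k b a \<subseteq> V"
  proof
    fix v assume "v \<in> support_set P L k b a"
    then obtain e' where e': "e' \<in> turn_reach (wide P L) k (b, a)"
      "v \<in> {snd e'} \<union> snd ` narrow_reach e' \<union>
       snd ` narrow_reach (prod.swap e')"
      unfolding support_set_def by blast
    have "snd e' \<in> V" "snd (prod.swap e') \<in> V" using finite_wide_reach(2)[where P = P, OF P e e'(1)] by auto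
    then show "v \<in> V" using e'(2) V by blast
  qed
qed

text \<open>Before a first hit all turns are below \<open>\<theta> \<le> L\<close>, so the vertex
  hit is within reach. Without a hit this holds for all turns up to position \<open>K\<close>, which
  is beyond \<open>2 * n + 6 * \<delta> + 1\<close>, the last position from which beam vertices are
  reached, and beyond its successor.\<close>

lemma sum_stopped:
  assumes P: "\<And>v u. finite {w. P v u w}" and b: "b \<in> V" "d a b = 1" and w: "w \<in> V" "d y w = 1"
    and g: "geod g a y" and pos: "0 < J" "0 < n" and \<theta>: "\<theta> \<le> L" and k: "K < k" "k \<le> K + n"
    and n: "2 * (J * D) + (4 * \<delta> + 1) \<le> n"
    and K: "2 * n + 2 * (J * D) + 6 * \<delta> + 2 \<le> K"
    and far: "\<not> hits (path_turn P L b g (d a y) w) g (d a y) \<theta> k \<Longrightarrow> K \<le> d a y"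
  defines "B \<equiv> support_set P L (K + n) b a"
  shows "(\<Sum>v\<in>B. stopped (path_turn P L b g (d a y) w) g (d a y) (beam_avg J D n a y) \<theta> k v) = 1"
    "v \<notin> B \<Longrightarrow> stopped (path_turn P L b g (d a y) w) g (d a y) (beam_avg J D n a y) \<theta> k v = 0"
proof -
  note G = geodD[OF g]
  define \<tau> where "\<tau> = path_turn P L b g (d a y) w"
  define TR where "TR = turn_reach (wide P L) (K + n) (b, a)"
  have ba: "d b a = 1" using d_sym[OF b(1) G(5)] b(2) by simp
  have finB: "finite B" unfolding B_def by (rule finite_support_set(1)[where P = P, OF P b(1) G(5) ba])
  have BI: "snd e \<in> B" "snd ` narrow_reach e \<subseteq> B"
      "snd ` narrow_reach (prod.swap e) \<subseteq> B" if "e \<in> TR" for e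
    using that unfolding B_def support_set_def TR_def by blast+
  have reach: "(prev_vertex b g i, g i) \<in> TR"
    if "i \<le> d a y" "i \<le> K + n" "\<And>j. j < i \<Longrightarrow> \<tau> (g j) < L" for i
    using path_reach[OF g w, of i P L b] that turn_reach_mono[of i "K + n" "wide P L" "(b, a)"]
    unfolding TR_def \<tau>_def by auto
  have both: "(\<Sum>v\<in>B. stopped \<tau> g (d a y) (beam_avg J D n a y) \<theta> k v) = 1 \<and>
    (\<forall>v. v \<notin> B \<longrightarrow> stopped \<tau> g (d a y) (beam_avg J D n a y) \<theta> k v = 0)"
  proof (cases "hits \<tau> g (d a y) \<theta> k")
    case True
    define i where "i = first_hit \<tau> g (d a y) \<theta>"
    note i = first_hit[OF True, folded i_def]
    have "(prev_vertex b g i, g i) \<in> TR"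
      by (rule reach) (use i(1,2,4) k \<theta> in \<open>auto intro: less_le_trans\<close>)
    from BI(1)[OF this] have "g i \<in> B" by simp
    then show ?thesis using finB True by (auto simp: stopped_def i_def)
  next
    case False
    then have Kd: "K \<le> d a y" using far by (simp add: \<tau>_def)
    have small: "\<tau> (g j) < L" if "j \<le> K" for j
    proof -
      have "j \<le> k" "j \<le> d a y" using that Kd k by linarith+
      then have "\<not> \<theta> \<le> \<tau> (g j)" using False by (auto simp: hits_def)
      then show ?thesis using \<theta> by linarith
    qed
    have sub: "beam a y (j * D) n (2 * n) \<subseteq> B" if j: "j < J" for j
    proof
      fix v assume v: "v \<in> beam a y (j * D) n (2 * n)"
      have jD: "j * D \<le> J * D" using j by simp
      have r: "(prev_vertex b g i, g i) \<in> TR" if "i \<le> K" for i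
        by (rule reach) (use that small Kd in auto)
      have "2 * (j * D) + (4 * \<delta> + 1) \<le> n" "2 * n + 2 * (j * D) + (4 * \<delta> + 1) \<le> d a y"
        using jD n K Kd by linarith+
      from beam_cover[OF g this v]
      show "v \<in> B"
      proof (elim disjE exE conjE)
        assume "v \<in> g ` {n<..2 * n}"
        then obtain i where "i \<le> 2 * n" "v = g i" by auto
        then show ?thesis using BI(1)[OF r[of i]] K by simp
      next
        fix i i' assume i: "i \<le> 2 * n + (6 * \<delta> + 1)" "i' = Suc i"
          and vi: "v \<in> snd ` narrow_reach (g i', g i)"
        have "(g i, g i') \<in> TR" using r[of i'] i K by (simp add: prev_vertex_def)
        from BI(3)[OF this] vi show ?thesis by (simp add: subset_iff)
      next
        fix i i' assume i: "i \<le> 2 * n + (6 * \<delta> + 1)" "i = Suc i'"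
          and vi: "v \<in> snd ` narrow_reach (g i', g i)"
        have "(g i', g i) \<in> TR" using r[of i] i K by (simp add: prev_vertex_def)
        from BI(2)[OF this] vi show ?thesis by (simp add: subset_iff)
      qed
    qed
    have ne: "beam a y (j * D) n (2 * n) \<noteq> {}" for j
      using geod_in_beam[OF g, of "2 * n" "2 * n" n] Kd K pos by auto
    have "(\<Sum>v\<in>B. beam_avg J D n a y v) = (\<Sum>j<J. \<Sum>v\<in>B. unif (beam a y (j * D) n (2 * n)) v) / real J"
      unfolding beam_avg_def by (simp flip: sum_divide_distrib) (rule disjI2, rule sum.swap)
    also have "(\<Sum>j<J. \<Sum>v\<in>B. unif (beam a y (j * D) n (2 * n)) v) = (\<Sum>j<J. 1)"
      using sub ne finB by (intro sum.cong sum_unif) auto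
    finally have "(\<Sum>v\<in>B. beam_avg J D n a y v) = 1" using pos by simp
    moreover have "beam_avg J D n a y v = 0" if "v \<notin> B" for v
    proof -
      have "unif (beam a y (j * D) n (2 * n)) v = 0" if "j < J" for j
        using sub[OF that] \<open>v \<notin> B\<close> by (auto simp: unif_def)
      then show ?thesis by (simp add: beam_avg_def)
    qed
    ultimately show ?thesis using False by (simp add: stopped_def)
  qed
  then show "(\<Sum>v\<in>B. stopped (path_turn P L b g (d a y) w) g (d a y) (beam_avg J D n a y) \<theta> k v) = 1"
    "v \<notin> B \<Longrightarrow> stopped (path_turn P L b g (d a y) w) g (d a y) (beam_avg J D n a y) \<theta> k v = 0"
    unfolding \<tau>_def by blast+
qed

end

section \<open>Group actions on fine hyperbolic graphs\<close>

lemma ex_large_nat: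
  fixes C \<epsilon> :: real
  assumes "0 < \<epsilon>" "0 \<le> C" shows "\<exists>n\<ge>N. 0 < n \<and> C / real n \<le> \<epsilon>"
proof -
  obtain k :: nat where k: "C / \<epsilon> < real k" using reals_Archimedean2 by blast
  define n where "n = max (Suc k) N"
  have "C / \<epsilon> \<le> real n" using k by (simp add: n_def)
  then have "C \<le> real n * \<epsilon>" using assms by (simp add: field_simps)
  then have "C / real n \<le> \<epsilon>" by (simp add: n_def field_simps)
  moreover have "N \<le> n" "0 < n" by (simp_all add: n_def)
  ultimately show ?thesis by blast
qed

text \<open>Edges are ordered pairs here, so that a translate of an edge fixes the images of both
  ends and leaves finitely many group elements.\<close>

locale edge_cofinite_action = fine_hyperbolic V d \<delta> + group G
  for V :: "'v set" and d \<delta> and G :: "('a, 'b) monoid_scheme" (structure) +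
  fixes act :: "'a \<Rightarrow> 'v \<Rightarrow> 'v"
  assumes act_closed: "g \<in> carrier G \<Longrightarrow> v \<in> V \<Longrightarrow> act g v \<in> V"
    and act_one: "v \<in> V \<Longrightarrow> act \<one> v = v"
    and act_mult: "g \<in> carrier G \<Longrightarrow> h \<in> carrier G \<Longrightarrow> v \<in> V \<Longrightarrow> act (g \<otimes> h) v = act g (act h v)"
    and d_act: "g \<in> carrier G \<Longrightarrow> u \<in> V \<Longrightarrow> v \<in> V \<Longrightarrow> d (act g u) (act g v) = d u v"
    and edge_orbits: "\<exists>R. finite R \<and> (\<forall>(u, v)\<in>R. u \<in> V \<and> v \<in> V \<and> d u v = 1) \<and>
      (\<forall>u\<in>V. \<forall>v\<in>V. d u v = 1 \<longrightarrow> (\<exists>(u0, v0)\<in>R. \<exists>g\<in>carrier G. act g u0 = u \<and> act g v0 = v))"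
    and edge_stabilizer: "u \<in> V \<Longrightarrow> v \<in> V \<Longrightarrow> d u v = 1 \<Longrightarrow>
      finite {g \<in> carrier G. act g u = u \<and> act g v = v}"
begin

lemma act_inv: "g \<in> carrier G \<Longrightarrow> v \<in> V \<Longrightarrow> act (inv g) (act g v) = v"
  using act_mult[of "inv g" g v] act_one[of v] by simp

lemma act_inv': "g \<in> carrier G \<Longrightarrow> v \<in> V \<Longrightarrow> act g (act (inv g) v) = v"
  using act_mult[of g "inv g" v] act_one[of v] by simp

lemma act_inj: "g \<in> carrier G \<Longrightarrow> u \<in> V \<Longrightarrow> v \<in> V \<Longrightarrow> act g u = act g v \<longleftrightarrow> u = v"
  using act_inv by metis

text \<open>If not empty, this is a coset of the stabilizer of the pair.\<close>

lemma finite_transporter: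
  assumes e: "u \<in> V" "v \<in> V" "d u v = 1"
  shows "finite {g \<in> carrier G. act g u = u' \<and> act g v = v'}"
proof (cases "{g \<in> carrier G. act g u = u' \<and> act g v = v'} = {}")
  case False
  then obtain h where h: "h \<in> carrier G" "act h u = u'" "act h v = v'" by blast
  have "{g \<in> carrier G. act g u = u' \<and> act g v = v'} \<subseteq>
      (\<lambda>g. h \<otimes> g) ` {g \<in> carrier G. act g u = u \<and> act g v = v}"
  proof
    fix g assume g: "g \<in> {g \<in> carrier G. act g u = u' \<and> act g v = v'}"
    then have "act (inv h \<otimes> g) u = u" "act (inv h \<otimes> g) v = v"
      using h e act_inv[of h] act_mult[of "inv h" g] by auto
    moreover have "g = h \<otimes> (inv h \<otimes> g)" using g h by (simp add: m_assoc[symmetric])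
    ultimately show "g \<in> (\<lambda>g. h \<otimes> g) ` {g \<in> carrier G. act g u = u \<and> act g v = v}" using g h by auto
  qed
  then show ?thesis using edge_stabilizer[OF e] finite_surj by blast
qed (metis finite.emptyI)

lemma geod_act:
  assumes g: "geod g x y" and h: "h \<in> carrier G" shows "geod (\<lambda>i. act h (g i)) (act h x) (act h y)"
  using geodD(1-4)[OF g] d_act[OF h geodD(5,6)[OF g]] act_closed[OF h] d_act[OF h] unfolding geod_def by simp

lemma conn_act: "conn z l x y \<Longrightarrow> g \<in> carrier G \<Longrightarrow> z \<in> V \<Longrightarrow> conn (act g z) l (act g x) (act g y)"
proof (induction l arbitrary: y)
  case 0
  then show ?case using act_closed act_inj by auto
next
  case (Suc l)
  then obtain w where w: "conn z l x w" "d w y \<le> 1" "y \<in> V" "y \<noteq> z" by (auto simp: conn.simps(2))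
  then have "conn (act g z) l (act g x) (act g w)" using Suc by blast
  moreover have "d (act g w) (act g y) \<le> 1" "act g y \<in> V" "act g y \<noteq> act g z"
    using w Suc.prems conn_in[OF w(1)] d_act act_closed act_inj by auto
  ultimately show ?case unfolding conn.simps(2) by blast
qed

lemma narrow_act:
  assumes "narrow l v u w" "v \<in> V" "g \<in> carrier G"
  shows "narrow l (act g v) (act g u) (act g w)"
  using assms conn_act[of v l u w g] act_closed d_act[of g v w] by (simp add: narrow_def)

lemma turn_reach_narrow_act:
  assumes "u \<in> V" "v \<in> V" "g \<in> carrier G"
  shows "e \<in> turn_reach (narrow l) k (u, v) \<Longrightarrow>
    fst e \<in> V \<and> snd e \<in> V \<and> map_prod (act g) (act g) e \<in> turn_reach (narrow l) k (act g u, act g v)"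
proof (induction k arbitrary: e)
  case 0
  then show ?case using assms by simp
next
  case (Suc k)
  from Suc.prems consider "e \<in> turn_reach (narrow l) k (u, v)"
    | p q w where "(p, q) \<in> turn_reach (narrow l) k (u, v)" "narrow l q p w" "e = (q, w)" by auto
  then show ?case
  proof cases
    case 1
    then show ?thesis using Suc.IH by auto
  next
    case 2
    from Suc.IH[OF 2(1)] have *: "q \<in> V" "(act g p, act g q) \<in> turn_reach (narrow l) k (act g u, act g v)" by auto
    have "narrow l (act g q) (act g p) (act g w)" by (rule narrow_act[OF 2(2) *(1) assms(3)])
    moreover have "w \<in> V" using 2(2) by (simp add: narrow_def)
    ultimately show ?thesis using * 2(3) by auto
  qed
qed

text \<open>Narrow turns are invariant, so every such set is a translate of one that belongs to a
  representative, and there are finitely many representatives. The bound is the \<open>c0\<close> of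
  \<open>card_beam_le\<close>.\<close>

lemma uniform_narrow_reach:
  "\<exists>c. \<forall>u\<in>V. \<forall>v\<in>V. d u v = 1 \<longrightarrow> card (turn_reach (narrow l) k (u, v)) \<le> c"
proof -
  obtain R where R: "finite R" "\<forall>(u, v)\<in>R. u \<in> V \<and> v \<in> V \<and> d u v = 1"
    "\<forall>u\<in>V. \<forall>v\<in>V. d u v = 1 \<longrightarrow> (\<exists>(u0, v0)\<in>R. \<exists>g\<in>carrier G. act g u0 = u \<and> act g v0 = v)"
    using edge_orbits by blast
  define c where "c = (\<Sum>e\<in>R. card (turn_reach (narrow l) k e))"
  have "card (turn_reach (narrow l) k (u, v)) \<le> c" if e: "u \<in> V" "v \<in> V" "d u v = 1" for u v
  proof -
    obtain u0 v0 g where *: "(u0, v0) \<in> R" "g \<in> carrier G" "act g u0 = u" "act g v0 = v"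
      using R(3) e by blast
    then have V0: "u0 \<in> V" "v0 \<in> V" "d u0 v0 = 1" using R(2) by auto
    have ig: "inv g \<in> carrier G" "act (inv g) u = u0" "act (inv g) v = v0" using * V0 act_inv by auto
    have "turn_reach (narrow l) k (u, v) \<subseteq> map_prod (act g) (act g) ` turn_reach (narrow l) k (u0, v0)"
    proof
      fix e assume "e \<in> turn_reach (narrow l) k (u, v)"
      from turn_reach_narrow_act[OF \<open>u \<in> V\<close> \<open>v \<in> V\<close> ig(1) this]
      have "map_prod (act (inv g)) (act (inv g)) e \<in> turn_reach (narrow l) k (u0, v0)"
        "e = map_prod (act g) (act g) (map_prod (act (inv g)) (act (inv g)) e)"
        using *(2) act_inv' ig by (auto simp: prod_eq_iff)
      then show "e \<in> map_prod (act g) (act g) ` turn_reach (narrow l) k (u0, v0)" by blast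
    qed
    then have "card (turn_reach (narrow l) k (u, v)) \<le> card (turn_reach (narrow l) k (u0, v0))"
      using finite_narrow_reach[OF V0] surj_card_le by blast
    also have "\<dots> \<le> c" unfolding c_def by (rule member_le_sum) (use * R in auto)
    finally show ?thesis .
  qed
  then show ?thesis by blast
qed

lemma beam_act:
  assumes h: "h \<in> carrier G" and V: "a \<in> V" "y \<in> V" "v \<in> V"
  shows "act h v \<in> beam (act h a) (act h y) r p p' \<longleftrightarrow> v \<in> beam a y r p p'"
proof -
  have *: "act h v \<in> beam (act h a) (act h y) r p p'"
    if "h \<in> carrier G" "a \<in> V" "y \<in> V" and v: "v \<in> beam a y r p p'" for h a y v
  proof -
    obtain a1 y1 where "v \<in> V" "p < d a v" "d a v \<le> p'" "a1 \<in> V" "y1 \<in> V" "d a a1 \<le> r" "d y y1 \<le> r"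
      "d a1 v + d v y1 = d a1 y1" using v by (auto simp: beam_def)
    then show ?thesis using that(1-3) act_closed d_act unfolding beam_def
      by (intro CollectI conjI bexI[of _ "act h a1"] bexI[of _ "act h y1"]) auto
  qed
  show ?thesis
  proof
    assume "act h v \<in> beam (act h a) (act h y) r p p'"
    from *[OF inv_closed[OF h] _ _ this] show "v \<in> beam a y r p p'"
      using act_inv[OF h] act_closed[OF h] V by simp
  qed (use * h V in blast)
qed

lemma beam_avg_act:
  assumes h: "h \<in> carrier G" and V: "a \<in> V" "y \<in> V" "v \<in> V"
  shows "beam_avg J D n (act h a) (act h y) (act h v) = beam_avg J D n a y v"
proof -
  have "beam (act h a) (act h y) r p p' = act h ` beam a y r p p'" for r p p'
  proof (intro equalityI subsetI)
    fix w assume w: "w \<in> beam (act h a) (act h y) r p p'"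
    then have "w \<in> V" by (simp add: beam_def)
    then have "act h (act (inv h) w) = w" "act (inv h) w \<in> V" using act_inv' act_closed h by auto
    then show "w \<in> act h ` beam a y r p p'" using beam_act[OF h V(1,2), of "act (inv h) w"] w by (metis imageI)
  next
    fix w assume "w \<in> act h ` beam a y r p p'"
    then obtain x where x: "x \<in> beam a y r p p'" "w = act h x" by blast
    then have "x \<in> V" by (simp add: beam_def)
    then show "w \<in> beam (act h a) (act h y) r p p'" using beam_act[OF h V(1,2)] x by blast
  qed
  moreover have "inj_on (act h) (beam a y r p p')" for r p p'
    using act_inj[OF h] by (auto simp: inj_on_def beam_def)
  ultimately have "card (beam (act h a) (act h y) r p p') = card (beam a y r p p')" for r p p'
    by (simp add: card_image)
  then have "unif (beam (act h a) (act h y) r p p') (act h v) = unif (beam a y r p p') v" for r p p'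
    using beam_act[OF h V] by (simp add: unif_def)
  then show ?thesis by (simp add: beam_avg_def)
qed

text \<open>Symmetric and invariant by construction. The finite set \<open>T\<close> is for turns
  that short walks need not bypass, such as those of a geodesic through a vertex of infinite
  valence.\<close>

definition turn_rel :: "nat \<Rightarrow> ('v \<times> 'v \<times> 'v) set \<Rightarrow> 'v \<Rightarrow> 'v \<Rightarrow> 'v \<Rightarrow> bool" where
  "turn_rel l T v u w \<longleftrightarrow> v \<in> V \<and> u \<in> V \<and> w \<in> V \<and> d v u = 1 \<and> d v w = 1 \<and>
     (conn v l u w \<or> (\<exists>g\<in>carrier G. \<exists>(v0, u0, w0)\<in>T. v = act g v0 \<and>
        (u = act g u0 \<and> w = act g w0 \<or> u = act g w0 \<and> w = act g u0)))"

lemma turn_rel_sym: "turn_rel l T v u w \<Longrightarrow> turn_rel l T v w u"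
  unfolding turn_rel_def using conn_sym by blast

lemma turn_rel_act:
  assumes "turn_rel l T v u w" "T \<subseteq> V \<times> V \<times> V" and h: "h \<in> carrier G"
  shows "turn_rel l T (act h v) (act h u) (act h w)"
proof -
  have V: "v \<in> V" "u \<in> V" "w \<in> V" "d v u = 1" "d v w = 1" using assms(1) by (auto simp: turn_rel_def)
  have "conn (act h v) l (act h u) (act h w) \<or> (\<exists>g\<in>carrier G. \<exists>(v0, u0, w0)\<in>T. act h v = act g v0 \<and>
        (act h u = act g u0 \<and> act h w = act g w0 \<or> act h u = act g w0 \<and> act h w = act g u0))"
  proof (cases "conn v l u w")
    case True
    then show ?thesis using conn_act h V by blast
  next
    case False
    then obtain g v0 u0 w0 where *: "g \<in> carrier G" "(v0, u0, w0) \<in> T" "v = act g v0"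
      "u = act g u0 \<and> w = act g w0 \<or> u = act g w0 \<and> w = act g u0"
      using assms(1) unfolding turn_rel_def by blast
    then have "v0 \<in> V" "u0 \<in> V" "w0 \<in> V" using assms(2) by auto
    then have "act h v = act (h \<otimes> g) v0"
      "act h u = act (h \<otimes> g) u0 \<and> act h w = act (h \<otimes> g) w0 \<or> act h u = act (h \<otimes> g) w0 \<and> act h w = act (h \<otimes> g) u0"
      using * h act_mult by auto
    then show ?thesis using *(1,2) h by blast
  qed
  then show ?thesis using V h act_closed d_act unfolding turn_rel_def by auto
qed

text \<open>Fineness bounds the directions joined to \<open>u\<close> by walks. For translates of
  turns in \<open>T\<close>, the images of one edge are prescribed, and this leaves finitely many
  translating elements.\<close>

lemma finite_turn_rel:
  assumes T: "finite T" and TV: "\<And>v u w. (v, u, w) \<in> T \<Longrightarrow> v \<in> V \<and> u \<in> V \<and> w \<in> V \<and> d v u = 1 \<and> d v w = 1"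
  shows "finite {w. turn_rel l T v u w}"
proof -
  define A where "A = (\<lambda>(v0, u0, w0). (\<lambda>g. act g w0) ` {g \<in> carrier G. act g v0 = v \<and> act g u0 = u} \<union>
      (\<lambda>g. act g u0) ` {g \<in> carrier G. act g v0 = v \<and> act g w0 = u})"
  have "{w. turn_rel l T v u w} \<subseteq> {w \<in> V. d v w = 1 \<and> conn v l u w} \<union> (\<Union>t\<in>T. A t)"
    unfolding turn_rel_def A_def by fastforce
  moreover have "finite (A t)" if "t \<in> T" for t
    using TV that finite_transporter by (cases t) (auto simp: A_def)
  ultimately show ?thesis
  proof (cases "u \<in> V \<and> v \<in> V \<and> d v u = 1")
    case True
    then show ?thesis using fine T \<open>\<And>t. t \<in> T \<Longrightarrow> finite (A t)\<close>
        finite_subset[OF \<open>{w. turn_rel l T v u w} \<subseteq> _\<close>] by blast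
  next
    case False
    then have "{w. turn_rel l T v u w} = {}" by (auto simp: turn_rel_def)
    then show ?thesis by (metis finite.emptyI)
  qed
qed

lemma near_act:
  assumes P: "\<And>v u w. P v u w \<Longrightarrow> P (act h v) (act h u) (act h w)"
  shows "near P v k u w \<Longrightarrow> near P (act h v) k (act h u) (act h w)"
proof (induction k arbitrary: w)
  case (Suc k)
  from Suc.prems consider "near P v k u w" | x where "near P v k u x" "P v x w" by auto
  then show ?case
  proof cases
    case 1
    then show ?thesis using Suc.IH by simp
  next
    case 2
    then have "near P (act h v) k (act h u) (act h x)" "P (act h v) (act h x) (act h w)"
      using Suc.IH P by simp_all
    then show ?thesis by auto
  qed
qed simp

lemma turn_size_act:
  assumes P: "\<And>h v u w. h \<in> carrier G \<Longrightarrow> P v u w \<Longrightarrow> P (act h v) (act h u) (act h w)"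
    and h: "h \<in> carrier G" and V: "v \<in> V" "u \<in> V" "w \<in> V"
  shows "turn_size P L (act h v) (act h u) (act h w) = turn_size P L v u w"
proof -
  have "near P (act h v) k (act h u) (act h w) \<longleftrightarrow> near P v k u w" for k
    using near_act[of P h v k u w, OF P[OF h]]
      near_act[of P "inv h" "act h v" k "act h u" "act h w", OF P[OF inv_closed[OF h]]] act_inv[OF h] V by auto
  then show ?thesis by (simp add: turn_size_def)
qed

lemma path_turn_act:
  assumes P: "\<And>h v u w. h \<in> carrier G \<Longrightarrow> P v u w \<Longrightarrow> P (act h v) (act h u) (act h w)"
    and h: "h \<in> carrier G" and g: "geod g a y" and b: "b \<in> V" "d a b = 1" and w: "w \<in> V" "d y w = 1"
    and i: "i \<le> d a y"
  shows "path_turn P L (act h b) (\<lambda>i. act h (g i)) (d a y) (act h w) (act h (g i)) =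
    path_turn P L b g (d a y) w (g i)"
proof -
  note G = geodD[OF g]
  have e: "d (act h a) (act h y) = d a y" using d_act h G by simp
  have V: "g i \<in> V" "prev_vertex b g i \<in> V" "next_vertex g (d a y) w i \<in> V"
    using G(3)[OF i] prev_vertex_adj[OF g b i] next_vertex_adj[OF g w i] by auto
  have "prev_vertex (act h b) (\<lambda>i. act h (g i)) i = act h (prev_vertex b g i)"
    "next_vertex (\<lambda>i. act h (g i)) (d a y) (act h w) i = act h (next_vertex g (d a y) w i)"
    by (auto simp: prev_vertex_def next_vertex_def)
  then show ?thesis
    using path_turn_geod[OF geod_act[OF g h], of i P L "act h b" "act h w"] path_turn_geod[OF g i, of P L b w]
      turn_size_act[of P h "g i" "prev_vertex b g i" "next_vertex g (d a y) w i", OF P h V] i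
    unfolding e by simp
qed

end

lemma stopped_equivariant:
  assumes f: "inj_on f U" and g: "\<And>i. i \<le> m \<Longrightarrow> g i \<in> U" and v: "v \<in> U"
    and \<tau>: "\<And>i. i \<le> m \<Longrightarrow> \<tau>' (f (g i)) = \<tau> (g i)" and \<eta>: "\<eta>' (f v) = \<eta> v"
  shows "stopped_avg L K n \<tau>' (\<lambda>i. f (g i)) m \<eta>' (f v) = stopped_avg L K n \<tau> g m \<eta> v"
proof -
  have h: "hits \<tau>' (\<lambda>i. f (g i)) m \<theta> k \<longleftrightarrow> hits \<tau> g m \<theta> k" for \<theta> k using \<tau> by (auto simp: hits_def)
  have "(i \<le> m \<and> \<theta> \<le> \<tau>' (f (g i))) = (i \<le> m \<and> \<theta> \<le> \<tau> (g i))" for i \<theta> using \<tau> by auto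
  then have e: "first_hit \<tau>' (\<lambda>i. f (g i)) m \<theta> = first_hit \<tau> g m \<theta>" for \<theta> by (simp add: first_hit_def)
  have "stopped \<tau>' (\<lambda>i. f (g i)) m \<eta>' \<theta> k (f v) = stopped \<tau> g m \<eta> \<theta> k v" for \<theta> k
    using inj_on_eq_iff[OF f v g] first_hit(1)[of \<tau> g m \<theta> k] by (auto simp: stopped_def h e \<eta>)
  then show ?thesis by (simp add: stopped_avg_def)
qed

lemma stopped_avg_nonneg:
  assumes "\<And>v. 0 \<le> \<eta> v" shows "0 \<le> stopped_avg L K n \<tau> g m \<eta> v"
  unfolding stopped_avg_def using assms
  by (intro divide_nonneg_nonneg sum_nonneg) (auto simp: stopped_def)

context fine_hyperbolic
begin

text \<open>With a common start, a common vertex has the same position on both paths; with a common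
  end, it is equally far from the end, and the lengths differ by at most \<open>D\<close>. Either
  way common vertices keep their order. By \<open>good\<close>, a path without a hit up to a time
  beyond \<open>K\<close> is long, so the beams are compared only where both are defined far
  enough.\<close>

lemma stopped_beam_avg_compare:
  assumes g: "geod g a y" and g': "geod g' a' y'" and D: "d a a' \<le> D" "d y y' \<le> D"
    and common: "a = a' \<or> y = y'"
    and pos: "0 < J" "0 < D" "0 < L" "0 < n"
    and n: "2 * ((J + 1) * D) + (4 * \<delta> + 1) + D \<le> n"
    and K: "2 * n + 2 * ((J + 1) * D) + 6 * \<delta> + 2 \<le> K"
    and c0: "\<And>u v. u \<in> V \<Longrightarrow> v \<in> V \<Longrightarrow> d u v = 1 \<Longrightarrow>
      card (narrow_reach (u, v)) \<le> c0"
    and c: "c = 1 + 2 * c0 * (12 * \<delta> + 3)"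
    and \<tau>: "\<tau> = path_turn P L b g (d a y) w" and \<tau>': "\<tau>' = path_turn P L b' g' (d a' y') w'"
    and near4: "\<And>v. \<tau> v \<le> \<tau>' v + 4" "\<And>v. \<tau>' v \<le> \<tau> v + 4"
    and good: "K \<le> d a y \<or> (\<exists>i\<le>d a y. L \<le> \<tau> (g i))" "K \<le> d a' y' \<or> (\<exists>i\<le>d a' y'. L \<le> \<tau>' (g' i))"
  shows "l1_le (\<lambda>v. stopped_avg L K n \<tau> g (d a y) (beam_avg J D n a y) v -
      stopped_avg L K n \<tau>' g' (d a' y') (beam_avg J D n a' y') v)
    ((8 * (real D + 1) * real c / real n + 8 * real c / real J + 2 / real J)
      + 16 * (real (K + n + D) + 1) / real L + 2 * real D / real n)"
proof (rule stopped_avg_compare[OF pos(3,4) near4])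
  note G = geodD[OF g] and G' = geodD[OF g']
  have D': "d a y \<le> d a' y' + D" "d a' y' \<le> d a y + D"
  proof -
    have "d a y \<le> d a a' + d a' y" "d a' y' \<le> d a' a + d a y'"
      "d a y \<le> d a y' + d y' y" "d a' y' \<le> d a' y + d y y'" by (intro d_tri G G')+
    then show "d a y \<le> d a' y' + D" "d a' y' \<le> d a y + D"
      using common D d_sym[OF G(5) G'(5)] d_sym[OF G(6) G'(6)] by (elim disjE; force)+
  qed
  show "\<tau> v = 0" if "v \<notin> g ` {..d a y}" for v using that by (simp add: \<tau> path_turn_def)
  show "\<tau>' v = 0" if "v \<notin> g' ` {..d a' y'}" for v using that by (simp add: \<tau>' path_turn_def)
  have idx2: "d a y - i = d a' y' - i'" if "i \<le> d a y" "i' \<le> d a' y'" "g i = g' i'" and "y = y'" for i i'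
    using G(8)[of i] G'(8)[of i'] that by simp
  have idx1: "i = i'" if "i \<le> d a y" "i' \<le> d a' y'" "g i = g' i'" and "a = a'" for i i'
    using G(7)[of i] G'(7)[of i'] that by simp
  show "i \<le> j \<longleftrightarrow> i' \<le> j'" if ij: "i \<le> d a y" "i' \<le> d a' y'" "j \<le> d a y" "j' \<le> d a' y'" "g i = g' i'" "g j = g' j'" for i i' j j'
    using common
  proof
    assume "a = a'"
    then show ?thesis using idx1[OF ij(1,2,5)] idx1[OF ij(3,4,6)] by blast
  next
    assume "y = y'"
    then show ?thesis using idx2[OF ij(1,2,5)] idx2[OF ij(3,4,6)] ij by linarith
  qed
  show "i \<le> i' + D \<and> i' \<le> i + D" if ij: "i \<le> d a y" "i' \<le> d a' y'" "g i = g' i'" for i i'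
    using common
  proof
    assume "a = a'"
    then show ?thesis using idx1[OF ij] by simp
  next
    assume "y = y'"
    then show ?thesis using idx2[OF ij] ij D' by linarith
  qed
  show "0 \<le> 8 * (real D + 1) * real c / real n + 8 * real c / real J + 2 / real J"
    by (intro add_nonneg_nonneg divide_nonneg_nonneg mult_nonneg_nonneg) auto
  show "l1_le (\<lambda>v. beam_avg J D n a y v - beam_avg J D n a' y' v)
      (8 * (real D + 1) * real c / real n + 8 * real c / real J + 2 / real J)"
    if \<theta>: "\<theta> \<le> L" "K < k" and nh: "\<not> hits \<tau> g (d a y) \<theta> k" "\<not> hits \<tau>' g' (d a' y') \<theta> k" for \<theta> k
  proof -
    have far: "K \<le> d a y"
    proof (rule ccontr)
      assume lt: "\<not> K \<le> d a y"
      then obtain i where "i \<le> d a y" "L \<le> \<tau> (g i)" using good(1) by blast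
      then have "i \<le> d a y" "i \<le> k" "\<theta> \<le> \<tau> (g i)" using \<theta> lt by linarith+
      then show False using nh(1) unfolding hits_def by blast
    qed
    have far': "K \<le> d a' y'"
    proof (rule ccontr)
      assume lt: "\<not> K \<le> d a' y'"
      then obtain i where "i \<le> d a' y'" "L \<le> \<tau>' (g' i)" using good(2) by blast
      then have "i \<le> d a' y'" "i \<le> k" "\<theta> \<le> \<tau>' (g' i)" using \<theta> lt by linarith+
      then show False using nh(2) unfolding hits_def by blast
    qed
    show ?thesis
      by (rule beam_avg_compare[OF pos(1,2) g g' D n _ _ c0 c]) (use far far' K in linarith)+
  qed
qed (rule l1_le_beam_avg)+

end

context edge_cofinite_action
begin

text \<open>The passage from \<open>x\<close> to \<open>s x t\<close> is split at
  \<open>s x\<close>, so that each half moves only one end of the path. The neighbour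
  \<open>b\<close> of \<open>z\<close> prolongs every path by an edge at both ends; the final edge,
  from \<open>x z\<close> to \<open>x b\<close>, determines \<open>x\<close> up to finitely many
  choices.\<close>

theorem approximately_invariant_vertex_measures:
  assumes z: "z \<in> V" and b: "b \<in> V" "d z b = 1"
    and E1: "finite E1" "E1 \<subseteq> carrier G" and \<epsilon>: "0 < (\<epsilon>::real)"
  shows "\<exists>B F \<zeta>. finite B \<and> B \<subseteq> V \<and> finite F \<and>
    (\<forall>x\<in>carrier G. (\<forall>v. 0 \<le> \<zeta> x v) \<and> (\<forall>v. v \<notin> B \<longrightarrow> \<zeta> x v = 0) \<and> sum (\<zeta> x) B = 1) \<and>
    (\<forall>s\<in>E1. \<forall>t\<in>E1. \<forall>x\<in>carrier G - F.
      l1_le (\<lambda>v. if v \<in> V then \<zeta> x v - \<zeta> (s \<otimes> x \<otimes> t) (act s v) else 0) \<epsilon>)"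
proof -
  \<comment> \<open>The radii of the beams are multiples of \<open>D\<close>; \<open>Suc\<close>
    makes it positive.\<close>
  define D where "D = Suc (\<Sum>s\<in>E1. d z (act s z))"
  have D: "d z (act s z) \<le> D" if "s \<in> E1" for s
    using member_le_sum[of s E1 "\<lambda>s. d z (act s z)"] that E1 by (simp add: D_def)
  have actV: "act x v \<in> V" if "x \<in> carrier G" "v \<in> V" for x v using act_closed that .
  have adj: "d (act x z) (act x b) = 1" if "x \<in> carrier G" for x using d_act[OF that z b(1)] b by simp
  define \<sigma> where "\<sigma> s = (SOME g. geod g z (act s z))" for s
  have \<sigma>: "geod (\<sigma> s) z (act s z)" if "s \<in> carrier G" for s
    unfolding \<sigma>_def by (rule someI_ex[OF geod_ex[OF z actV[OF that z]]])
  define \<alpha> where "\<alpha> x = \<sigma> x" for x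
  have \<alpha>: "geod (\<alpha> x) z (act x z)" if "x \<in> carrier G" for x unfolding \<alpha>_def by (rule \<sigma>[OF that])
  define turn where "turn s j = (\<sigma> s j, prev_vertex b (\<sigma> s) j, next_vertex (\<sigma> s) (d z (act s z)) (act s b) j)" for s j
  \<comment> \<open>The turns that \<open>path_turn_compare\<close> requires of the connecting
    geodesics.\<close>
  define T where "T = (\<lambda>(s, j). turn s j) ` (SIGMA s:E1. {..d z (act s z)})"
  have finT: "finite T" unfolding T_def using E1 by auto
  have TV: "v \<in> V \<and> u \<in> V \<and> w \<in> V \<and> d v u = 1 \<and> d v w = 1" if vuw: "(v, u, w) \<in> T" for v u w
  proof -
    obtain s j where s: "s \<in> E1" "j \<le> d z (act s z)" "(v, u, w) = turn s j" using vuw by (auto simp: T_def)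
    then have sG: "s \<in> carrier G" using E1 by auto
    show ?thesis using s(3) geodD(3)[OF \<sigma>[OF sG] s(2)] prev_vertex_adj[OF \<sigma>[OF sG] b s(2)]
        next_vertex_adj[OF \<sigma>[OF sG] actV[OF sG b(1)] adj[OF sG] s(2)] by (simp add: turn_def)
  qed
  then have TVV: "T \<subseteq> V \<times> V \<times> V" by auto
  define P where "P = turn_rel (12 * (D + \<delta> + 1)) T"
  have Psym: "P v w u" if "P v u w" for v u w using that turn_rel_sym unfolding P_def by blast
  have Pact: "P (act h v) (act h u) (act h w)" if "h \<in> carrier G" "P v u w" for h v u w
    using that turn_rel_act[OF _ TVV] unfolding P_def by blast
  have Pfin: "finite {w. P v u w}" for v u unfolding P_def by (rule finite_turn_rel[OF finT TV])
  have Pconn: "P v u w" if "v \<in> V" "u \<in> V" "w \<in> V" "d v u = 1" "d v w = 1" "conn v (12 * (D + \<delta> + 1)) u w" for v u w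
    using that unfolding P_def turn_rel_def by blast
  have turns: "P (\<sigma> s j) (prev_vertex b (\<sigma> s) j) (next_vertex (\<sigma> s) (d z (act s z)) (act s b) j)"
    if s: "s \<in> E1" "j \<le> d z (act s z)" for s j
  proof -
    have t: "turn s j \<in> T" unfolding T_def using s by (intro image_eqI[of _ _ "(s, j)"]) auto
    from TV[OF t[unfolded turn_def]] show ?thesis
      unfolding P_def turn_rel_def using t[unfolded turn_def]
      by (intro conjI disjI2 bexI[of _ "\<one>"] bexI[of _ "turn s j"]) (auto simp: turn_def act_one)
  qed
  obtain c0 where c0': "\<forall>u\<in>V. \<forall>v\<in>V. d u v = 1 \<longrightarrow> card (narrow_reach (u, v)) \<le> c0"
    using uniform_narrow_reach by blast
  then have c0: "card (narrow_reach (u, v)) \<le> c0"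
    if "u \<in> V" "v \<in> V" "d u v = 1" for u v using that by blast
  define c where "c = 1 + 2 * c0 * (12 * \<delta> + 3)"
  \<comment> \<open>Each constant outweighs those before it: \<open>J\<close> the growth constant
    \<open>c\<close>, then \<open>n\<close> the radii and \<open>D\<close>, and \<open>L\<close> the
    length \<open>K + n + D\<close>. None of \<open>P\<close>, \<open>D\<close> and \<open>c\<close>
    depends on them. The three quotients are at most \<open>\<epsilon> / 8\<close> each, and their
    sum \<open>e1\<close> is spent twice.\<close>
  obtain J :: nat where J: "0 < J" "(8 * real c + 2) / real J \<le> \<epsilon> / 8"
    using ex_large_nat[of "\<epsilon> / 8" "8 * real c + 2" 0] \<epsilon> by auto
  obtain n where n: "2 * ((J + 1) * D) + (4 * \<delta> + 1) + D \<le> n" "0 < n" "(8 * (real D + 1) * real c + 2 * real D) / real n \<le> \<epsilon> / 8"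
    using ex_large_nat[of "\<epsilon> / 8" "8 * (real D + 1) * real c + 2 * real D" "2 * ((J + 1) * D) + (4 * \<delta> + 1) + D"] \<epsilon> by auto
  define K where "K = 2 * n + 2 * ((J + 1) * D) + 6 * \<delta> + 2"
  obtain L :: nat where L: "0 < L" "16 * (real (K + n + D) + 1) / real L \<le> \<epsilon> / 8"
    using ex_large_nat[of "\<epsilon> / 8" "16 * (real (K + n + D) + 1)" 0] \<epsilon> by auto
  define e1 where "e1 = (8 * (real D + 1) * real c / real n + 8 * real c / real J + 2 / real J)
      + 16 * (real (K + n + D) + 1) / real L + 2 * real D / real n"
  have e1: "e1 + e1 \<le> \<epsilon>"
    using J(2) n(3) L(2) \<epsilon> unfolding e1_def add_divide_distrib by linarith
  have D0: "0 < D" by (simp add: D_def)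
  define \<tau> where "\<tau> x = path_turn P L b (\<alpha> x) (d z (act x z)) (act x b)" for x
  define \<xi> where "\<xi> x = stopped_avg L K n (\<tau> x) (\<alpha> x) (d z (act x z)) (beam_avg J D n z (act x z))" for x
  define good where "good x \<longleftrightarrow> K \<le> d z (act x z) \<or> (\<exists>i\<le>d z (act x z). L \<le> \<tau> x (\<alpha> x i))" for x
  \<comment> \<open>On these short paths without a turn of size \<open>L\<close>, the stopped
    measure need not have mass one; \<zeta> is a point mass at \<open>z\<close> instead.\<close>
  define F0 where "F0 = {x \<in> carrier G. \<not> good x}"
  have bz: "d b z = 1" using d_sym[OF b(1) z] b(2) by simp
  have finF0: "finite F0"
  proof -
    define TR where "TR = turn_reach (wide P L) K (b, z)"
    have "F0 \<subseteq> (\<Union>e\<in>TR. {x \<in> carrier G. act x z = fst e \<and> act x b = snd e})"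
    proof
      fix x assume "x \<in> F0"
      then have x: "x \<in> carrier G" and bad: "\<not> good x" by (auto simp: F0_def)
      have xK: "\<not> K \<le> d z (act x z)" using bad unfolding good_def by blast
      have x\<tau>: "\<tau> x (\<alpha> x i) < L" if "i \<le> d z (act x z)" for i
        using bad that unfolding good_def by (meson not_le)
      have sub: "turn_reach (wide P L) (Suc (d z (act x z))) (b, z) \<subseteq> TR"
        unfolding TR_def by (rule turn_reach_mono) (use xK in simp)
      have "(prev_vertex b (\<alpha> x) (Suc (d z (act x z))), if Suc (d z (act x z)) \<le> d z (act x z) then \<alpha> x (Suc (d z (act x z))) else act x b)
          \<in> turn_reach (wide P L) (Suc (d z (act x z))) (b, z)"
        by (rule path_reach[OF \<alpha>[OF x] actV[OF x b(1)] adj[OF x]]) (use x\<tau> in \<open>simp_all add: \<tau>_def\<close>)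
      moreover have "prev_vertex b (\<alpha> x) (Suc (d z (act x z))) = act x z"
        using geodD(2)[OF \<alpha>[OF x]] by (simp add: prev_vertex_def)
      ultimately have "(act x z, act x b) \<in> TR"
        using sub by (simp add: subset_iff del: turn_reach.simps)
      then show "x \<in> (\<Union>e\<in>TR. {x \<in> carrier G. act x z = fst e \<and> act x b = snd e})" using x by force
    qed
    moreover have "finite TR" unfolding TR_def by (rule finite_wide_reach(1)[where P = P, OF Pfin b(1) z bz])
    then have "finite (\<Union>e\<in>TR. {x \<in> carrier G. act x z = fst e \<and> act x b = snd e})"
      by (intro finite_UN_I finite_transporter[OF z b])
    ultimately show ?thesis by (rule finite_subset)
  qed
  define B where "B = support_set P L (K + n) b z"
  have B: "finite B" "B \<subseteq> V" unfolding B_def using finite_support_set[where P = P, OF Pfin b(1) z bz] by blast+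
  have zB: "z \<in> B"
  proof -
    have "(b, z) \<in> turn_reach (wide P L) (K + n) (b, z)"
      using turn_reach_mono[of 0 "K + n" "wide P L" "(b, z)"] by auto
    then show ?thesis unfolding B_def support_set_def by force
  qed
  define \<zeta> where "\<zeta> x = (if x \<in> F0 then (\<lambda>v. if v = z then 1 else 0) else \<xi> x)" for x
  define F where "F = F0 \<union> (\<Union>s\<in>E1. (\<lambda>y. inv s \<otimes> y) ` F0) \<union> (\<Union>s\<in>E1. \<Union>t\<in>E1. (\<lambda>y. inv s \<otimes> y \<otimes> inv t) ` F0)"
  have finF: "finite F" unfolding F_def using finF0 E1 by auto
  have prob: "(\<forall>v. 0 \<le> \<zeta> x v) \<and> (\<forall>v. v \<notin> B \<longrightarrow> \<zeta> x v = 0) \<and> sum (\<zeta> x) B = 1" if x: "x \<in> carrier G" for x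
  proof (cases "x \<in> F0")
    case True
    then show ?thesis using zB B by (auto simp: \<zeta>_def)
  next
    case False
    then have gx: "good x" using x by (simp add: F0_def)
    have st: "(\<Sum>v\<in>B. stopped (\<tau> x) (\<alpha> x) (d z (act x z)) (beam_avg J D n z (act x z)) \<theta> k v) = 1"
      "v \<notin> B \<Longrightarrow> stopped (\<tau> x) (\<alpha> x) (d z (act x z)) (beam_avg J D n z (act x z)) \<theta> k v = 0"
      if "1 \<le> \<theta>" "\<theta> \<le> L" "K < k" "k \<le> K + n" for \<theta> k v
    proof -
      have far: "K \<le> d z (act x z)" if "\<not> hits (\<tau> x) (\<alpha> x) (d z (act x z)) \<theta> k"
      proof (rule ccontr)
        assume lt: "\<not> K \<le> d z (act x z)"
        then obtain i where "i \<le> d z (act x z)" "L \<le> \<tau> x (\<alpha> x i)" using gx by (auto simp: good_def)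
        then have "i \<le> d z (act x z)" "i \<le> k" "\<theta> \<le> \<tau> x (\<alpha> x i)" using \<open>\<theta> \<le> L\<close> \<open>K < k\<close> lt by linarith+
        then show False using that unfolding hits_def by blast
      qed
      have JD: "J * D \<le> (J + 1) * D" by simp
      note S = sum_stopped[where P = P, OF Pfin b actV[OF x b(1)] adj[OF x] \<alpha>[OF x] J(1) n(2) that(2,3,4),
          folded \<tau>_def B_def, OF _ _ far]
      have 1: "2 * (J * D) + (4 * \<delta> + 1) \<le> n" using n(1) JD by linarith
      have 2: "2 * n + 2 * (J * D) + 6 * \<delta> + 2 \<le> K" unfolding K_def using JD by linarith
      show "(\<Sum>v\<in>B. stopped (\<tau> x) (\<alpha> x) (d z (act x z)) (beam_avg J D n z (act x z)) \<theta> k v) = 1"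
        by (rule S(1)[OF 1 2])
      show "stopped (\<tau> x) (\<alpha> x) (d z (act x z)) (beam_avg J D n z (act x z)) \<theta> k v = 0" if "v \<notin> B"
        by (rule S(2)[OF 1 2 _ that])
    qed
    have "sum (\<xi> x) B = 1" unfolding \<xi>_def by (rule sum_stopped_avg[OF L(1) n(2) st(1)])
    moreover have "\<xi> x v = 0" if "v \<notin> B" for v
    proof -
      have "(\<Sum>p\<in>{1..L} \<times> {K<..K + n}.
          stopped (\<tau> x) (\<alpha> x) (d z (act x z)) (beam_avg J D n z (act x z)) (fst p) (snd p) v) = 0"
        by (rule sum.neutral) (use st(2)[OF _ _ _ _ that] in auto)
      then show ?thesis unfolding \<xi>_def stopped_avg_def by (simp add: case_prod_unfold)
    qed
    moreover have "0 \<le> \<xi> x v" for v unfolding \<xi>_def by (intro stopped_avg_nonneg beam_avg_nonneg)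
    ultimately show ?thesis using False by (simp add: \<zeta>_def)
  qed
  have "l1_le (\<lambda>v. if v \<in> V then \<zeta> x v - \<zeta> (s \<otimes> x \<otimes> t) (act s v) else 0) \<epsilon>"
    if s: "s \<in> E1" and t: "t \<in> E1" and x: "x \<in> carrier G - F" for s t x
  proof -
    have G: "s \<in> carrier G" "t \<in> carrier G" "x \<in> carrier G" using s t x E1 by auto
    define h where "h = s \<otimes> x"
    define k where "k = h \<otimes> t"
    have hG: "h \<in> carrier G" and kG: "k \<in> carrier G" using G by (auto simp: h_def k_def)
    have hz: "act h v = act s (act x v)" if "v \<in> V" for v using act_mult G that by (simp add: h_def)
    have kz: "act k v = act h (act t v)" if "v \<in> V" for v using act_mult G hG that by (simp add: k_def)
    have "x \<notin> F0" using x by (auto simp: F_def)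
    moreover have "h \<notin> F0"
    proof
      assume "h \<in> F0"
      moreover have "x = inv s \<otimes> h" using G by (simp add: h_def m_assoc[symmetric])
      ultimately show False using x s by (auto simp: F_def)
    qed
    moreover have "k \<notin> F0"
    proof
      assume "k \<in> F0"
      moreover have "x = inv s \<otimes> k \<otimes> inv t"
      proof -
        have "inv s \<otimes> k \<otimes> inv t = inv s \<otimes> (s \<otimes> (x \<otimes> (t \<otimes> inv t)))" unfolding k_def h_def using G by (simp only: m_assoc m_closed inv_closed)
        then show ?thesis using G by (simp add: m_assoc[symmetric])
      qed
      ultimately have "x \<in> (\<lambda>y. inv s \<otimes> y \<otimes> inv t) ` F0" by blast
      then show False using x s t unfolding F_def by blast
    qed
    ultimately have good: "good x" "good h" "good k" and \<zeta>: "\<zeta> x = \<xi> x" "\<zeta> h = \<xi> h" "\<zeta> k = \<xi> k"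
      using G hG kG by (auto simp: F0_def \<zeta>_def)
    \<comment> \<open>The translate by \<open>s\<close> of the path for \<open>x\<close> ends where the path for \<open>h = s x\<close> ends.\<close>
    define g where "g i = act s (\<alpha> x i)" for i
    have xz: "act x z \<in> V" "act x b \<in> V" "act s z \<in> V" "act s b \<in> V" "act t z \<in> V" "act t b \<in> V"
      using actV G z b by auto
    have g: "geod g (act s z) (act h z)"
      using geod_act[OF \<alpha>[OF G(3)] G(1)] unfolding g_def[abs_def] hz[OF z] .
    have m: "d (act s z) (act h z) = d z (act x z)" unfolding hz[OF z] by (rule d_act[OF G(1) z xz(1)])
    define \<tau>g where "\<tau>g = path_turn P L (act s b) g (d (act s z) (act h z)) (act h b)"
    have \<tau>g: "\<tau>g (act s (\<alpha> x i)) = \<tau> x (\<alpha> x i)" if "i \<le> d z (act x z)" for i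
      using path_turn_act[of P, OF Pact G(1) \<alpha>[OF G(3)] b xz(2) adj[OF G(3)] that, of L]
      unfolding \<tau>g_def \<tau>_def g_def[abs_def] m hz[OF b(1)] .
    define \<xi>g where "\<xi>g = stopped_avg L K n \<tau>g g (d (act s z) (act h z)) (beam_avg J D n (act s z) (act h z))"
    have eq: "\<xi>g (act s v) = \<xi> x v" if v: "v \<in> V" for v
      unfolding \<xi>g_def \<xi>_def m g_def[abs_def]
    proof (rule stopped_equivariant[where U = V])
      show "inj_on (act s) V" using act_inj[OF G(1)] by (simp add: inj_on_def)
      show "\<alpha> x i \<in> V" if "i \<le> d z (act x z)" for i using geodD(3)[OF \<alpha>[OF G(3)] that] .
      show "beam_avg J D n (act s z) (act h z) (act s v) = beam_avg J D n z (act x z) v"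
        unfolding hz[OF z] by (rule beam_avg_act[OF G(1) z xz(1) v])
    qed (use v \<tau>g in auto)
    have left: "\<tau> h v \<le> \<tau>g v + 4" "\<tau>g v \<le> \<tau> h v + 4" for v
      unfolding \<tau>_def \<tau>g_def
      using path_turn_compare_both[where P = P, OF \<alpha>[OF hG] g \<sigma>[OF G(1)] D[OF s] b xz(4) adj[OF G(1)]
        actV[OF hG b(1)] adj[OF hG] Psym Pconn turns[OF s]] by blast+
    have dy: "d (act h z) (act h z) \<le> D" "d z z \<le> D" using d_self z actV[OF hG z] by simp_all
    have "l1_le (\<lambda>v. \<xi> h v - \<xi>g v) e1"
      unfolding \<xi>_def \<xi>g_def e1_def
    proof (rule stopped_beam_avg_compare[OF \<alpha>[OF hG] g D[OF s] dy(1) _ J(1) D0 L(1) n(2,1) _ c0 c_def _ \<tau>g_def left])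
      show "K \<le> d (act s z) (act h z) \<or> (\<exists>i\<le>d (act s z) (act h z). L \<le> \<tau>g (g i))"
        using good(1) \<tau>g unfolding m good_def g_def by auto
      show "K \<le> d z (act h z) \<or> (\<exists>i\<le>d z (act h z). L \<le> \<tau> h (\<alpha> h i))" using good(2) unfolding good_def .
    qed (auto simp: K_def \<tau>_def)
    then have 1: "l1_le (\<lambda>v. \<xi>g v - \<xi> h v) e1" by (rule l1_le_swap)
    \<comment> \<open>The reversed paths for \<open>h\<close> and \<open>k = h t\<close> have a common end.\<close>
    have hs: "geod (\<lambda>i. act h (\<sigma> t i)) (act h z) (act k z)"
      using geod_act[OF \<sigma>[OF G(2)] hG] unfolding kz[OF z] .
    have dhk: "d (act h z) (act k z) = d z (act t z)" unfolding kz[OF z] by (rule d_act[OF hG z xz(5)])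
    \<comment> \<open>The connecting geodesic is the translate by \<open>h\<close> of the fixed one
      from \<open>z\<close> to \<open>t z\<close>, and \<open>P\<close> is invariant.\<close>
    have turns_h: "P (act h (\<sigma> t j)) (prev_vertex (act h b) (\<lambda>i. act h (\<sigma> t i)) j)
        (next_vertex (\<lambda>i. act h (\<sigma> t i)) (d (act h z) (act k z)) (act k b) j)" if j: "j \<le> d (act h z) (act k z)" for j
    proof -
      have "prev_vertex (act h b) (\<lambda>i. act h (\<sigma> t i)) j = act h (prev_vertex b (\<sigma> t) j)"
        "next_vertex (\<lambda>i. act h (\<sigma> t i)) (d (act h z) (act k z)) (act k b) j = act h (next_vertex (\<sigma> t) (d z (act t z)) (act t b) j)"
        unfolding dhk kz[OF b(1)] by (auto simp: prev_vertex_def next_vertex_def)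
      then show ?thesis using Pact[OF hG turns[OF t, of j]] j dhk by simp
    qed
    have right: "\<tau> h v \<le> \<tau> k v + 4" "\<tau> k v \<le> \<tau> h v + 4" for v
      using path_turn_compare_both[where P = P, OF geod_rev[OF \<alpha>[OF hG]] geod_rev[OF \<alpha>[OF kG]] hs _
        actV[OF hG b(1)] adj[OF hG] actV[OF kG b(1)] adj[OF kG] b Psym Pconn turns_h, where L = L and v = v]
        path_turn_rev[where P = P, OF \<alpha>[OF hG] Psym, where L = L and v = v and w = "act h b" and b = b]
        path_turn_rev[where P = P, OF \<alpha>[OF kG] Psym, where L = L and v = v and w = "act k b" and b = b] D[OF t]
      unfolding \<tau>_def dhk by auto
    have "l1_le (\<lambda>v. \<xi> h v - \<xi> k v) e1"
      unfolding \<xi>_def e1_def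
    proof (rule stopped_beam_avg_compare[OF \<alpha>[OF hG] \<alpha>[OF kG] dy(2) _ _ J(1) D0 L(1) n(2,1) _ c0 c_def _ _ right])
      show "d (act h z) (act k z) \<le> D" unfolding dhk by (rule D[OF t])
      show "K \<le> d z (act h z) \<or> (\<exists>i\<le>d z (act h z). L \<le> \<tau> h (\<alpha> h i))" using good(2) unfolding good_def .
      show "K \<le> d z (act k z) \<or> (\<exists>i\<le>d z (act k z). L \<le> \<tau> k (\<alpha> k i))" using good(3) unfolding good_def .
    qed (auto simp: K_def \<tau>_def)
    with 1 have "l1_le (\<lambda>v. \<xi>g v - \<xi> k v) (e1 + e1)" by (rule l1_le_triangle)
    then have "l1_le (\<lambda>v. \<xi>g v - \<xi> k v) \<epsilon>" using e1 by (rule l1_le_mono)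
    \<comment> \<open>Read at \<open>act s v\<close>, the measure of the translated path is the one
      of \<open>x\<close> at \<open>v\<close>.\<close>
    then have "l1_le (\<lambda>v. if v \<in> V then \<xi>g (act s v) - \<xi> k (act s v) else 0) \<epsilon>"
      by (rule l1_le_reindex) (use act_inj[OF G(1)] in \<open>simp add: inj_on_def\<close>)
    moreover have "(\<lambda>v. if v \<in> V then \<xi>g (act s v) - \<xi> k (act s v) else 0) =
        (\<lambda>v. if v \<in> V then \<zeta> x v - \<zeta> (s \<otimes> x \<otimes> t) (act s v) else 0)"
      using eq \<zeta> by (auto simp: k_def h_def fun_eq_iff)
    ultimately show ?thesis by simp
  qed
  then show ?thesis using B finF prob by (intro exI[of _ B] exI[of _ F] exI[of _ \<zeta>]) blast
qed

end

section \<open>From graphs to path metrics\<close>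

locale simple_connected_graph =
  fixes V :: "'v set" and E :: "'v set set"
  assumes graph: "graph V E" and connected: "connected_graph V E"
begin

abbreviation "dist_G \<equiv> graph_dist V E"

text \<open>With functions in place of lists, shifting, reversing and joining paths is arithmetic of
  indices.\<close>

definition walk :: "(nat \<Rightarrow> 'v) \<Rightarrow> nat \<Rightarrow> bool" where
  "walk f n \<longleftrightarrow> (\<forall>i\<le>n. f i \<in> V) \<and> (\<forall>i<n. f i = f (Suc i) \<or> {f i, f (Suc i)} \<in> E)"

lemma graph_path_map: "graph_path V E (map f [0..<Suc n]) \<longleftrightarrow> walk f n"
proof -
  have "set (map f [0..<Suc n]) \<subseteq> V \<longleftrightarrow> (\<forall>i\<le>n. f i \<in> V)" by (auto simp del: upt_Suc simp: less_Suc_eq_le)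
  moreover have "(\<forall>i. Suc i < length (map f [0..<Suc n]) \<longrightarrow> map f [0..<Suc n] ! i = map f [0..<Suc n] ! Suc i \<or>
      {map f [0..<Suc n] ! i, map f [0..<Suc n] ! Suc i} \<in> E) \<longleftrightarrow> (\<forall>i<n. f i = f (Suc i) \<or> {f i, f (Suc i)} \<in> E)"
    by (simp del: upt_Suc)
  ultimately show ?thesis unfolding graph_path_def walk_def by (simp del: upt_Suc)
qed

lemma map_upt_ends: "hd (map f [0..<Suc n]) = f 0" "last (map f [0..<Suc n]) = f n"
    "path_length (map f [0..<Suc n]) = n"
  by (simp_all add: hd_map hd_append last_map path_length_def)

lemma graph_path_walk:
  assumes "graph_path V E p"
  shows "\<exists>f. walk f (path_length p) \<and> f 0 = hd p \<and> f (path_length p) = last p"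
proof -
  have p: "p \<noteq> []" "length p = Suc (path_length p)" using assms by (auto simp: graph_path_def path_length_def)
  have "p = map ((!) p) [0..<Suc (path_length p)]" using map_nth[of p] p by simp
  then have "walk ((!) p) (path_length p)" using assms graph_path_map by metis
  moreover have "p ! 0 = hd p" "p ! path_length p = last p"
    using p by (simp_all add: hd_conv_nth last_conv_nth path_length_def)
  ultimately show ?thesis by blast
qed

lemma path_iff_walk:
  "(\<exists>p. graph_path V E p \<and> hd p = x \<and> last p = y \<and> path_length p = n) \<longleftrightarrow>
   (\<exists>f. walk f n \<and> f 0 = x \<and> f n = y)"
proof
  assume "\<exists>p. graph_path V E p \<and> hd p = x \<and> last p = y \<and> path_length p = n"
  then show "\<exists>f. walk f n \<and> f 0 = x \<and> f n = y" using graph_path_walk by metis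
next
  assume "\<exists>f. walk f n \<and> f 0 = x \<and> f n = y"
  then obtain f where "walk f n" "f 0 = x" "f n = y" by blast
  then show "\<exists>p. graph_path V E p \<and> hd p = x \<and> last p = y \<and> path_length p = n"
    using graph_path_map[of f n] map_upt_ends[of f n] by metis
qed

lemma dist_least: "dist_G x y = (LEAST n. \<exists>f. walk f n \<and> f 0 = x \<and> f n = y)"
  unfolding graph_dist_def path_iff_walk by simp

lemma dist_le: "walk f n \<Longrightarrow> dist_G (f 0) (f n) \<le> n"
  unfolding dist_least by (rule Least_le) blast

lemma dist_attained:
  assumes "x \<in> V" "y \<in> V" shows "\<exists>f. walk f (dist_G x y) \<and> f 0 = x \<and> f (dist_G x y) = y"
proof -
  obtain p where "graph_path V E p" "hd p = x" "last p = y"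
    using connected assms unfolding connected_graph_def by blast
  then have "\<exists>n f. walk f n \<and> f 0 = x \<and> f n = y" using graph_path_walk by metis
  then show ?thesis unfolding dist_least by (rule LeastI_ex)
qed

lemma walk_shift: "walk f n \<Longrightarrow> i \<le> j \<Longrightarrow> j \<le> n \<Longrightarrow> walk (\<lambda>k. f (i + k)) (j - i)"
  by (auto simp: walk_def)

lemma walk_rev:
  assumes "walk f n" shows "walk (\<lambda>i. f (n - i)) n"
  unfolding walk_def
proof (intro conjI allI impI)
  fix i assume "i < n"
  then have "f (n - Suc i) = f (Suc (n - Suc i)) \<or> {f (n - Suc i), f (Suc (n - Suc i))} \<in> E"
    using assms by (auto simp: walk_def)
  then show "f (n - i) = f (n - Suc i) \<or> {f (n - i), f (n - Suc i)} \<in> E"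
    using \<open>i < n\<close> by (auto simp: Suc_diff_Suc insert_commute)
qed (use assms in \<open>simp add: walk_def\<close>)

lemma walk_concat:
  assumes f: "walk f n" and g: "walk g m" and e: "g 0 = f n"
  shows "walk (\<lambda>i. if i \<le> n then f i else g (i - n)) (n + m)"
  unfolding walk_def
proof (intro conjI allI impI)
  fix i assume i: "i < n + m"
  consider "i < n" | "i = n" "0 < m" | "n < i" using i by linarith
  then show "(if i \<le> n then f i else g (i - n)) = (if Suc i \<le> n then f (Suc i) else g (Suc i - n)) \<or>
    {if i \<le> n then f i else g (i - n), if Suc i \<le> n then f (Suc i) else g (Suc i - n)} \<in> E"
  proof cases
    case 1
    then show ?thesis using f by (auto simp: walk_def)
  next
    case 2
    then show ?thesis using g e unfolding walk_def by force
  next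
    case 3
    then have "i - n < m" "Suc i - n = Suc (i - n)" using i by auto
    then have "g (i - n) = g (Suc i - n) \<or> {g (i - n), g (Suc i - n)} \<in> E" using g unfolding walk_def by metis
    then show ?thesis using 3 by simp
  qed
qed (use f g in \<open>auto simp: walk_def\<close>)

sublocale vertex_metric V dist_G
proof
  fix x y assume V: "x \<in> V" "y \<in> V"
  obtain f where f: "walk f (dist_G x y)" "f 0 = x" "f (dist_G x y) = y" using dist_attained V by blast
  show "dist_G x y = 0 \<longleftrightarrow> x = y"
  proof
    assume "x = y"
    then show "dist_G x y = 0" using dist_le[of "\<lambda>_. x" 0] V by (simp add: walk_def)
  qed (use f in auto)
  have le: "dist_G y x \<le> dist_G x y" if "x \<in> V" "y \<in> V" for x y
  proof -
    obtain f where f: "walk f (dist_G x y)" "f 0 = x" "f (dist_G x y) = y"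
      using dist_attained \<open>x \<in> V\<close> \<open>y \<in> V\<close> by blast
    then show ?thesis using dist_le[OF walk_rev[OF f(1)]] by simp
  qed
  show "dist_G x y = dist_G y x" using le V by (simp add: antisym)
  fix z assume z: "z \<in> V"
  obtain g where g: "walk g (dist_G y z)" "g 0 = y" "g (dist_G y z) = z" using dist_attained V z by blast
  have "walk (\<lambda>i. if i \<le> dist_G x y then f i else g (i - dist_G x y)) (dist_G x y + dist_G y z)"
    by (rule walk_concat) (use f g in auto)
  from dist_le[OF this] show "dist_G x z \<le> dist_G x y + dist_G y z"
    using f g by (cases "dist_G y z = 0") auto
qed

lemma dist_eq_1:
  assumes "u \<in> V" "v \<in> V" shows "dist_G u v = 1 \<longleftrightarrow> {u, v} \<in> E"
proof
  assume "dist_G u v = 1"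
  moreover obtain f where "walk f (dist_G u v)" "f 0 = u" "f (dist_G u v) = v" using dist_attained assms by blast
  ultimately have "u = v \<or> {u, v} \<in> E" by (auto simp: walk_def)
  moreover have "u \<noteq> v" using d_eq_0[of u v] assms \<open>dist_G u v = 1\<close> by auto
  ultimately show "{u, v} \<in> E" by blast
next
  assume e: "{u, v} \<in> E"
  then have "card {u, v} = 2" using graph by (auto simp: graph_def)
  then have "u \<noteq> v" by auto
  moreover have "walk (\<lambda>i. if i = 0 then u else v) 1" using e assms by (auto simp: walk_def)
  ultimately show "dist_G u v = 1" using dist_le[of "\<lambda>i. if i = 0 then u else v" 1] d_eq_0[of u v] assms by auto
qed

text \<open>A walk of minimal length is a geodesic, since a shortcut between two of its points would
  shorten it.\<close>

lemma geod_exists: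
  assumes "x \<in> V" "y \<in> V" shows "\<exists>g. geod g x y"
proof -
  define n where "n = dist_G x y"
  obtain f where f: "walk f n" "f 0 = x" "f n = y" using dist_attained assms n_def by blast
  have fV: "f i \<in> V" if "i \<le> n" for i using f(1) that by (simp add: walk_def)
  have le: "dist_G (f i) (f j) \<le> j - i" if "i \<le> j" "j \<le> n" for i j
    using dist_le[OF walk_shift[OF f(1) that]] that by simp
  have "dist_G (f i) (f j) = j - i" if "i \<le> j" "j \<le> n" for i j
    using d_tri[of x "f i" y] d_tri[of "f i" "f j" y] le[of 0 i] le[of j n] le[OF that] fV[of i] fV[of j] that f(2,3) assms
    by (simp add: n_def)
  then have "geod f x y" unfolding geod_def using f fV by (simp flip: n_def)
  then show ?thesis by blast
qed

lemma geodesic_path_map: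
  assumes g: "geod g x y" shows "geodesic_path V E (map g [0..<Suc (dist_G x y)])"
proof -
  note G = geodD[OF g]
  have "walk g (dist_G x y)"
    unfolding walk_def using G(3) G(4) dist_eq_1 by (metis Suc_diff_Suc Suc_leI diff_self_eq_0 le_refl less_imp_le lessI One_nat_def)
  then have "graph_path V E (map g [0..<Suc (dist_G x y)])" by (simp only: graph_path_map)
  moreover have "int (dist_G (g i) (g j)) = \<bar>int i - int j\<bar>" if "i \<le> dist_G x y" "j \<le> dist_G x y" for i j
    using geod_dist[OF g that] by (auto simp: of_nat_diff)
  ultimately show ?thesis unfolding geodesic_path_def by (simp del: upt_Suc add: less_Suc_eq_le)
qed

text \<open>When the walk returns to a vertex of the path built so far, the path is cut back to that
  vertex; so its vertices stay distinct.\<close>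

lemma conn_imp_path:
  assumes "conn v l u w"
  shows "\<exists>p. graph_path V E p \<and> hd p = u \<and> last p = w \<and> distinct p \<and> v \<notin> set p \<and> length p \<le> Suc l"
  using assms
proof (induction l arbitrary: w)
  case 0
  then show ?case by (intro exI[of _ "[u]"]) (auto simp: graph_path_def)
next
  case (Suc l)
  then obtain x where x: "conn v l u x" "dist_G x w \<le> 1" "w \<in> V" "w \<noteq> v" by (auto simp: conn.simps(2))
  obtain p where p: "graph_path V E p" "hd p = u" "last p = x" "distinct p" "v \<notin> set p" "length p \<le> Suc l"
    using Suc.IH[OF x(1)] by blast
  then have ne: "p \<noteq> []" by (simp add: graph_path_def)
  show ?case
  proof (cases "w \<in> set p")
    case True
    then obtain p1 p2 where s: "p = p1 @ w # p2" by (meson split_list)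
    have "graph_path V E (p1 @ [w])" unfolding graph_path_def
    proof (intro conjI allI impI)
      show "set (p1 @ [w]) \<subseteq> V" using p(1) by (simp add: graph_path_def s)
      fix i assume i: "Suc i < length (p1 @ [w])"
      have "p ! i = p ! Suc i \<or> {p ! i, p ! Suc i} \<in> E"
        using p(1) i by (auto simp: graph_path_def s)
      moreover have "p ! i = (p1 @ [w]) ! i" "p ! Suc i = (p1 @ [w]) ! Suc i"
        using i by (auto simp: s nth_append)
      ultimately show "(p1 @ [w]) ! i = (p1 @ [w]) ! Suc i \<or> {(p1 @ [w]) ! i, (p1 @ [w]) ! Suc i} \<in> E" by simp
    qed simp
    then show ?thesis using p by (intro exI[of _ "p1 @ [w]"]) (auto simp: s hd_append)
  next
    case False
    have "x \<noteq> w" using False p(3) ne by auto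
    moreover have xV: "x \<in> V" using conn_in[OF x(1)] by simp
    ultimately have e: "{x, w} \<in> E"
      using dist_eq_1[OF xV x(3)] x(2) d_eq_0[OF xV x(3)] by (metis le_neq_implies_less less_one)
    have "graph_path V E (p @ [w])" unfolding graph_path_def
    proof (intro conjI allI impI)
      show "set (p @ [w]) \<subseteq> V" using p(1) x(3) by (simp add: graph_path_def)
      fix i assume i: "Suc i < length (p @ [w])"
      show "(p @ [w]) ! i = (p @ [w]) ! Suc i \<or> {(p @ [w]) ! i, (p @ [w]) ! Suc i} \<in> E"
      proof (cases "Suc i < length p")
        case True
        then show ?thesis using p(1) by (auto simp: graph_path_def nth_append)
      next
        case False
        then have "i = length p - 1" "Suc i = length p" using i ne by auto
        then show ?thesis using e p(3) ne by (simp add: nth_append last_conv_nth)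
      qed
    qed simp
    then show ?thesis using p False x(4) ne by (intro exI[of _ "p @ [w]"]) auto
  qed
qed

text \<open>A simple path from \<open>u\<close> to \<open>w\<close> that misses \<open>v\<close>,
  closed up through \<open>v\<close>, is a circuit of length at most \<open>l + 2\<close> through
  the edge. As \<open>w\<close> is its last vertex but one, finitely many circuits leave finitely
  many \<open>w\<close>.\<close>

lemma fine_conn:
  assumes fine: "fine_graph V E" and uv: "u \<in> V" "v \<in> V" "dist_G v u = 1"
  shows "finite {w \<in> V. dist_G v w = 1 \<and> conn v l u w}"
proof -
  define C where "C = {c. circuit V E c \<and> path_length c \<le> l + 2 \<and> path_contains_edge c {v, u}}"
  have "{v, u} \<in> E" using dist_eq_1 uv by blast
  then have "finite C" using fine unfolding fine_graph_def C_def by blast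
  moreover have "{w \<in> V. dist_G v w = 1 \<and> conn v l u w} \<subseteq> (\<lambda>c. c ! (length c - 2)) ` C"
  proof
    fix w assume "w \<in> {w \<in> V. dist_G v w = 1 \<and> conn v l u w}"
    then have w: "w \<in> V" "{v, w} \<in> E" "conn v l u w" using dist_eq_1[OF uv(2)] by auto
    obtain p where p: "graph_path V E p" "hd p = u" "last p = w" "distinct p" "v \<notin> set p" "length p \<le> Suc l"
      using conn_imp_path[OF w(3)] by blast
    then have ne: "p \<noteq> []" by (simp add: graph_path_def)
    define c where "c = v # p @ [v]"
    have "graph_path V E c" unfolding graph_path_def
    proof (intro conjI allI impI)
      show "set c \<subseteq> V" using p(1) uv by (simp add: graph_path_def c_def)
      fix i assume i: "Suc i < length c"
      consider "i = 0" | j where "i = Suc j" "Suc j < length p" | "i = length p"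
        using i ne by (cases i) (auto simp: c_def less_Suc_eq)
      then show "c ! i = c ! Suc i \<or> {c ! i, c ! Suc i} \<in> E"
      proof cases
        case 1
        then show ?thesis using \<open>{v, u} \<in> E\<close> p(2) ne by (simp add: c_def nth_append hd_conv_nth)
      next
        case 2
        then show ?thesis using p(1) by (auto simp: c_def nth_append graph_path_def)
      next
        case 3
        then have "c ! i = w" "c ! Suc i = v" using p(3) ne
          by (simp_all add: c_def nth_append last_conv_nth nth_Cons')
        then show ?thesis using w(2) by (simp add: insert_commute)
      qed
    qed (simp add: c_def)
    moreover have "hd c = last c" "distinct (butlast c)" using p by (auto simp: c_def butlast_append)
    moreover have "path_length c \<le> l + 2" using p(6) by (simp add: path_length_def c_def)
    moreover have "path_contains_edge c {v, u}" unfolding path_contains_edge_def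
      using p(2) ne by (intro exI[of _ 0]) (simp add: c_def nth_append hd_conv_nth)
    ultimately have "c \<in> C" by (simp add: C_def circuit_def)
    moreover have "c ! (length c - 2) = w" using p(3) ne
      by (simp add: c_def nth_append last_conv_nth nth_Cons')
    ultimately show "w \<in> (\<lambda>c. c ! (length c - 2)) ` C" by blast
  qed
  ultimately show ?thesis using finite_surj by blast
qed

lemma fine_hyperbolic_exists:
  assumes "fine_graph V E" "hyperbolic_graph V E"
  shows "\<exists>\<delta>. fine_hyperbolic V dist_G \<delta>"
proof -
  obtain \<delta>r :: real where \<delta>r: "\<delta>r > 0"
    "\<And>\<alpha> \<beta> k. geodesic_path V E \<alpha> \<Longrightarrow> geodesic_path V E \<beta> \<Longrightarrow> hd \<alpha> = hd \<beta> \<Longrightarrow>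
       real k \<le> gromov_product V E (last \<alpha>) (last \<beta>) (hd \<alpha>) \<Longrightarrow> real (dist_G (\<alpha> ! k) (\<beta> ! k)) < \<delta>r"
    using assms(2) unfolding hyperbolic_graph_def by metis
  define \<delta> where "\<delta> = nat \<lceil>\<delta>r\<rceil>"
  have "fine_hyperbolic V dist_G \<delta>"
  proof unfold_locales
    fix g h x y z and k :: nat
    assume g: "geod g z x" and h: "geod h z y" and k: "2 * k + dist_G x y \<le> dist_G z x + dist_G z y"
    note G = geodD[OF g] and H = geodD[OF h]
    define p q where "p = map g [0..<Suc (dist_G z x)]" and "q = map h [0..<Suc (dist_G z y)]"
    have t: "dist_G z y \<le> dist_G z x + dist_G x y" "dist_G z x \<le> dist_G z y + dist_G y x" by (intro d_tri G H)+
    have s: "dist_G x z = dist_G z x" "dist_G y z = dist_G z y" "dist_G y x = dist_G x y" by (intro d_sym G H)+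
    have kk: "k \<le> dist_G z x" "k \<le> dist_G z y" using k t s by linarith+
    have "real (dist_G (p ! k) (q ! k)) < \<delta>r"
    proof (rule \<delta>r(2))
      show "geodesic_path V E p" "geodesic_path V E q" unfolding p_def q_def by (intro geodesic_path_map g h)+
      show "hd p = hd q" using map_upt_ends(1)[of g] map_upt_ends(1)[of h] G(1) H(1) by (simp only: p_def q_def)
      have e: "hd p = z" "last p = x" "last q = y"
        using map_upt_ends(1,2)[of g] map_upt_ends(1,2)[of h] G(1,2) H(2) by (simp_all only: p_def q_def)
      show "real k \<le> gromov_product V E (last p) (last q) (hd p)"
        unfolding e gromov_product_def s using k by (simp add: field_simps flip: of_nat_add)
    qed
    moreover have "p ! k = g k" "q ! k = h k" using kk by (simp_all add: p_def q_def del: upt_Suc)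
    ultimately have "real (dist_G (g k) (h k)) < \<delta>r" by simp
    then show "dist_G (g k) (h k) \<le> \<delta>" unfolding \<delta>_def by linarith
  qed (use geod_exists fine_conn[OF assms(1)] in auto)
  then show ?thesis by blast
qed

end

text \<open>The graph action speaks of unordered edges. Each representative edge yields two ordered
  pairs, and fixing both ends is stronger than preserving the edge.\<close>

lemma edge_cofinite_action_of_graph_action:
  fixes G :: "('a, 'b) monoid_scheme" and V :: "'v set"
  assumes "group G" and gr: "graph V E" and co: "connected_graph V E" and "fine_graph V E" "hyperbolic_graph V E"
    and ga: "graph_action G V E \<phi>" and orb: "finite (orbits G E (edge_action \<phi>))"
    and stab: "\<forall>e\<in>E. finite (stabilizer G (edge_action \<phi>) e)"
  shows "\<exists>\<delta>. edge_cofinite_action V (graph_dist V E) \<delta> G \<phi>"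
proof -
  interpret simple_connected_graph V E by unfold_locales (fact gr co)+
  interpret group G by fact
  interpret A: group_action G V \<phi> using ga by (simp add: graph_action_def)
  obtain \<delta> where \<delta>: "fine_hyperbolic V dist_G \<delta>" using fine_hyperbolic_exists assms by blast
  interpret fine_hyperbolic V dist_G \<delta> by fact
  have cl: "\<phi> g v \<in> V" if "g \<in> carrier G" "v \<in> V" for g v using A.element_image that by blast
  have one: "\<phi> \<one>\<^bsub>G\<^esub> v = v" if "v \<in> V" for v using A.id_eq_one that by (metis restrict_apply)
  have mult: "\<phi> (g \<otimes>\<^bsub>G\<^esub> h) v = \<phi> g (\<phi> h v)" if "g \<in> carrier G" "h \<in> carrier G" "v \<in> V" for g h v
    using A.composition_rule that by blast
  have inv: "\<phi> (inv\<^bsub>G\<^esub> g) (\<phi> g v) = v" if "g \<in> carrier G" "v \<in> V" for g v using A.orbit_sym_aux that by blast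
  have edge: "{\<phi> g x, \<phi> g y} \<in> E \<longleftrightarrow> {x, y} \<in> E" if "g \<in> carrier G" "x \<in> V" "y \<in> V" for g x y
    using ga that unfolding graph_action_def by blast
  have dle: "dist_G (\<phi> g x) (\<phi> g y) \<le> dist_G x y" if "g \<in> carrier G" "x \<in> V" "y \<in> V" for g x y
  proof -
    obtain f where f: "walk f (dist_G x y)" "f 0 = x" "f (dist_G x y) = y" using dist_attained \<open>x \<in> V\<close> \<open>y \<in> V\<close> by blast
    then have "walk (\<lambda>i. \<phi> g (f i)) (dist_G x y)"
      using cl edge that(1) unfolding walk_def by (metis Suc_leI less_imp_le)
    from dist_le[OF this] show ?thesis using f by simp
  qed
  have edgeV: "\<exists>u v. e = {u, v} \<and> u \<in> V \<and> v \<in> V" if "e \<in> E" for e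
  proof -
    have "e \<subseteq> V" "card e = 2" using gr that by (auto simp: graph_def)
    then show ?thesis by (metis card_2_iff insert_subset)
  qed
  have "edge_cofinite_action V dist_G \<delta> G \<phi>"
  proof unfold_locales
    show "dist_G (\<phi> g u) (\<phi> g v) = dist_G u v" if "g \<in> carrier G" "u \<in> V" "v \<in> V" for g u v
      using dle[OF that] dle[of "inv\<^bsub>G\<^esub> g" "\<phi> g u" "\<phi> g v"] inv cl that by simp
    show "finite {g \<in> carrier G. \<phi> g u = u \<and> \<phi> g v = v}" if "u \<in> V" "v \<in> V" "dist_G u v = 1" for u v
    proof (rule finite_subset)
      show "{g \<in> carrier G. \<phi> g u = u \<and> \<phi> g v = v} \<subseteq> stabilizer G (edge_action \<phi>) {u, v}"
        by (auto simp: stabilizer_def edge_action_def)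
      show "finite (stabilizer G (edge_action \<phi>) {u, v})" using stab dist_eq_1 that by blast
    qed
    define rep where "rep O' = (SOME e. e \<in> O')" for O' :: "'v set set"
    define R where "R = {(u, v). u \<in> V \<and> v \<in> V \<and> {u, v} \<in> E \<and> {u, v} \<in> rep ` orbits G E (edge_action \<phi>)}"
    have rep: "\<exists>g\<in>carrier G. rep (orbit G (edge_action \<phi>) e) = \<phi> g ` e" if "e \<in> E" for e
    proof -
      have "edge_action \<phi> \<one>\<^bsub>G\<^esub> e \<in> orbit G (edge_action \<phi>) e" unfolding orbit_def by blast
      then have "rep (orbit G (edge_action \<phi>) e) \<in> orbit G (edge_action \<phi>) e" unfolding rep_def by (rule someI)
      then show ?thesis by (auto simp: orbit_def edge_action_def)
    qed
    have R1: "finite R"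
    proof (rule finite_subset)
      show "R \<subseteq> (\<Union>e\<in>rep ` orbits G E (edge_action \<phi>) \<inter> E. e \<times> e)" unfolding R_def by blast
      have "finite e" if "e \<in> E" for e using gr that by (auto simp: graph_def card_2_iff)
      then show "finite (\<Union>e\<in>rep ` orbits G E (edge_action \<phi>) \<inter> E. e \<times> e)" using orb by auto
    qed
    have R2: "\<forall>(u, v)\<in>R. u \<in> V \<and> v \<in> V \<and> dist_G u v = 1" using dist_eq_1 by (auto simp: R_def)
    have R3: "\<exists>(u0, v0)\<in>R. \<exists>g\<in>carrier G. \<phi> g u0 = u \<and> \<phi> g v0 = v"
      if uv: "u \<in> V" "v \<in> V" "dist_G u v = 1" for u v
    proof -
      have e: "{u, v} \<in> E" using dist_eq_1 uv by blast
      then obtain g where g: "g \<in> carrier G" "rep (orbit G (edge_action \<phi>) {u, v}) = \<phi> g ` {u, v}" using rep by blast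
      have "orbit G (edge_action \<phi>) {u, v} \<in> orbits G E (edge_action \<phi>)" using e by (auto simp: orbits_def)
      then have "\<phi> g ` {u, v} \<in> rep ` orbits G E (edge_action \<phi>)" using g(2) by (metis imageI)
      then have "(\<phi> g u, \<phi> g v) \<in> R" using cl g(1) uv edge e by (simp add: R_def)
      moreover have "inv\<^bsub>G\<^esub> g \<in> carrier G" "\<phi> (inv\<^bsub>G\<^esub> g) (\<phi> g u) = u" "\<phi> (inv\<^bsub>G\<^esub> g) (\<phi> g v) = v"
        using inv g(1) uv by auto
      ultimately show ?thesis
        by (intro bexI[of _ "(\<phi> g u, \<phi> g v)"]) (auto intro: bexI[of _ "inv\<^bsub>G\<^esub> g"])
    qed
    show "\<exists>R. finite R \<and> (\<forall>(u, v)\<in>R. u \<in> V \<and> v \<in> V \<and> dist_G u v = 1) \<and>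
      (\<forall>u\<in>V. \<forall>v\<in>V. dist_G u v = 1 \<longrightarrow> (\<exists>(u0, v0)\<in>R. \<exists>g\<in>carrier G. \<phi> g u0 = u \<and> \<phi> g v0 = v))"
      by (rule exI[of _ R], rule conjI[OF R1], rule conjI[OF R2]) (intro ballI impI R3)
  qed (use cl one mult in auto)
  then show ?thesis by blast
qed

section \<open>Means on cosets of amenable subgroups\<close>

lemma l1_le_has_sum:
  assumes "\<And>x. x \<in> A \<Longrightarrow> 0 \<le> f x" "(f has_sum s) A"
  shows "l1_le (\<lambda>x. if x \<in> A then f x else 0) s"
  unfolding l1_le_def
proof (intro allI impI)
  fix T :: "'a set" assume T: "finite T"
  have "(\<Sum>x\<in>T. \<bar>if x \<in> A then f x else 0\<bar>) = sum f (T \<inter> A)"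
    using T assms(1) by (intro sum.mono_neutral_cong_right) auto
  also have "\<dots> \<le> s" using T assms by (intro finite_sum_le_has_sum[OF assms(2)]) auto
  finally show "(\<Sum>x\<in>T. \<bar>if x \<in> A then f x else 0\<bar>) \<le> s" .
qed

lemma l1_le_product:
  assumes f: "l1_le f a" and g: "l1_le g b" shows "l1_le (\<lambda>(x, y). f x * g y) (a * b)"
  unfolding l1_le_def
proof (intro allI impI)
  fix T :: "('a \<times> 'b) set" assume T: "finite T"
  have "T \<subseteq> fst ` T \<times> snd ` T" by force
  then have "(\<Sum>p\<in>T. \<bar>case p of (x, y) \<Rightarrow> f x * g y\<bar>) \<le> (\<Sum>p\<in>fst ` T \<times> snd ` T. \<bar>case p of (x, y) \<Rightarrow> f x * g y\<bar>)"
    using T by (intro sum_mono2) auto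
  also have "\<dots> = (\<Sum>x\<in>fst ` T. \<bar>f x\<bar>) * (\<Sum>y\<in>snd ` T. \<bar>g y\<bar>)"
    by (simp add: sum_product sum.cartesian_product case_prod_unfold abs_mult)
  also have "\<dots> \<le> a * b"
    using T by (intro mult_mono l1_leD[OF f] l1_leD[OF g] l1_le_nonneg[OF f]) (auto intro: sum_nonneg)
  finally show "(\<Sum>p\<in>T. \<bar>case p of (x, y) \<Rightarrow> f x * g y\<bar>) \<le> a * b" .
qed

text \<open>Finite sums are bounded by those over rectangles, so nonnegativity gives summability;
  the value is then found by summing over one factor at a time.\<close>

lemma has_sum_product_nonneg:
  fixes f :: "'x \<Rightarrow> real" and g :: "'y \<Rightarrow> real"
  assumes f: "\<And>x. x \<in> A \<Longrightarrow> 0 \<le> f x" "(f has_sum s) A" and g: "\<And>y. y \<in> B \<Longrightarrow> 0 \<le> g y" "(g has_sum t) B"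
  shows "((\<lambda>(x, y). f x * g y) has_sum (s * t)) (A \<times> B)"
proof -
  have "(\<lambda>(x, y). f x * g y) summable_on A \<times> B"
  proof (rule nonneg_bdd_above_summable_on)
    show "0 \<le> (case p of (x, y) \<Rightarrow> f x * g y)" if "p \<in> A \<times> B" for p using that f(1) g(1) by auto
    show "bdd_above (sum (\<lambda>(x, y). f x * g y) ` {F. F \<subseteq> A \<times> B \<and> finite F})"
    proof (rule bdd_aboveI2)
      fix F assume F: "F \<in> {F. F \<subseteq> A \<times> B \<and> finite F}"
      have "sum (\<lambda>(x, y). f x * g y) F \<le> (\<Sum>p\<in>F. \<bar>case p of (x, y) \<Rightarrow> (if x \<in> A then f x else 0) * (if y \<in> B then g y else 0)\<bar>)"
        using F by (intro sum_mono) auto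
      also have "\<dots> \<le> s * t" using F by (intro l1_leD l1_le_product l1_le_has_sum f g) auto
      finally show "sum (\<lambda>(x, y). f x * g y) F \<le> s * t" .
    qed
  qed
  then show ?thesis
    by (intro has_sum_SigmaI[where g = "\<lambda>x. f x * t"]) (auto intro: has_sum_cmult_right has_sum_cmult_left f g)
qed

context group
begin

lemma bij_betw_mult_left: "g \<in> carrier G \<Longrightarrow> bij_betw (\<lambda>t. g \<otimes> t) (carrier G) (carrier G)"
  by (rule bij_betwI[where g = "\<lambda>t. inv g \<otimes> t"]) (auto simp: m_assoc[symmetric])

text \<open>Finite vertex stabilizers are not in the given family; the uniform mean serves for them.
  For the others the amenable action on a point provides the mean.\<close>

lemma amenable_subgroup_mean:
  assumes H: "subgroup H G" and am: "finite H \<or> amenable_group (G\<lparr>carrier := H\<rparr>)"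
    and S: "finite S" "S \<subseteq> H" and \<epsilon>: "0 < \<epsilon>"
  shows "\<exists>\<kappa>. (\<forall>t. 0 \<le> \<kappa> t) \<and> (\<forall>t. t \<notin> H \<longrightarrow> \<kappa> t = 0) \<and> (\<kappa> has_sum 1) H \<and>
    (\<forall>s\<in>S. l1_le (\<lambda>t. if t \<in> H then \<kappa> (inv s \<otimes> t) - \<kappa> t else 0) \<epsilon>)"
  using am
proof
  assume fin: "finite H"
  have "H \<noteq> {}" using subgroup.one_closed[OF H] by auto
  then have "(unif H has_sum 1) H" using fin sum_unif[of H H] by (simp add: has_sum_finite_iff)
  moreover have "inv s \<otimes> t \<in> H" if "s \<in> S" "t \<in> H" for s t
    using subgroup.m_closed[OF H] subgroup.m_inv_closed[OF H] S that by blast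
  then have "(\<lambda>t. if t \<in> H then unif H (inv s \<otimes> t) - unif H t else 0) = (\<lambda>t. 0)" if "s \<in> S" for s
    using that by (auto simp: unif_def)
  ultimately show ?thesis using \<epsilon>
    by (intro exI[of _ "unif H"]) (auto simp: unif_nonneg l1_le_0 unif_def)
next
  assume am: "amenable_group (G\<lparr>carrier := H\<rparr>)"
  define GH where "GH = G\<lparr>carrier := H\<rparr>"
  have cGH: "carrier GH = H" by (simp add: GH_def)
  obtain \<mu> where \<mu>: "continuous_map (discrete_topology {()}) (Prob_topology GH) \<mu>"
    "\<forall>s\<in>S. l1_norm GH (\<lambda>t. left_translate GH s (\<mu> ()) t - \<mu> () t) \<le> \<epsilon>"
  proof -
    have "\<exists>\<mu>. continuous_map (discrete_topology {()}) (Prob_topology GH) \<mu> \<and>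
          (\<forall>s\<in>S. \<forall>\<omega>\<in>topspace (discrete_topology {()}).
             l1_norm GH (\<lambda>t. left_translate GH s (\<mu> \<omega>) t - \<mu> ((\<lambda>x\<in>{()}. x) \<omega>) t) \<le> \<epsilon>)"
      using am S \<epsilon> cGH unfolding amenable_group_def amenable_action_def GH_def[symmetric] by blast
    then show ?thesis using that by auto
  qed
  have "\<mu> () \<in> topspace (Prob_topology GH)" using \<mu>(1) by (auto simp: continuous_map_def)
  then have p: "\<mu> () \<in> H \<rightarrow>\<^sub>E {0..}" "(\<mu> () has_sum 1) H"
    by (auto simp: Prob_topology_def Prob_def cGH)
  \<comment> \<open>Means on the subgroup are \<open>undefined\<close> outside \<open>H\<close>;
    extended by 0 they live on the whole group.\<close>
  define \<kappa> where "\<kappa> t = (if t \<in> H then \<mu> () t else 0)" for t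
  have hs: "(\<kappa> has_sum 1) H" using p(2) by (rule has_sum_cong[THEN iffD2, rotated]) (simp add: \<kappa>_def)
  have nn: "0 \<le> \<kappa> t" for t using p(1) by (auto simp: \<kappa>_def PiE_iff)
  have "l1_le (\<lambda>t. if t \<in> H then \<kappa> (inv s \<otimes> t) - \<kappa> t else 0) \<epsilon>" if s: "s \<in> S" for s
  proof -
    have sH: "s \<in> H" and isH: "inv s \<in> H" using s S subgroup.m_inv_closed[OF H] by auto
    have mc: "inv s \<otimes> t \<in> H" "s \<otimes> t \<in> H" if "t \<in> H" for t using subgroup.m_closed[OF H] sH isH that by auto
    have HG: "t \<in> carrier G" if "t \<in> H" for t using subgroup.mem_carrier[OF H that] .
    have bij: "bij_betw (\<lambda>t. inv s \<otimes> t) H H"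
      by (rule bij_betwI[where g = "\<lambda>t. s \<otimes> t"]) (use mc HG sH in \<open>auto simp: m_assoc[symmetric]\<close>)
    have hs': "((\<lambda>t. \<kappa> (inv s \<otimes> t)) has_sum 1) H" using hs has_sum_reindex_bij_betw[OF bij] by blast
    \<comment> \<open>\<open>infsum\<close> is 0 for functions that are not summable, so its bound
      is of use only once summability is known.\<close>
    have sm: "(\<lambda>t. \<bar>\<kappa> (inv s \<otimes> t) - \<kappa> t\<bar>) summable_on H"
    proof (rule summable_on_comparison_test)
      show "(\<lambda>t. \<kappa> (inv s \<otimes> t) + \<kappa> t) summable_on H" using has_sum_add[OF hs' hs] by (auto simp: summable_on_def)
      show "\<bar>\<kappa> (inv s \<otimes> t) - \<kappa> t\<bar> \<le> \<kappa> (inv s \<otimes> t) + \<kappa> t" for t using nn[of "inv s \<otimes> t"] nn[of t] by linarith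
    qed simp
    have "l1_norm GH (\<lambda>t. left_translate GH s (\<mu> ()) t - \<mu> () t) = infsum (\<lambda>t. \<bar>\<kappa> (inv s \<otimes> t) - \<kappa> t\<bar>) H"
      unfolding l1_norm_def cGH
    proof (rule infsum_cong)
      fix t assume t: "t \<in> H"
      have "inv\<^bsub>GH\<^esub> s = inv s" unfolding GH_def by (rule m_inv_consistent[OF H sH])
      then show "\<bar>left_translate GH s (\<mu> ()) t - \<mu> () t\<bar> = \<bar>\<kappa> (inv s \<otimes> t) - \<kappa> t\<bar>"
        using t mc by (simp add: left_translate_def \<kappa>_def GH_def)
    qed
    then have le: "infsum (\<lambda>t. \<bar>\<kappa> (inv s \<otimes> t) - \<kappa> t\<bar>) H \<le> \<epsilon>" using bspec[OF \<mu>(2) s] by metis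
    have "l1_le (\<lambda>t. if t \<in> H then \<bar>\<kappa> (inv s \<otimes> t) - \<kappa> t\<bar> else 0) \<epsilon>"
      by (rule l1_le_mono[OF l1_le_has_sum[OF _ has_sum_infsum[OF sm]] le]) simp
    then show ?thesis by (rule l1_le_dominated) simp
  qed
  then show ?thesis using hs nn by (intro exI[of _ \<kappa>]) (auto simp: \<kappa>_def)
qed

end

text \<open>The mean of \<open>v\<close> is a mean on the stabilizer of the representative of its
  orbit, translated by an element \<open>a v\<close> that carries the representative to
  \<open>v\<close>. Comparing its translate by \<open>s\<close> with the mean of
  \<open>\<phi> s v\<close> then amounts to translating by the cocycle \<open>h s v\<close>, which
  lies in that stabilizer. As \<open>S\<close> and \<open>B\<close> are finite, finitely many
  cocycle values occur.\<close>

lemma coset_means: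
  fixes G (structure)
  assumes act: "group_action G V \<phi>"
    and am: "\<And>v. v \<in> V \<Longrightarrow> finite (stabilizer G \<phi> v) \<or> amenable_group (G\<lparr>carrier := stabilizer G \<phi> v\<rparr>)"
    and B: "finite B" "B \<subseteq> V" and S: "finite S" "S \<subseteq> carrier G" and \<epsilon>: "(0::real) < \<epsilon>"
  shows "\<exists>m. (\<forall>v\<in>V. (\<forall>t. 0 \<le> m v t) \<and> (m v has_sum 1) (carrier G)) \<and>
    (\<forall>s\<in>S. \<forall>v\<in>B. l1_le (\<lambda>t. if t \<in> carrier G then m v (inv s \<otimes> t) - m (\<phi> s v) t else 0) \<epsilon>)"
proof -
  interpret group_action G V \<phi> by fact
  interpret group G using group_hom group_hom.axioms(1) by auto
  have cl: "\<phi> g v \<in> V" if "g \<in> carrier G" "v \<in> V" for g v using element_image that by blast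
  have act_inv: "\<phi> (inv g) (\<phi> g v) = v" if "g \<in> carrier G" "v \<in> V" for g v using orbit_sym_aux that by blast
  \<comment> \<open>The choice depends only on the orbit as a set, so all its points have the same
    representative.\<close>
  define rep where "rep v = (SOME w. w \<in> orbit G \<phi> v)" for v
  have "\<exists>g. g \<in> carrier G \<and> \<phi> g (rep v) = v \<and> rep v \<in> V" if v: "v \<in> V" for v
  proof -
    have "rep v \<in> orbit G \<phi> v" unfolding rep_def by (rule someI[of _ v]) (rule orbit_refl[OF v])
    then obtain g where g: "g \<in> carrier G" "rep v = \<phi> g v" by (auto simp: orbit_def)
    then show ?thesis using act_inv v cl by (intro exI[of _ "inv g"]) auto
  qed
  then obtain a where a: "\<And>v. v \<in> V \<Longrightarrow> a v \<in> carrier G \<and> \<phi> (a v) (rep v) = v \<and> rep v \<in> V" by metis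
  have rep_act: "rep (\<phi> s v) = rep v" if s: "s \<in> carrier G" and v: "v \<in> V" for s v
  proof -
    have "orbit G \<phi> (\<phi> s v) = orbit G \<phi> v"
    proof (intro equalityI subsetI)
      fix w assume "w \<in> orbit G \<phi> (\<phi> s v)"
      then obtain g where "g \<in> carrier G" "w = \<phi> g (\<phi> s v)" by (auto simp: orbit_def)
      then have "w = \<phi> (g \<otimes> s) v" "g \<otimes> s \<in> carrier G" using composition_rule[OF v] s by auto
      then show "w \<in> orbit G \<phi> v" by (auto simp: orbit_def)
    next
      fix w assume "w \<in> orbit G \<phi> v"
      then obtain g where g: "g \<in> carrier G" "w = \<phi> g v" by (auto simp: orbit_def)
      then have "w = \<phi> (g \<otimes> inv s) (\<phi> s v)" "g \<otimes> inv s \<in> carrier G"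
        using composition_rule[OF cl[OF s v], of g "inv s"] act_inv[OF s v] s by auto
      then show "w \<in> orbit G \<phi> (\<phi> s v)" by (auto simp: orbit_def)
    qed
    then show ?thesis by (simp add: rep_def)
  qed
  define h where "h s v = inv (a (\<phi> s v)) \<otimes> s \<otimes> a v" for s v
  have h: "h s v \<in> stabilizer G \<phi> (rep v)" if s: "s \<in> carrier G" and v: "v \<in> V" for s v
  proof -
    note av = a[OF v] and asv = a[OF cl[OF s v]]
    have hG: "h s v \<in> carrier G" using s av asv by (simp add: h_def)
    have "\<phi> (h s v) (rep v) = \<phi> (inv (a (\<phi> s v))) (\<phi> s (\<phi> (a v) (rep v)))"
      unfolding h_def
      using composition_rule[of "rep v" "inv (a (\<phi> s v)) \<otimes> s" "a v"] composition_rule[of v "inv (a (\<phi> s v))" s]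
        s v av asv by simp
    also have "\<dots> = rep v" using av asv act_inv[of "a (\<phi> s v)" "rep (\<phi> s v)"] rep_act[OF s v] by simp
    finally show ?thesis using hG by (simp add: stabilizer_def)
  qed
  define R where "R r = {h s v | s v. s \<in> S \<and> v \<in> B \<and> rep v = r}" for r
  define Q where "Q r \<kappa> \<longleftrightarrow> (\<forall>t. 0 \<le> \<kappa> t) \<and> (\<forall>t. t \<notin> stabilizer G \<phi> r \<longrightarrow> \<kappa> t = 0) \<and>
    (\<kappa> has_sum 1) (stabilizer G \<phi> r) \<and>
    (\<forall>s\<in>R r. l1_le (\<lambda>t. if t \<in> stabilizer G \<phi> r then \<kappa> (inv s \<otimes> t) - \<kappa> t else 0) \<epsilon>)"
    for r and \<kappa> :: "'a \<Rightarrow> real"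
  have "\<exists>\<kappa>. Q r \<kappa>" if r: "r \<in> V" for r
    unfolding Q_def
  proof (rule amenable_subgroup_mean[where S = "R r", OF stabilizer_subgroup[OF r] am[OF r] _ _ \<epsilon>])
    have "R r \<subseteq> (\<lambda>(s, v). h s v) ` (S \<times> B)" by (auto simp: R_def)
    then show "finite (R r)" by (rule finite_surj[rotated]) (use B S in simp)
    show "R r \<subseteq> stabilizer G \<phi> r" using h B S by (auto simp: R_def)
  qed
  then obtain \<kappa> where "\<forall>r\<in>V. Q r (\<kappa> r)" using bchoice[of V Q] by blast
  then have \<kappa>: "(\<forall>t. 0 \<le> \<kappa> r t) \<and> (\<forall>t. t \<notin> stabilizer G \<phi> r \<longrightarrow> \<kappa> r t = 0) \<and>
    (\<kappa> r has_sum 1) (stabilizer G \<phi> r) \<and>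
    (\<forall>s\<in>R r. l1_le (\<lambda>t. if t \<in> stabilizer G \<phi> r then \<kappa> r (inv s \<otimes> t) - \<kappa> r t else 0) \<epsilon>)" if "r \<in> V" for r
    using that unfolding Q_def by simp
  define m where "m v t = \<kappa> (rep v) (inv (a v) \<otimes> t)" for v t
  have "(\<forall>t. 0 \<le> m v t) \<and> (m v has_sum 1) (carrier G)" if v: "v \<in> V" for v
  proof -
    have r: "rep v \<in> V" and aG: "inv (a v) \<in> carrier G" using a[OF v] by auto
    have "(\<kappa> (rep v) has_sum 1) (carrier G)"
      using \<kappa>[OF r] by (subst has_sum_cong_neutral[where S = "carrier G" and T = "stabilizer G \<phi> (rep v)"])
        (auto simp: stabilizer_def)
    then have "((\<lambda>t. \<kappa> (rep v) (inv (a v) \<otimes> t)) has_sum 1) (carrier G)"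
      using has_sum_reindex_bij_betw[OF bij_betw_mult_left[OF aG]] by blast
    then show ?thesis using \<kappa>[OF r] unfolding m_def by blast
  qed
  moreover have "l1_le (\<lambda>t. if t \<in> carrier G then m v (inv s \<otimes> t) - m (\<phi> s v) t else 0) \<epsilon>"
    if s: "s \<in> S" and v: "v \<in> B" for s v
  proof -
    have sG: "s \<in> carrier G" and vV: "v \<in> V" using s v S B by auto
    have r: "rep v \<in> V" and aG: "a v \<in> carrier G" "a (\<phi> s v) \<in> carrier G" using a[OF vV] a[OF cl[OF sG vV]] by auto
    define f where "f t = inv (a (\<phi> s v)) \<otimes> t" for t
    define H where "H = stabilizer G \<phi> (rep v)"
    have Hsub: "subgroup H G" unfolding H_def by (rule stabilizer_subgroup[OF r])
    have hH: "h s v \<in> H" unfolding H_def by (rule h[OF sG vV])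
    have hR: "h s v \<in> R (rep v)" using s v by (auto simp: R_def)
    have "l1_le (\<lambda>t. if t \<in> H then \<kappa> (rep v) (inv (h s v) \<otimes> t) - \<kappa> (rep v) t else 0) \<epsilon>"
      using \<kappa>[OF r] hR unfolding H_def by blast
    moreover have "inj_on f (carrier G)" unfolding f_def using aG by (auto simp: inj_on_def)
    ultimately have "l1_le (\<lambda>t. if t \<in> carrier G then
        if f t \<in> H then \<kappa> (rep v) (inv (h s v) \<otimes> f t) - \<kappa> (rep v) (f t) else 0 else 0) \<epsilon>"
      by (rule l1_le_reindex)
    moreover have "(if f t \<in> H then \<kappa> (rep v) (inv (h s v) \<otimes> f t) - \<kappa> (rep v) (f t) else 0) = m v (inv s \<otimes> t) - m (\<phi> s v) t"
      if t: "t \<in> carrier G" for t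
    proof -
      have hG: "h s v \<in> carrier G" using hH Hsub subgroup.mem_carrier by metis
      have "inv (h s v) \<otimes> f t = inv (a v) \<otimes> (inv s \<otimes> t)"
      proof -
        have "a (\<phi> s v) \<otimes> (inv (a (\<phi> s v)) \<otimes> t) = t" using aG t by (simp add: m_assoc[symmetric])
        then show ?thesis unfolding h_def f_def using sG aG t by (simp add: inv_mult_group m_assoc)
      qed
      then have e1: "m v (inv s \<otimes> t) = \<kappa> (rep v) (inv (h s v) \<otimes> f t)" by (simp add: m_def)
      have e2: "m (\<phi> s v) t = \<kappa> (rep v) (f t)" by (simp add: m_def f_def rep_act[OF sG vV])
      have fG: "f t \<in> carrier G" using aG t by (simp add: f_def)
      show ?thesis
      proof (cases "f t \<in> H")
        case False
        have "inv (h s v) \<otimes> f t \<notin> H"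
        proof
          assume "inv (h s v) \<otimes> f t \<in> H"
          then have "h s v \<otimes> (inv (h s v) \<otimes> f t) \<in> H" using hH subgroup.m_closed[OF Hsub] by blast
          then show False using False hG fG by (simp add: m_assoc[symmetric])
        qed
        then show ?thesis using False \<kappa>[OF r] unfolding e1 e2 H_def by simp
      qed (simp add: e1 e2)
    qed
    ultimately show ?thesis by (simp cong: if_cong)
  qed
  ultimately show ?thesis by blast
qed

text \<open>One \<epsilon> pays for replacing the translate of \<open>m v\<close> by the mean of
  \<open>\<phi> s v\<close>, the other for replacing the coefficients.\<close>

lemma approximately_invariant_means:
  fixes G (structure) and \<zeta> :: "'a \<Rightarrow> 'v \<Rightarrow> real"
  assumes act: "group_action G V \<phi>"
    and am: "\<And>v. v \<in> V \<Longrightarrow> finite (stabilizer G \<phi> v) \<or> amenable_group (G\<lparr>carrier := stabilizer G \<phi> v\<rparr>)"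
    and B: "finite B" "B \<subseteq> V" and S: "finite S" "S \<subseteq> carrier G" and \<epsilon>: "0 < \<epsilon>"
    and prob: "\<And>x. x \<in> carrier G \<Longrightarrow> (\<forall>v. 0 \<le> \<zeta> x v) \<and> (\<forall>v. v \<notin> B \<longrightarrow> \<zeta> x v = 0) \<and> sum (\<zeta> x) B = 1"
    and inv: "\<And>s t x. s \<in> S \<Longrightarrow> t \<in> S \<Longrightarrow> x \<in> carrier G - F \<Longrightarrow>
      l1_le (\<lambda>v. if v \<in> V then \<zeta> x v - \<zeta> (s \<otimes> x \<otimes> t) (\<phi> s v) else 0) \<epsilon>"
  shows "\<exists>m. (\<forall>v\<in>V. (\<forall>t. 0 \<le> m v t) \<and> (m v has_sum 1) (carrier G)) \<and>
    (\<forall>s\<in>S. \<forall>t\<in>S. \<forall>x\<in>carrier G - F. l1_le (\<lambda>p. if p \<in> carrier G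
       then (\<Sum>v\<in>B. \<zeta> x v * m v (inv s \<otimes> p)) - (\<Sum>v\<in>B. \<zeta> (s \<otimes> x \<otimes> t) v * m v p) else 0) (2 * \<epsilon>))"
proof -
  interpret group_action G V \<phi> by fact
  interpret group G using group_hom group_hom.axioms(1) by auto
  have cl: "\<phi> g v \<in> V" if "g \<in> carrier G" "v \<in> V" for g v using element_image that by blast
  obtain m where m: "\<And>v. v \<in> V \<Longrightarrow> (\<forall>t. 0 \<le> m v t) \<and> (m v has_sum 1) (carrier G)"
    "\<And>s v. s \<in> S \<Longrightarrow> v \<in> B \<Longrightarrow> l1_le (\<lambda>t. if t \<in> carrier G then m v (inv s \<otimes> t) - m (\<phi> s v) t else 0) \<epsilon>"
    using coset_means[OF act am B S \<epsilon>] by blast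
  have "l1_le (\<lambda>p. if p \<in> carrier G
       then (\<Sum>v\<in>B. \<zeta> x v * m v (inv s \<otimes> p)) - (\<Sum>v\<in>B. \<zeta> (s \<otimes> x \<otimes> t) v * m v p) else 0) (2 * \<epsilon>)"
    if s: "s \<in> S" and t: "t \<in> S" and x: "x \<in> carrier G - F" for s t x
  proof -
    have G: "s \<in> carrier G" "t \<in> carrier G" "x \<in> carrier G" using s t x S by auto
    define y where "y = s \<otimes> x \<otimes> t"
    have y: "y \<in> carrier G" using G by (simp add: y_def)
    \<comment> \<open>Large enough to contain the support of \<open>\<zeta> x\<close> and the
      preimage under \<open>\<phi> s\<close> of the support of \<open>\<zeta> y\<close>.\<close>
    define C where "C = B \<union> \<phi> (inv s) ` B"
    have C: "finite C" "C \<subseteq> V" using B cl G by (auto simp: C_def)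
    have inj: "inj_on (\<phi> s) C" using inj_prop[OF G(1)] C(2) inj_on_subset by blast
    have sC: "B \<subseteq> \<phi> s ` C"
    proof
      fix v assume "v \<in> B"
      then have "\<phi> s (\<phi> (inv s) v) = v" "\<phi> (inv s) v \<in> C"
        using orbit_sym_aux[of "inv s" v "\<phi> (inv s) v"] G B by (auto simp: C_def)
      then show "v \<in> \<phi> s ` C" by (metis imageI)
    qed
    have 1: "l1_le (\<lambda>p. \<Sum>v\<in>B. \<zeta> x v * (if p \<in> carrier G then m v (inv s \<otimes> p) - m (\<phi> s v) p else 0)) (\<Sum>v\<in>B. \<bar>\<zeta> x v\<bar> * \<epsilon>)"
      by (intro l1_le_sum l1_le_cmult m(2) s)
    have e1: "(\<Sum>v\<in>B. \<bar>\<zeta> x v\<bar> * \<epsilon>) = \<epsilon>"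
      using prob[OF G(3)] by (simp add: sum_distrib_right[symmetric])
    have 2: "l1_le (\<lambda>p. \<Sum>v\<in>C. (\<zeta> x v - \<zeta> y (\<phi> s v)) * (if p \<in> carrier G then m (\<phi> s v) p else 0))
        (\<Sum>v\<in>C. \<bar>\<zeta> x v - \<zeta> y (\<phi> s v)\<bar> * 1)"
    proof (intro l1_le_sum l1_le_cmult l1_le_has_sum)
      fix v p assume "v \<in> C"
      then show "(m (\<phi> s v) has_sum 1) (carrier G)" "0 \<le> m (\<phi> s v) p" using m(1) cl G C by blast+
    qed
    have e2: "(\<Sum>v\<in>C. \<bar>\<zeta> x v - \<zeta> y (\<phi> s v)\<bar> * 1) \<le> \<epsilon>"
    proof -
      have "(\<Sum>v\<in>C. \<bar>\<zeta> x v - \<zeta> y (\<phi> s v)\<bar> * 1) = (\<Sum>v\<in>C. \<bar>if v \<in> V then \<zeta> x v - \<zeta> y (\<phi> s v) else 0\<bar>)"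
        using C by (intro sum.cong) auto
      also have "\<dots> \<le> \<epsilon>" using inv[OF s t x] C(1) unfolding y_def by (rule l1_leD)
      finally show ?thesis .
    qed
    have "l1_le (\<lambda>p. (\<Sum>v\<in>B. \<zeta> x v * (if p \<in> carrier G then m v (inv s \<otimes> p) - m (\<phi> s v) p else 0)) +
        (\<Sum>v\<in>C. (\<zeta> x v - \<zeta> y (\<phi> s v)) * (if p \<in> carrier G then m (\<phi> s v) p else 0))) (2 * \<epsilon>)"
      by (rule l1_le_mono[OF l1_le_add[OF 1 2]]) (use e1 e2 in linarith)
    moreover have "(\<Sum>v\<in>B. \<zeta> x v * (if p \<in> carrier G then m v (inv s \<otimes> p) - m (\<phi> s v) p else 0)) +
        (\<Sum>v\<in>C. (\<zeta> x v - \<zeta> y (\<phi> s v)) * (if p \<in> carrier G then m (\<phi> s v) p else 0)) =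
        (if p \<in> carrier G then (\<Sum>v\<in>B. \<zeta> x v * m v (inv s \<otimes> p)) - (\<Sum>v\<in>B. \<zeta> y v * m v p) else 0)" for p
    proof (cases "p \<in> carrier G")
      case True
      have a: "(\<Sum>v\<in>C. \<zeta> x v * m (\<phi> s v) p) = (\<Sum>v\<in>B. \<zeta> x v * m (\<phi> s v) p)"
        using C prob[OF G(3)] by (intro sum.mono_neutral_right) (auto simp: C_def)
      have "(\<Sum>v\<in>C. \<zeta> y (\<phi> s v) * m (\<phi> s v) p) = (\<Sum>w\<in>\<phi> s ` C. \<zeta> y w * m w p)"
        using inj by (simp add: sum.reindex)
      also have "\<dots> = (\<Sum>w\<in>B. \<zeta> y w * m w p)"
        using C sC prob[OF y] by (intro sum.mono_neutral_right) auto
      finally show ?thesis using a True by (simp add: left_diff_distrib right_diff_distrib sum_subtractf)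
    qed simp
    ultimately have "l1_le (\<lambda>p. if p \<in> carrier G
        then (\<Sum>v\<in>B. \<zeta> x v * m v (inv s \<otimes> p)) - (\<Sum>v\<in>B. \<zeta> y v * m v p) else 0) (2 * \<epsilon>)"
      by (simp only:)
    then show ?thesis by (simp only: y_def)
  qed
  then show ?thesis using m(1) by blast
qed

section \<open>Limits along ultrafilters\<close>

lemma has_sum_sum_finite:
  fixes f :: "'i \<Rightarrow> 'x \<Rightarrow> real"
  assumes "\<And>i. i \<in> I \<Longrightarrow> (f i has_sum s i) A"
  shows "((\<lambda>x. \<Sum>i\<in>I. f i x) has_sum (\<Sum>i\<in>I. s i)) A"
  using assms
proof (induction I rule: infinite_finite_induct)
  case (insert i I)
  then show ?case using has_sum_add[of "f i" A "s i" "\<lambda>x. \<Sum>i\<in>I. f i x"] by simp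
qed simp_all

text \<open>Compactness gives a cluster point of the image filter, and along an ultrafilter a
  cluster point is a limit.\<close>

lemma ultrafilter_tendsto:
  fixes f :: "'a \<Rightarrow> real"
  assumes F: "F \<in> ultrafilters_on X" and f: "\<And>x. x \<in> X \<Longrightarrow> a \<le> f x \<and> f x \<le> b"
  shows "(f \<longlongrightarrow> Lim F f) F"
proof -
  have ev: "eventually (\<lambda>x. x \<in> X) F" and nb: "F \<noteq> bot"
    using F by (auto simp: ultrafilters_on_def le_principal)
  have "compact {a..b}" "filtermap f F \<noteq> bot" "eventually (\<lambda>y. y \<in> {a..b}) (filtermap f F)"
    using ev f nb by (auto simp: filtermap_bot_iff eventually_filtermap elim: eventually_mono)
  then obtain l where l: "inf (nhds l) (filtermap f F) \<noteq> bot"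
    unfolding compact_filter by metis
  have "(f \<longlongrightarrow> l) F"
  proof (rule topological_tendstoI)
    fix U assume U: "open U" "l \<in> U"
    show "eventually (\<lambda>x. f x \<in> U) F"
    proof (rule ccontr)
      assume "\<not> ?thesis"
      then have "eventually (\<lambda>x. f x \<notin> U) F" using ultrafilters_on_not[OF F] by blast
      then have "eventually (\<lambda>y. y \<notin> U) (filtermap f F)" by (simp add: eventually_filtermap)
      moreover have "eventually (\<lambda>y. y \<in> U) (nhds l)" using U eventually_nhds by blast
      ultimately have "eventually (\<lambda>y. False) (inf (nhds l) (filtermap f F))"
        unfolding eventually_inf by (metis (mono_tags, lifting))
      then show False using l by (simp add: trivial_limit_def)
    qed
  qed
  then show ?thesis using tendsto_Lim nb by metis
qed

lemma Lim_ultrafilter_bounds: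
  fixes f :: "'a \<Rightarrow> real"
  assumes F: "F \<in> ultrafilters_on X" and f: "\<And>x. x \<in> X \<Longrightarrow> a \<le> f x \<and> f x \<le> b"
    and g: "eventually (\<lambda>x. c \<le> f x \<and> f x \<le> e) F"
  shows "c \<le> Lim F f \<and> Lim F f \<le> e"
proof -
  have nb: "F \<noteq> bot" using F by (simp add: ultrafilters_on_def)
  have lim: "(f \<longlongrightarrow> Lim F f) F" by (rule ultrafilter_tendsto[where f = f, OF F f])
  have "eventually (\<lambda>x. c \<le> f x) F" "eventually (\<lambda>x. f x \<le> e) F"
    using g by (auto elim: eventually_mono)
  then show ?thesis using tendsto_lowerbound[OF lim _ nb] tendsto_upperbound[OF lim _ nb] by blast
qed

text \<open>The ultrafilters along which \<open>f\<close> stays within \<open>e / 2\<close> of its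
  limit along \<open>F\<close> form a basic open set, and this closed condition passes to their
  limits.\<close>

lemma continuous_map_Lim:
  fixes f :: "'a \<Rightarrow> real"
  assumes f: "\<And>x. x \<in> X \<Longrightarrow> a \<le> f x \<and> f x \<le> b"
  shows "continuous_map (beta X) euclideanreal (\<lambda>F. Lim F f)"
  unfolding continuous_map_atin limitin_canonical_iff tendsto_iff
proof (intro ballI allI impI)
  fix F and e :: real assume F: "F \<in> topspace (beta X)" and e: "0 < e"
  then have F: "F \<in> ultrafilters_on X" by (simp add: topspace_beta)
  define U where "U = {H \<in> ultrafilters_on X. eventually (\<lambda>x. Lim F f - e / 2 \<le> f x \<and> f x \<le> Lim F f + e / 2) H}"
  have "eventually (\<lambda>x. dist (f x) (Lim F f) < e / 2) F"
    using ultrafilter_tendsto[where f = f, OF F f] half_gt_zero[OF e] unfolding tendsto_iff by blast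
  then have "eventually (\<lambda>x. Lim F f - e / 2 \<le> f x \<and> f x \<le> Lim F f + e / 2) F"
    by (rule eventually_mono) (unfold dist_real_def, linarith)
  then have "F \<in> U" using F unfolding U_def by blast
  moreover have "openin (beta X) U" unfolding U_def by (rule openin_beta_basic)
  moreover have "dist (Lim H f) (Lim F f) < e" if "H \<in> U" for H
  proof -
    have "Lim F f - e / 2 \<le> Lim H f \<and> Lim H f \<le> Lim F f + e / 2"
      by (rule Lim_ultrafilter_bounds[where f = f, OF _ f]) (use that in \<open>auto simp: U_def\<close>)
    then show ?thesis unfolding dist_real_def using e by linarith
  qed
  ultimately show "eventually (\<lambda>H. dist (Lim H f) (Lim F f) < e) (atin (beta X) F)"
    unfolding eventually_atin by blast
qed

lemma eventually_in_ultrafilters_on: "F \<in> ultrafilters_on X \<Longrightarrow> eventually (\<lambda>x. x \<in> X) F"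
  by (simp add: ultrafilters_on_def le_principal)

lemma filtermap_eventually_cong:
  assumes "eventually (\<lambda>x. f x = g x) F" shows "filtermap f F = filtermap g F"
proof -
  have "eventually (\<lambda>x. P (f x)) F \<longleftrightarrow> eventually (\<lambda>x. P (g x)) F" for P
    using assms by (intro eventually_subst) (auto elim: eventually_mono)
  then show ?thesis by (simp add: filter_eq_iff eventually_filtermap)
qed

lemma filtermap_ultrafilter:
  assumes F: "F \<in> ultrafilters_on X" and f: "f \<in> X \<rightarrow> X" shows "filtermap f F \<in> ultrafilters_on X"
proof -
  have "eventually (\<lambda>x. f x \<in> X) F"
    using eventually_in_ultrafilters_on[OF F] by (rule eventually_mono) (use f in auto)
  then show ?thesis using F ultrafilters_on_not[OF F]
    by (auto simp: ultrafilters_on_def le_principal eventually_filtermap filtermap_bot_iff)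
qed

text \<open>Continuity provides a set of \<open>F\<close> whose points, as principal ultrafilters,
  are mapped into the basic open set of \<open>P\<close>, which means \<open>P (f x)\<close>.
  Applied to the negation of \<open>P\<close>, this yields the converse.\<close>

lemma beta_extension_eq_filtermap:
  assumes F: "F \<in> ultrafilters_on X" and f: "f \<in> X \<rightarrow> X"
  shows "beta_extension X f F = filtermap f F"
proof -
  define g where "g = beta_extension X f"
  have cont: "continuous_map (beta X) (beta X) g" and pt: "\<And>x. x \<in> X \<Longrightarrow> g (beta_point x) = beta_point (f x)"
    unfolding g_def using beta_extension[OF f] by blast+
  have gF: "g F \<in> ultrafilters_on X" using cont F by (auto simp: continuous_map_def topspace_beta)
  have imp: "eventually (\<lambda>x. P (f x)) F" if P: "eventually P (g F)" for P
  proof -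
    define W where "W = {H \<in> ultrafilters_on X. eventually P H}"
    have "openin (beta X) {H \<in> topspace (beta X). g H \<in> W}"
      using cont openin_beta_basic[of X P] unfolding continuous_map_def W_def by blast
    moreover have "F \<in> {H \<in> topspace (beta X). g H \<in> W}" using F gF P by (simp add: topspace_beta W_def)
    ultimately obtain A where A: "A \<subseteq> X" "eventually (\<lambda>x. x \<in> A) F"
      "{H \<in> ultrafilters_on X. eventually (\<lambda>x. x \<in> A) H} \<subseteq> {H \<in> topspace (beta X). g H \<in> W}"
      by (rule openin_beta_nbhd)
    have "P (f x)" if x: "x \<in> A" for x
    proof -
      have "beta_point x \<in> {H \<in> ultrafilters_on X. eventually (\<lambda>x. x \<in> A) H}"
        using beta_point_in[of x X] A(1) x by (auto simp: topspace_beta beta_point_def eventually_principal)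
      from subsetD[OF A(3) this] have "g (beta_point x) \<in> W" by simp
      then have "beta_point (f x) \<in> W" using pt[of x] A(1) x by auto
      then show ?thesis by (simp add: W_def beta_point_def eventually_principal)
    qed
    then show ?thesis using A(2) by (auto elim: eventually_mono)
  qed
  have "eventually P (g F) \<longleftrightarrow> eventually (\<lambda>x. P (f x)) F" for P
    using imp[of P] imp[of "\<lambda>x. \<not> P x"] ultrafilters_on_not[OF gF, of P] ultrafilters_on_not[OF F, of "\<lambda>x. P (f x)"]
    by blast
  then show ?thesis unfolding g_def[symmetric] by (simp add: filter_eq_iff eventually_filtermap)
qed

lemma topspace_beta_remainder:
  "topspace (beta_remainder X) = ultrafilters_on X - beta_point ` X"
  by (auto simp: beta_remainder_def topspace_beta)

text \<open>An ultrafilter that contains a finite set contains one of its singletons and is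
  principal. Finite exceptional sets thus disappear on the remainder.\<close>

lemma eventually_notin_finite:
  assumes F: "F \<in> topspace (beta_remainder X)" and A: "finite A"
  shows "eventually (\<lambda>x. x \<notin> A) F"
proof (rule ccontr)
  have FU: "F \<in> ultrafilters_on X" using F by (simp add: topspace_beta_remainder)
  assume n: "\<not> ?thesis"
  have "\<exists>a\<in>A. eventually (\<lambda>x. x = a) F"
  proof (rule ccontr)
    assume "\<not> ?thesis"
    then have "\<forall>a\<in>A. eventually (\<lambda>x. x \<noteq> a) F" using ultrafilters_on_not[OF FU, of "\<lambda>x. x = _"] by blast
    then have "eventually (\<lambda>x. \<forall>a\<in>A. x \<noteq> a) F" using A by (simp add: eventually_ball_finite)
    then have "eventually (\<lambda>x. x \<notin> A) F" by (rule eventually_mono) auto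
    then show False using n by blast
  qed
  then obtain a where a: "eventually (\<lambda>x. x = a) F" by blast
  have nb: "F \<noteq> bot" using FU by (simp add: ultrafilters_on_def)
  have "eventually P F \<longleftrightarrow> P a" for P
  proof
    assume "eventually P F"
    with a have "eventually (\<lambda>x. P a) F" by eventually_elim simp
    then show "P a" using nb by (metis eventually_const)
  next
    assume "P a"
    with a show "eventually P F" by (auto elim: eventually_mono)
  qed
  then have "F = beta_point a" "a \<in> X"
    using eventually_in_ultrafilters_on[OF FU] by (auto simp: filter_eq_iff beta_point_def eventually_principal)
  then show False using F by (simp add: topspace_beta_remainder)
qed

text \<open>Principal ultrafilters are isolated points, so the remainder is closed.\<close>

lemma compact_space_beta_remainder: "compact_space (beta_remainder X)"
proof -
  have "{beta_point x} = {F \<in> ultrafilters_on X. eventually (\<lambda>y. y = x) F}" if x: "x \<in> X" for x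
  proof (intro equalityI subsetI)
    fix F assume "F \<in> {F \<in> ultrafilters_on X. eventually (\<lambda>y. y = x) F}"
    then have "F \<in> ultrafilters_on X" "\<not> eventually (\<lambda>y. y \<notin> {x}) F"
      using ultrafilters_on_not[of F X "\<lambda>y. y = x"] by auto
    then have "F \<in> beta_point ` X" using eventually_notin_finite[of F X "{x}"] by (auto simp: topspace_beta_remainder)
    then show "F \<in> {beta_point x}"
      using \<open>F \<in> {F \<in> ultrafilters_on X. _ F}\<close> by (auto simp: beta_point_def eventually_principal)
  qed (use beta_point_in[OF x] in \<open>auto simp: topspace_beta beta_point_def eventually_principal\<close>)
  then have "openin (beta X) {beta_point x}" if "x \<in> X" for x
    using openin_beta_basic[of X "\<lambda>y. y = x"] that by simp
  then have "openin (beta X) (\<Union>x\<in>X. {beta_point x})" by blast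
  then have "openin (beta X) (beta_point ` X)" by (simp only: UNION_singleton_eq_range)
  then have "closedin (beta X) (topspace (beta X) - beta_point ` X)" by (intro closedin_diff) auto
  then show ?thesis unfolding beta_remainder_def
    by (intro compact_space_subtopology closedin_compact_space compact_space_beta)
qed

section \<open>The two-sided action on the remainder\<close>

context group
begin

lemma bitranslation_eq:
  assumes "\<omega> \<in> topspace (beta_remainder (carrier G))" "s \<in> carrier G" "t \<in> carrier G"
  shows "bitranslation G (s, t) \<omega> = filtermap (\<lambda>x. s \<otimes> x \<otimes> inv t) \<omega>"
  using assms by (simp add: bitranslation_def beta_extension_eq_filtermap topspace_beta_remainder)

lemma filtermap_bitranslation_comp:
  assumes \<omega>: "\<omega> \<in> ultrafilters_on (carrier G)"
    and G: "s \<in> carrier G" "t \<in> carrier G" "s' \<in> carrier G" "t' \<in> carrier G"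
  shows "filtermap (\<lambda>x. s \<otimes> x \<otimes> inv t) (filtermap (\<lambda>x. s' \<otimes> x \<otimes> inv t') \<omega>) =
    filtermap (\<lambda>x. (s \<otimes> s') \<otimes> x \<otimes> inv (t \<otimes> t')) \<omega>"
  unfolding filtermap_filtermap
  by (rule filtermap_eventually_cong)
    (use eventually_in_ultrafilters_on[OF \<omega>] G in \<open>auto simp: inv_mult_group m_assoc elim!: eventually_mono\<close>)

lemma filtermap_bitranslation_one:
  assumes \<omega>: "\<omega> \<in> ultrafilters_on (carrier G)" shows "filtermap (\<lambda>x. \<one> \<otimes> x \<otimes> inv \<one>) \<omega> = \<omega>"
proof -
  have "filtermap (\<lambda>x. \<one> \<otimes> x \<otimes> inv \<one>) \<omega> = filtermap (\<lambda>x. x) \<omega>"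
    by (rule filtermap_eventually_cong) (use eventually_in_ultrafilters_on[OF \<omega>] in \<open>auto elim!: eventually_mono\<close>)
  then show ?thesis by simp
qed

lemma filtermap_bitranslation_in:
  assumes \<omega>: "\<omega> \<in> topspace (beta_remainder (carrier G))" and G: "s \<in> carrier G" "t \<in> carrier G"
  shows "filtermap (\<lambda>x. s \<otimes> x \<otimes> inv t) \<omega> \<in> topspace (beta_remainder (carrier G))"
proof -
  have \<omega>U: "\<omega> \<in> ultrafilters_on (carrier G)" using \<omega> by (simp add: topspace_beta_remainder)
  have "filtermap (\<lambda>x. s \<otimes> x \<otimes> inv t) \<omega> \<noteq> beta_point y" if y: "y \<in> carrier G" for y
  proof
    assume e: "filtermap (\<lambda>x. s \<otimes> x \<otimes> inv t) \<omega> = beta_point y"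
    have "eventually (\<lambda>z. z = y) (beta_point y)" by (simp add: beta_point_def eventually_principal)
    then have "eventually (\<lambda>x. s \<otimes> x \<otimes> inv t = y) \<omega>" unfolding e[symmetric] eventually_filtermap .
    moreover have "eventually (\<lambda>x. x \<notin> {inv s \<otimes> y \<otimes> t}) \<omega>" by (rule eventually_notin_finite[OF \<omega>]) simp
    ultimately have "eventually (\<lambda>x. False) \<omega>"
      using eventually_in_ultrafilters_on[OF \<omega>U]
    proof eventually_elim
      case (elim x)
      have xG: "x \<in> carrier G" using elim by blast
      have "inv s \<otimes> (s \<otimes> x \<otimes> inv t) \<otimes> t = x"
      proof -
        have "inv s \<otimes> (s \<otimes> x \<otimes> inv t) \<otimes> t = (inv s \<otimes> s) \<otimes> x \<otimes> (inv t \<otimes> t)"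
          using xG G by (simp only: m_assoc m_closed inv_closed)
        then show ?thesis using xG G by simp
      qed
      then show False using elim by auto
    qed
    then show False using \<omega>U by (simp add: ultrafilters_on_def)
  qed
  moreover have "filtermap (\<lambda>x. s \<otimes> x \<otimes> inv t) \<omega> \<in> ultrafilters_on (carrier G)"
    by (rule filtermap_ultrafilter[OF \<omega>U]) (use G in auto)
  ultimately show ?thesis by (auto simp: topspace_beta_remainder)
qed

lemma bitranslation_action: "action_by_homeomorphisms (G \<times>\<times> G) (beta_remainder (carrier G)) (bitranslation G)"
proof -
  define S where "S = topspace (beta_remainder (carrier G))"
  have U: "\<omega> \<in> ultrafilters_on (carrier G)" if "\<omega> \<in> S" for \<omega> using that by (simp add: S_def topspace_beta_remainder)
  have cl: "bitranslation G g \<omega> \<in> S" if "g \<in> carrier G \<times> carrier G" "\<omega> \<in> S" for g \<omega>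
    using that filtermap_bitranslation_in bitranslation_eq by (auto simp: S_def)
  have comp: "bitranslation G (s, t) (bitranslation G (s', t') \<omega>) = bitranslation G (s \<otimes> s', t \<otimes> t') \<omega>"
    if "s \<in> carrier G" "t \<in> carrier G" "s' \<in> carrier G" "t' \<in> carrier G" "\<omega> \<in> S" for s t s' t' \<omega>
    using that bitranslation_eq filtermap_bitranslation_in filtermap_bitranslation_comp[OF U] by (simp add: S_def)
  have one: "bitranslation G (\<one>, \<one>) \<omega> = \<omega>" if "\<omega> \<in> S" for \<omega>
    using that bitranslation_eq[of \<omega> \<one> \<one>] filtermap_bitranslation_one[OF U] by (simp add: S_def)
  have inv: "bitranslation G (inv s, inv t) (bitranslation G (s, t) \<omega>) = \<omega>"
    "bitranslation G (s, t) (bitranslation G (inv s, inv t) \<omega>) = \<omega>"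
    if "s \<in> carrier G" "t \<in> carrier G" "\<omega> \<in> S" for s t \<omega>
    using comp[of "inv s" "inv t" s t] comp[of s t "inv s" "inv t"] one that by simp_all
  have ext: "bitranslation G (s, t) \<in> extensional S" for s t by (simp add: bitranslation_def S_def)
  have cont: "continuous_map (beta_remainder (carrier G)) (beta_remainder (carrier G)) (bitranslation G (s, t))"
    if st: "s \<in> carrier G" "t \<in> carrier G" for s t
  proof -
    have "continuous_map (beta_remainder (carrier G)) (beta (carrier G)) (beta_extension (carrier G) (\<lambda>x. s \<otimes> x \<otimes> inv t))"
      unfolding beta_remainder_def
      by (intro continuous_map_from_subtopology beta_extension(1)) (use st in auto)
    then have "continuous_map (beta_remainder (carrier G)) (beta (carrier G)) (bitranslation G (s, t))"
      by (rule continuous_map_eq) (simp add: bitranslation_def)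
    moreover have "bitranslation G (s, t) \<in> topspace (beta_remainder (carrier G)) \<rightarrow> topspace (beta_remainder (carrier G))"
      using cl[of "(s, t)"] st by (auto simp: S_def)
    ultimately show ?thesis
      by (subst (2) beta_remainder_def) (auto simp: continuous_map_in_subtopology beta_remainder_def)
  qed
  have bij: "bij_betw (bitranslation G (s, t)) S S" if "s \<in> carrier G" "t \<in> carrier G" for s t
    by (rule bij_betwI[where g = "bitranslation G (inv s, inv t)"]) (use that cl inv in auto)
  have Bij: "bitranslation G (s, t) \<in> Bij S" if "s \<in> carrier G" "t \<in> carrier G" for s t
    using bij[OF that] ext by (simp add: Bij_def)
  have "group_hom (G \<times>\<times> G) (BijGroup S) (bitranslation G)"
  proof (intro group_hom.intro group_hom_axioms.intro DirProd_group group_BijGroup homI)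
    fix x y assume xy: "x \<in> carrier (G \<times>\<times> G)" "y \<in> carrier (G \<times>\<times> G)"
    obtain s t s' t' where e: "x = (s, t)" "y = (s', t')" "s \<in> carrier G" "t \<in> carrier G" "s' \<in> carrier G" "t' \<in> carrier G"
      using xy by (metis SigmaE carrier_DirProd)
    have "bitranslation G (s \<otimes> s', t \<otimes> t') = compose S (bitranslation G (s, t)) (bitranslation G (s', t'))"
      by (rule extensionalityI[OF ext compose_extensional]) (use comp e in \<open>simp add: compose_eq\<close>)
    then show "bitranslation G (x \<otimes>\<^bsub>G \<times>\<times> G\<^esub> y) = bitranslation G x \<otimes>\<^bsub>BijGroup S\<^esub> bitranslation G y"
      using e Bij by (simp add: BijGroup_def)
  qed (use Bij in \<open>auto simp: BijGroup_def is_group\<close>)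
  moreover have "homeomorphic_map (beta_remainder (carrier G)) (beta_remainder (carrier G)) (bitranslation G g)"
    if gG: "g \<in> carrier (G \<times>\<times> G)" for g
  proof -
    obtain s t where g: "g = (s, t)" "s \<in> carrier G" "t \<in> carrier G" using gG by auto
    have "homeomorphic_maps (beta_remainder (carrier G)) (beta_remainder (carrier G)) (bitranslation G (s, t)) (bitranslation G (inv s, inv t))"
      unfolding homeomorphic_maps_def using cont g inv by (simp add: S_def)
    then show ?thesis using g homeomorphic_map_maps by blast
  qed
  ultimately show ?thesis unfolding action_by_homeomorphisms_def group_action_def S_def by blast
qed

text \<open>It suffices to construct the means at the points of \<open>G\<close> outside a finite set, provided that
  they are combinations of finitely many fixed ones: the bounded coefficients extend to \<open>\<beta>G\<close>.\<close>

lemma amenable_bitranslation: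
  assumes approx: "\<And>S \<epsilon>. finite S \<Longrightarrow> S \<subseteq> carrier G \<Longrightarrow> 0 < (\<epsilon>::real) \<Longrightarrow>
    \<exists>(B :: 'v set) F \<zeta> m. finite B \<and> finite F \<and>
      (\<forall>x\<in>carrier G. (\<forall>v. 0 \<le> \<zeta> x v) \<and> sum (\<zeta> x) B = 1) \<and>
      (\<forall>v\<in>B. (\<forall>t. 0 \<le> m v t) \<and> (m v has_sum (1::real)) (carrier G)) \<and>
      (\<forall>s\<in>S. \<forall>t\<in>S. \<forall>x\<in>carrier G - F. l1_le (\<lambda>p. if p \<in> carrier G
       then (\<Sum>v\<in>B. \<zeta> x v * m v (inv s \<otimes> p)) - (\<Sum>v\<in>B. \<zeta> (s \<otimes> x \<otimes> t) v * m v p) else 0) \<epsilon>)"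
  shows "amenable_action (G \<times>\<times> G) (beta_remainder (carrier G)) (bitranslation G)"
  unfolding amenable_action_def
proof (intro conjI allI impI compact_space_beta_remainder bitranslation_action)
  show "Hausdorff_space (beta_remainder (carrier G))"
    unfolding beta_remainder_def by (intro Hausdorff_space_subtopology Hausdorff_space_beta)
  fix E and \<epsilon> :: real assume E: "finite E" "E \<subseteq> carrier (G \<times>\<times> G)" and \<epsilon>: "0 < \<epsilon>"
  \<comment> \<open>Inverses are included because \<open>s x t^-1\<close> and its inverse
    \<open>t x^-1 s^-1\<close> are both to be compared.\<close>
  define S where "S = fst ` E \<union> snd ` E \<union> (\<lambda>s. inv s) ` (fst ` E \<union> snd ` E)"
  have S: "finite S" "S \<subseteq> carrier G" using E by (auto simp: S_def)
  obtain B :: "'v set" and F \<zeta> m where fin: "finite B" "finite F"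
    and prob\<zeta>: "\<forall>x\<in>carrier G. (\<forall>v. 0 \<le> \<zeta> x v) \<and> sum (\<zeta> x) B = 1"
    and prob_m: "\<forall>v\<in>B. (\<forall>t. 0 \<le> m v t) \<and> (m v has_sum (1::real)) (carrier G)"
    and inv\<zeta>: "\<forall>s\<in>S. \<forall>t\<in>S. \<forall>x\<in>carrier G - F. l1_le (\<lambda>p. if p \<in> carrier G
       then (\<Sum>v\<in>B. \<zeta> x v * m v (inv s \<otimes> p)) - (\<Sum>v\<in>B. \<zeta> (s \<otimes> x \<otimes> t) v * m v p) else 0) (\<epsilon> / 2)"
    using approx[OF S half_gt_zero[OF \<epsilon>]] by (elim exE conjE) (rule that; assumption)
  note * = fin bspec[OF prob\<zeta>] bspec[OF prob_m] bspec[OF bspec[OF bspec[OF inv\<zeta>]]]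
  have \<zeta>01: "0 \<le> \<zeta> x v \<and> \<zeta> x v \<le> 1" if "x \<in> carrier G" "v \<in> B" for x v
    using *(3)[OF that(1)] member_le_sum[OF that(2), of "\<zeta> x"] *(1) by simp
  \<comment> \<open>Coefficients of the product mean: the factor from \<open>x\<close> handles
    \<open>s\<close>, the one from \<open>inv x\<close> handles \<open>t\<close>.\<close>
  define c where "c v w x = \<zeta> x v * \<zeta> (inv x) w" for v w x
  have c01: "0 \<le> c v w x \<and> c v w x \<le> 1" if "x \<in> carrier G" "v \<in> B" "w \<in> B" for v w x
    using \<zeta>01[of x v] \<zeta>01[of "inv x" w] that by (auto simp: c_def intro: mult_le_one)
  define \<nu> where "\<nu> x p = (\<Sum>v\<in>B. \<zeta> x v * m v p)" for x p
  define \<mu> where "\<mu> \<omega> = (\<lambda>p\<in>carrier G \<times> carrier G.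
    \<Sum>(v, w)\<in>B \<times> B. Lim \<omega> (c v w) * (m v (fst p) * m w (snd p)))" for \<omega>
  let ?R = "beta_remainder (carrier G)"
  have RU: "\<omega> \<in> ultrafilters_on (carrier G)" if "\<omega> \<in> topspace ?R" for \<omega>
    using that by (simp add: topspace_beta_remainder)
  have lim: "((\<lambda>x. c v w x) \<longlongrightarrow> Lim \<omega> (c v w)) \<omega>" if "\<omega> \<in> topspace ?R" "v \<in> B" "w \<in> B" for \<omega> v w
    by (rule ultrafilter_tendsto[OF RU[OF that(1)], of 0 _ 1]) (use c01 that in auto)
  have \<mu>lim: "((\<lambda>x. \<nu> x p * \<nu> (inv x) q) \<longlongrightarrow> \<mu> \<omega> (p, q)) \<omega>"
    if "\<omega> \<in> topspace ?R" "p \<in> carrier G" "q \<in> carrier G" for \<omega> p q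
  proof -
    have "\<nu> x p * \<nu> (inv x) q = (\<Sum>(v, w)\<in>B \<times> B. c v w x * (m v p * m w q))" for x
      by (simp add: \<nu>_def sum_product sum.cartesian_product c_def mult_ac)
    moreover have "((\<lambda>x. \<Sum>(v, w)\<in>B \<times> B. c v w x * (m v p * m w q)) \<longlongrightarrow> \<mu> \<omega> (p, q)) \<omega>"
      unfolding \<mu>_def using that lim by (auto simp: case_prod_unfold intro!: tendsto_intros)
    ultimately show ?thesis by simp
  qed
  have Lim0: "0 \<le> Lim \<omega> (c v w)" if "\<omega> \<in> topspace ?R" "v \<in> B" "w \<in> B" for \<omega> v w
  proof -
    have "eventually (\<lambda>x. 0 \<le> c v w x \<and> c v w x \<le> 1) \<omega>"
      using eventually_in_ultrafilters_on[OF RU[OF that(1)]] by (rule eventually_mono) (use c01 that in auto)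
    from Lim_ultrafilter_bounds[OF RU[OF that(1)] _ this, of 0 1] c01 that show ?thesis by blast
  qed
  have Lim1: "(\<Sum>(v, w)\<in>B \<times> B. Lim \<omega> (c v w)) = 1" if \<omega>: "\<omega> \<in> topspace ?R" for \<omega>
  proof -
    have "((\<lambda>x. \<Sum>(v, w)\<in>B \<times> B. c v w x) \<longlongrightarrow> (\<Sum>(v, w)\<in>B \<times> B. Lim \<omega> (c v w))) \<omega>"
      using lim[OF \<omega>] by (auto simp: case_prod_unfold intro!: tendsto_intros)
    moreover have "eventually (\<lambda>x. (\<Sum>(v, w)\<in>B \<times> B. c v w x) = 1) \<omega>"
      using eventually_in_ultrafilters_on[OF RU[OF \<omega>]]
    proof (rule eventually_mono)
      fix x assume x: "x \<in> carrier G"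
      have "(\<Sum>(v, w)\<in>B \<times> B. c v w x) = sum (\<zeta> x) B * sum (\<zeta> (inv x)) B"
        by (simp add: c_def sum_product sum.cartesian_product)
      then show "(\<Sum>(v, w)\<in>B \<times> B. c v w x) = 1" using *(3) x by simp
    qed
    then have "((\<lambda>x. \<Sum>(v, w)\<in>B \<times> B. c v w x) \<longlongrightarrow> 1) \<omega>" by (rule tendsto_eventually)
    moreover have "\<omega> \<noteq> bot" using RU[OF \<omega>] by (simp add: ultrafilters_on_def)
    ultimately show ?thesis using tendsto_unique by blast
  qed
  have prob: "\<mu> \<omega> \<in> Prob (G \<times>\<times> G)" if \<omega>: "\<omega> \<in> topspace ?R" for \<omega>
  proof -
    have "0 \<le> (\<Sum>(v, w)\<in>B \<times> B. Lim \<omega> (c v w) * (m v (fst p) * m w (snd p)))" for p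
      using *(4) Lim0[OF \<omega>] by (auto intro!: sum_nonneg mult_nonneg_nonneg)
    then have 1: "\<mu> \<omega> \<in> carrier G \<times> carrier G \<rightarrow>\<^sub>E {0..}" by (auto simp: \<mu>_def)
    have "((\<lambda>p. \<Sum>x\<in>B \<times> B. Lim \<omega> (c (fst x) (snd x)) * (\<lambda>(p, q). m (fst x) p * m (snd x) q) p) has_sum
        (\<Sum>x\<in>B \<times> B. Lim \<omega> (c (fst x) (snd x)) * (1 * 1))) (carrier G \<times> carrier G)"
      by (intro has_sum_sum_finite has_sum_cmult_right has_sum_product_nonneg) (use *(4) in auto)
    then have "(\<mu> \<omega> has_sum 1) (carrier G \<times> carrier G)"
      using Lim1[OF \<omega>] by (subst has_sum_cong) (auto simp: \<mu>_def case_prod_unfold)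
    with 1 show ?thesis by (simp add: Prob_def)
  qed
  have cont: "continuous_map ?R (Prob_topology (G \<times>\<times> G)) \<mu>"
    unfolding Prob_topology_def continuous_map_in_subtopology
  proof
    show "continuous_map ?R (product_topology (\<lambda>_. euclideanreal) (carrier (G \<times>\<times> G))) \<mu>"
      unfolding continuous_map_componentwise
    proof (intro conjI ballI)
      show "\<mu> ` topspace ?R \<subseteq> extensional (carrier (G \<times>\<times> G))" by (auto simp: \<mu>_def)
      fix p assume p: "p \<in> carrier (G \<times>\<times> G)"
      have "continuous_map ?R euclideanreal (\<lambda>\<omega>. Lim \<omega> (c v w))" if "v \<in> B" "w \<in> B" for v w
        unfolding beta_remainder_def
        by (intro continuous_map_from_subtopology continuous_map_Lim[of _ 0 _ 1]) (use c01 that in auto)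
      then have "continuous_map ?R euclideanreal (\<lambda>\<omega>. \<Sum>x\<in>B \<times> B. Lim \<omega> (c (fst x) (snd x)) * (m (fst x) (fst p) * m (snd x) (snd p)))"
        by (intro continuous_map_sum continuous_map_real_mult_right) (use *(1) in auto)
      then show "continuous_map ?R euclideanreal (\<lambda>\<omega>. \<mu> \<omega> p)" using p by (simp add: \<mu>_def case_prod_unfold)
    qed
    show "\<mu> \<in> topspace ?R \<rightarrow> Prob (G \<times>\<times> G)" using prob by auto
  qed
  have \<nu>1: "l1_le (\<lambda>p. if p \<in> carrier G then \<nu> x p else 0) 1" if x: "x \<in> carrier G" for x
  proof (rule l1_le_has_sum)
    show "0 \<le> \<nu> x p" for p unfolding \<nu>_def using *(3)[OF x] *(4) by (auto intro!: sum_nonneg)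
    have "((\<lambda>p. \<Sum>v\<in>B. \<zeta> x v * m v p) has_sum (\<Sum>v\<in>B. \<zeta> x v * 1)) (carrier G)"
      by (intro has_sum_sum_finite has_sum_cmult_right) (use *(4) in auto)
    then show "(\<nu> x has_sum 1) (carrier G)" using *(3)[OF x] unfolding \<nu>_def[abs_def] by simp
  qed
  have main: "l1_norm (G \<times>\<times> G) (\<lambda>r. left_translate (G \<times>\<times> G) st (\<mu> \<omega>) r - \<mu> (bitranslation G st \<omega>) r) \<le> \<epsilon>"
    if st: "st \<in> E" and \<omega>: "\<omega> \<in> topspace ?R" for st \<omega>
  proof -
    obtain s t where e: "st = (s, t)" by force
    have G: "s \<in> carrier G" "t \<in> carrier G" using st E by (auto simp: e)
    have sS: "s \<in> S" "t \<in> S" "inv s \<in> S" "inv t \<in> S" using st unfolding S_def e by force+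
    define f where "f x = s \<otimes> x \<otimes> inv t" for x
    define \<omega>' where "\<omega>' = bitranslation G st \<omega>"
    have \<omega>'e: "\<omega>' = filtermap f \<omega>" unfolding \<omega>'_def f_def[abs_def] e by (rule bitranslation_eq[OF \<omega> G])
    have \<omega>': "\<omega>' \<in> topspace ?R" unfolding \<omega>'e f_def[abs_def] by (rule filtermap_bitranslation_in[OF \<omega> G])
    \<comment> \<open>The defect of equivariance at the point \<open>x\<close>. Its limit along
      \<omega> is the defect \<open>L\<close> of \<mu> at \<omega>, and bounds for sums over finite
      sets survive the limit.\<close>
    define D where "D x r = \<nu> x (inv s \<otimes> fst r) * \<nu> (inv x) (inv t \<otimes> snd r) - \<nu> (f x) (fst r) * \<nu> (inv (f x)) (snd r)" for x r
    define L where "L r = \<mu> \<omega> (inv s \<otimes> fst r, inv t \<otimes> snd r) - \<mu> \<omega>' r" for r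
    have Dlim: "((\<lambda>x. D x r) \<longlongrightarrow> L r) \<omega>" if r: "r \<in> carrier G \<times> carrier G" for r
    proof -
      have "((\<lambda>x. \<nu> x (fst r) * \<nu> (inv x) (snd r)) \<longlongrightarrow> \<mu> \<omega>' r) \<omega>'"
        using \<mu>lim[OF \<omega>', of "fst r" "snd r"] r by auto
      then have "((\<lambda>x. \<nu> (f x) (fst r) * \<nu> (inv (f x)) (snd r)) \<longlongrightarrow> \<mu> \<omega>' r) \<omega>"
        unfolding \<omega>'e filterlim_filtermap .
      moreover have "((\<lambda>x. \<nu> x (inv s \<otimes> fst r) * \<nu> (inv x) (inv t \<otimes> snd r)) \<longlongrightarrow> \<mu> \<omega> (inv s \<otimes> fst r, inv t \<otimes> snd r)) \<omega>"
        by (rule \<mu>lim[OF \<omega>]) (use r G in auto)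
      ultimately show ?thesis unfolding D_def L_def by (intro tendsto_diff)
    qed
    have Dle: "(\<Sum>r\<in>T. \<bar>D x r\<bar>) \<le> \<epsilon>"
      if T: "finite T" "T \<subseteq> carrier G \<times> carrier G" and x: "x \<in> carrier G" "x \<notin> F" "inv x \<notin> F" for T x
    proof -
      have fx: "f x \<in> carrier G" "inv (f x) = t \<otimes> inv x \<otimes> inv s"
        using G x by (simp_all add: f_def inv_mult_group m_assoc)
      \<comment> \<open>The difference of products splits as \<open>a\<close> times
        \<open>n'\<close> plus \<open>n\<close> times \<open>a'\<close>: the two defects have mass
        at most \<open>\<epsilon> / 2\<close>, the other factors at most 1.\<close>
      define a where "a p = (if p \<in> carrier G then \<nu> x (inv s \<otimes> p) - \<nu> (f x) p else 0)" for p
      define a' where "a' q = (if q \<in> carrier G then \<nu> (inv x) (inv t \<otimes> q) - \<nu> (inv (f x)) q else 0)" for q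
      define n where "n p = (if p \<in> carrier G then \<nu> (f x) p else 0)" for p
      define n' where "n' q = (if q \<in> carrier G then (\<lambda>q. if q \<in> carrier G then \<nu> (inv x) q else 0) (inv t \<otimes> q) else 0)" for q
      have a: "l1_le a (\<epsilon> / 2)" unfolding a_def \<nu>_def f_def using *(5)[OF sS(1,4)] x by simp
      have a': "l1_le a' (\<epsilon> / 2)" unfolding a'_def \<nu>_def fx(2) using *(5)[OF sS(2,3), of "inv x"] x by simp
      have n: "l1_le n 1" unfolding n_def by (rule \<nu>1[OF fx(1)])
      have "l1_le n' 1" unfolding n'_def
        by (rule l1_le_reindex[OF \<nu>1]) (use x G in \<open>auto simp: inj_on_def\<close>)
      then have "l1_le (\<lambda>r. (case r of (p, q) \<Rightarrow> a p * n' q) + (case r of (p, q) \<Rightarrow> n p * a' q)) (\<epsilon> / 2 * 1 + 1 * (\<epsilon> / 2))"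
        by (intro l1_le_add l1_le_product a a' n)
      then have "(\<Sum>r\<in>T. \<bar>(case r of (p, q) \<Rightarrow> a p * n' q) + (case r of (p, q) \<Rightarrow> n p * a' q)\<bar>) \<le> \<epsilon> / 2 * 1 + 1 * (\<epsilon> / 2)"
        using T(1) by (rule l1_leD)
      moreover have "D x r = (case r of (p, q) \<Rightarrow> a p * n' q) + (case r of (p, q) \<Rightarrow> n p * a' q)" if rT: "r \<in> T" for r
      proof -
        obtain p q where r: "r = (p, q)" "p \<in> carrier G" "q \<in> carrier G" using T(2) rT by blast
        then show ?thesis using G by (simp add: D_def a_def a'_def n_def n'_def algebra_simps)
      qed
      ultimately show ?thesis by (simp add: field_simps)
    qed
    have Lle: "(\<Sum>r\<in>T. \<bar>L r\<bar>) \<le> \<epsilon>" if T: "finite T" "T \<subseteq> carrier G \<times> carrier G" for T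
    proof (rule tendsto_upperbound)
      show "((\<lambda>x. \<Sum>r\<in>T. \<bar>D x r\<bar>) \<longlongrightarrow> (\<Sum>r\<in>T. \<bar>L r\<bar>)) \<omega>"
        using Dlim T(2) by (intro tendsto_sum tendsto_rabs) auto
      show "\<omega> \<noteq> bot" using RU[OF \<omega>] by (simp add: ultrafilters_on_def)
      \<comment> \<open>Both \<open>x\<close> and its inverse have to avoid the exceptional
        set.\<close>
      have "eventually (\<lambda>x. x \<notin> F \<union> (\<lambda>x. inv x) ` F) \<omega>"
        by (rule eventually_notin_finite[OF \<omega>]) (use *(2) in auto)
      with eventually_in_ultrafilters_on[OF RU[OF \<omega>]] show "eventually (\<lambda>x. (\<Sum>r\<in>T. \<bar>D x r\<bar>) \<le> \<epsilon>) \<omega>"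
      proof eventually_elim
        case (elim x)
        have "inv x \<notin> F"
        proof
          assume "inv x \<in> F"
          then have "inv (inv x) \<in> (\<lambda>x. inv x) ` F" by blast
          then show False using elim by simp
        qed
        then show ?case using Dle[OF T] elim by simp
      qed
    qed
    have "l1_norm (G \<times>\<times> G) (\<lambda>r. left_translate (G \<times>\<times> G) st (\<mu> \<omega>) r - \<mu> (bitranslation G st \<omega>) r)
        = infsum (\<lambda>r. \<bar>L r\<bar>) (carrier G \<times> carrier G)"
      unfolding l1_norm_def carrier_DirProd
    proof (rule infsum_cong)
      fix r assume r: "r \<in> carrier G \<times> carrier G"
      have "inv\<^bsub>G \<times>\<times> G\<^esub> (s, t) = (inv s, inv t)" by (rule inv_DirProd[OF is_group is_group G])
      then show "\<bar>left_translate (G \<times>\<times> G) st (\<mu> \<omega>) r - \<mu> (bitranslation G st \<omega>) r\<bar> = \<bar>L r\<bar>"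
        using r by (simp add: left_translate_def L_def e mult_DirProd' flip: \<omega>'_def[unfolded e])
    qed
    \<comment> \<open>Without summability the sum is 0 by convention.\<close>
    also have "\<dots> \<le> \<epsilon>"
    proof (cases "(\<lambda>r. \<bar>L r\<bar>) summable_on (carrier G \<times> carrier G)")
      case True
      then show ?thesis by (rule infsum_le_finite_sums) (rule Lle)
    next
      case False
      then show ?thesis using \<epsilon> by (simp add: infsum_not_exists)
    qed
    finally show ?thesis .
  qed
  show "\<exists>\<mu>. continuous_map ?R (Prob_topology (G \<times>\<times> G)) \<mu> \<and>
    (\<forall>s\<in>E. \<forall>\<omega>\<in>topspace ?R. l1_norm (G \<times>\<times> G)
      (\<lambda>r. left_translate (G \<times>\<times> G) s (\<mu> \<omega>) r - \<mu> (bitranslation G s \<omega>) r) \<le> \<epsilon>)"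
    using cont main by blast
qed

end

theorem mainTheorem4:
  fixes \<Gamma> :: "('a, 'b) monoid_scheme" and \<G> :: "'a set set"
  assumes "group \<Gamma>"
    and "relatively_hyperbolic TYPE('v) \<Gamma> \<G>"
    and "\<forall>H\<in>\<G>. subgroup H \<Gamma> \<and> amenable_group (\<Gamma>\<lparr>carrier := H\<rparr>)"
  shows "amenable_action (\<Gamma> \<times>\<times> \<Gamma>) (beta_remainder (carrier \<Gamma>)) (bitranslation \<Gamma>)"
proof -
  interpret group \<Gamma> by fact
  obtain V :: "'v set" and E \<phi> where K: "graph V E" "connected_graph V E" "fine_graph V E" "hyperbolic_graph V E"
    "graph_action \<Gamma> V E \<phi>" "finite (orbits \<Gamma> E (edge_action \<phi>))"
    "\<forall>e\<in>E. finite (stabilizer \<Gamma> (edge_action \<phi>) e)"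
    "{stabilizer \<Gamma> \<phi> v | v. v \<in> V \<and> infinite (stabilizer \<Gamma> \<phi> v)} = \<G>"
    using assms(2) unfolding relatively_hyperbolic_def by blast
  have act: "group_action \<Gamma> V \<phi>" using K(5) by (simp add: graph_action_def)
  have am: "finite (stabilizer \<Gamma> \<phi> v) \<or> amenable_group (\<Gamma>\<lparr>carrier := stabilizer \<Gamma> \<phi> v\<rparr>)" if "v \<in> V" for v
    using assms(3) K(8) that by blast
  interpret C: simple_connected_graph V E by unfold_locales (fact K)+
  obtain \<delta> where "edge_cofinite_action V (graph_dist V E) \<delta> \<Gamma> \<phi>"
    using edge_cofinite_action_of_graph_action[OF assms(1) K(1-7)] by blast
  then interpret A: edge_cofinite_action V "graph_dist V E" \<delta> \<Gamma> \<phi> .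
  obtain z where z: "z \<in> V" using K(2) by (auto simp: connected_graph_def)
  have vertex: "\<exists>B F \<zeta>. finite B \<and> B \<subseteq> V \<and> finite F \<and>
    (\<forall>x\<in>carrier \<Gamma>. (\<forall>v. 0 \<le> \<zeta> x v) \<and> (\<forall>v. v \<notin> B \<longrightarrow> \<zeta> x v = 0) \<and> sum (\<zeta> x) B = 1) \<and>
    (\<forall>s\<in>S. \<forall>t\<in>S. \<forall>x\<in>carrier \<Gamma> - F.
      l1_le (\<lambda>v. if v \<in> V then \<zeta> x v - \<zeta> (s \<otimes>\<^bsub>\<Gamma>\<^esub> x \<otimes>\<^bsub>\<Gamma>\<^esub> t) (\<phi> s v) else 0) \<epsilon>)"
    if S: "finite S" "S \<subseteq> carrier \<Gamma>" and \<epsilon>: "0 < (\<epsilon>::real)" for S \<epsilon>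
  proof (cases "\<exists>u b. u \<in> V \<and> b \<in> V \<and> graph_dist V E u b = 1")
    case True
    then obtain u b where ub: "u \<in> V" "b \<in> V" "graph_dist V E u b = 1" by blast
    show ?thesis by (rule A.approximately_invariant_vertex_measures[OF ub S \<epsilon>])
  next
    case False
    \<comment> \<open>A connected graph without edges is a point. The whole group fixes it, and the
      point mass is invariant.\<close>
    have "v = z" if v: "v \<in> V" for v
    proof (rule ccontr)
      assume "v \<noteq> z"
      then have n: "1 \<le> graph_dist V E v z" using C.d_eq_0[OF v z] by simp
      obtain g where g: "C.geod g v z" using A.geod_ex[OF v z] by blast
      have "graph_dist V E (g 0) (g 1) = 1" "g 0 \<in> V" "g 1 \<in> V"
        using C.geodD(4)[OF g, of 0 1] C.geodD(3)[OF g, of 0] C.geodD(3)[OF g, of 1] n by auto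
      then show False using False by blast
    qed
    then have V: "V = {z}" using z by blast
    have fixed: "\<phi> s z = z" if "s \<in> carrier \<Gamma>" for s using A.act_closed[OF that z] V by simp
    define \<zeta> :: "'a \<Rightarrow> 'v \<Rightarrow> real" where "\<zeta> x v = (if v = z then 1 else 0)" for x v
    have "(\<lambda>v. if v \<in> V then \<zeta> x v - \<zeta> y (\<phi> s v) else 0) = (\<lambda>v. 0)" if "s \<in> S" for s x y
      using fixed S(2) that V by (auto simp: \<zeta>_def fun_eq_iff)
    then have inv: "\<forall>s\<in>S. \<forall>t\<in>S. \<forall>x\<in>carrier \<Gamma> - {}.
      l1_le (\<lambda>v. if v \<in> V then \<zeta> x v - \<zeta> (s \<otimes>\<^bsub>\<Gamma>\<^esub> x \<otimes>\<^bsub>\<Gamma>\<^esub> t) (\<phi> s v) else 0) \<epsilon>"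
      using \<epsilon> by (simp add: l1_le_0)
    have prob: "\<forall>x\<in>carrier \<Gamma>. (\<forall>v. 0 \<le> \<zeta> x v) \<and> (\<forall>v. v \<notin> {z} \<longrightarrow> \<zeta> x v = 0) \<and> sum (\<zeta> x) {z} = 1"
      by (simp add: \<zeta>_def)
    show ?thesis
    proof (rule exI[of _ "{z}"], rule exI[of _ "{}"], rule exI[of _ \<zeta>], intro conjI)
      show "{z} \<subseteq> V" using z by simp
    qed (use prob inv in \<open>simp_all only: finite.intros\<close>)
  qed
  show ?thesis
  proof (rule amenable_bitranslation[where 'v = 'v])
    fix S and \<epsilon> :: real assume S: "finite S" "S \<subseteq> carrier \<Gamma>" and \<epsilon>: "0 < \<epsilon>"
    obtain B F \<zeta> where B: "finite B" "B \<subseteq> V" and F: "finite F"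
      and prob: "\<forall>x\<in>carrier \<Gamma>. (\<forall>v. 0 \<le> \<zeta> x v) \<and> (\<forall>v. v \<notin> B \<longrightarrow> \<zeta> x v = 0) \<and> sum (\<zeta> x) B = 1"
      and inv: "\<forall>s\<in>S. \<forall>t\<in>S. \<forall>x\<in>carrier \<Gamma> - F.
        l1_le (\<lambda>v. if v \<in> V then \<zeta> x v - \<zeta> (s \<otimes>\<^bsub>\<Gamma>\<^esub> x \<otimes>\<^bsub>\<Gamma>\<^esub> t) (\<phi> s v) else 0) (\<epsilon> / 2)"
      using vertex[OF S half_gt_zero[OF \<epsilon>]] by (elim exE conjE) (rule that; assumption)
    have "\<exists>m. (\<forall>v\<in>V. (\<forall>t. 0 \<le> m v t) \<and> (m v has_sum (1::real)) (carrier \<Gamma>)) \<and>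
      (\<forall>s\<in>S. \<forall>t\<in>S. \<forall>x\<in>carrier \<Gamma> - F. l1_le (\<lambda>p. if p \<in> carrier \<Gamma>
       then (\<Sum>v\<in>B. \<zeta> x v * m v (inv\<^bsub>\<Gamma>\<^esub> s \<otimes>\<^bsub>\<Gamma>\<^esub> p)) - (\<Sum>v\<in>B. \<zeta> (s \<otimes>\<^bsub>\<Gamma>\<^esub> x \<otimes>\<^bsub>\<Gamma>\<^esub> t) v * m v p) else 0) (2 * (\<epsilon> / 2)))"
      by (rule approximately_invariant_means[OF act _ B S half_gt_zero[OF \<epsilon>]])
        (fact am, rule bspec[OF prob], assumption, rule bspec[OF bspec[OF bspec[OF inv]]], assumption+)
    then obtain m where m: "\<forall>v\<in>V. (\<forall>t. 0 \<le> m v t) \<and> (m v has_sum (1::real)) (carrier \<Gamma>)"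
      "\<forall>s\<in>S. \<forall>t\<in>S. \<forall>x\<in>carrier \<Gamma> - F. l1_le (\<lambda>p. if p \<in> carrier \<Gamma>
       then (\<Sum>v\<in>B. \<zeta> x v * m v (inv\<^bsub>\<Gamma>\<^esub> s \<otimes>\<^bsub>\<Gamma>\<^esub> p)) - (\<Sum>v\<in>B. \<zeta> (s \<otimes>\<^bsub>\<Gamma>\<^esub> x \<otimes>\<^bsub>\<Gamma>\<^esub> t) v * m v p) else 0) (2 * (\<epsilon> / 2))"
      by (elim exE conjE) (rule that; assumption)
    show "\<exists>(B :: 'v set) F \<zeta> m. finite B \<and> finite F \<and>
      (\<forall>x\<in>carrier \<Gamma>. (\<forall>v. 0 \<le> \<zeta> x v) \<and> sum (\<zeta> x) B = 1) \<and>
      (\<forall>v\<in>B. (\<forall>t. 0 \<le> m v t) \<and> (m v has_sum (1::real)) (carrier \<Gamma>)) \<and>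
      (\<forall>s\<in>S. \<forall>t\<in>S. \<forall>x\<in>carrier \<Gamma> - F. l1_le (\<lambda>p. if p \<in> carrier \<Gamma>
       then (\<Sum>v\<in>B. \<zeta> x v * m v (inv\<^bsub>\<Gamma>\<^esub> s \<otimes>\<^bsub>\<Gamma>\<^esub> p)) - (\<Sum>v\<in>B. \<zeta> (s \<otimes>\<^bsub>\<Gamma>\<^esub> x \<otimes>\<^bsub>\<Gamma>\<^esub> t) v * m v p) else 0) \<epsilon>)"
    proof (intro exI conjI)
      show "finite B" "finite F" by fact+
      show "\<forall>x\<in>carrier \<Gamma>. (\<forall>v. 0 \<le> \<zeta> x v) \<and> sum (\<zeta> x) B = 1" using prob by simp
      show "\<forall>v\<in>B. (\<forall>t. 0 \<le> m v t) \<and> (m v has_sum (1::real)) (carrier \<Gamma>)" using m(1) B(2) by (simp add: subset_iff)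
      show "\<forall>s\<in>S. \<forall>t\<in>S. \<forall>x\<in>carrier \<Gamma> - F. l1_le (\<lambda>p. if p \<in> carrier \<Gamma>
       then (\<Sum>v\<in>B. \<zeta> x v * m v (inv\<^bsub>\<Gamma>\<^esub> s \<otimes>\<^bsub>\<Gamma>\<^esub> p)) - (\<Sum>v\<in>B. \<zeta> (s \<otimes>\<^bsub>\<Gamma>\<^esub> x \<otimes>\<^bsub>\<Gamma>\<^esub> t) v * m v p) else 0) \<epsilon>"
        using m(2) by simp
    qed
  qed
qed

end
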